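(* Assume $(\alpha,\beta)\in[-\frac{\pi}{2},\frac{\pi}{2}]^2$. Then $S_{\text{opt}}(\alpha,\beta)$ contains a unique $C^\infty$ curve $c_1(\alpha,\beta)$. Moreover, the following hold. (i) If $|\alpha-\beta|<\pi$, then $S_{\text{opt}}(\alpha,\beta)=\{c_1(\alpha,\beta)\}$. (ii) If $|\alpha-\beta|=\pi$, then every curve in $S_{\text{opt}}(\alpha,\beta)$ is $C^2$. (iii) If $(\alpha,\beta)\neq(0,0)$, then there exist $t_1<t_2<t_1+2\pi$ such that $c_1(\alpha,\beta)$ is directly similar to $R_{[t_1,t_2]}$.
   Context: A curve is a function $f:[a,b]\to\mathbb{C}$ whose derivative $f'$ is absolutely continuous and non-vanishing. Its bending energy is $\|f\|^2:=\frac14\int_0^{\mathcal{L}}\kappa^2\,ds$, where $\mathcal{L}$ is the arclength of $f$ and $\kappa$ its signed curvature as a function of arclength $s$ (the value $+\infty$ is allowed). Two curves are equivalent if they have the same arclength parametrization; $f$ and $g$ are directly similar if there is a map $T(z)=c_1z+c_2$ ($c_1,c_2\in\mathbb{C}$, $c_1\ne0$) such that $f$ and $T\circ g$ are equivalent. An s-curve is a curve which first turns monotonically at most $180^\circ$ in one direction (either counter-clockwise or clockwise) and then turns monotonically at most $180^\circ$ in the opposite direction; that is, for a continuous tangent angle $\theta$ of $f'$ there is $c\in[a,b]$ such that $\theta$ is monotone on $[a,c]$ and monotone in the opposite sense on $[c,b]$, with total change at most $\pi$ in magnitude on each of the two intervals. For angles $\alpha,\beta$, $S(\alpha,\beta)$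 is the set of all s-curves $f:[a,b]\to\mathbb{C}$ with $f(a)=0$, $f'(a)/|f'(a)|=e^{i\alpha}$, $f(b)=1$, $f'(b)/|f'(b)|=e^{i\beta}$. $S_{\text{opt}}(\alpha,\beta)$ is the set of all arclength parametrized curves in $S(\alpha,\beta)$ whose bending energy is minimal among curves in $S(\alpha,\beta)$ (arclength parametrized curves are taken to be defined on $[0,\mathcal{L}]$). $R(t)=\sin t+i\,\xi(t)$, $t\in\mathbb{R}$, where $\xi'(t)=\frac{\sin^2 t}{\sqrt{1+\sin^2 t}}$, $\xi(0)=0$ (rectangular elastica); $R_{[t_1,t_2]}$ denotes the restriction of $R$ to $[t_1,t_2]$. *)

theory Defs
  imports "HOL-Analysis.Analysis"
begin

definition absolutely_continuous_on :: "real set \<Rightarrow> (real \<Rightarrow> 'a::real_normed_vector) \<Rightarrow> bool" where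
  "absolutely_continuous_on S g \<longleftrightarrow>
     (\<forall>e>0. \<exists>d>0. \<forall>D. D division_of (\<Union>D) \<and> (\<Union>D) \<subseteq> S \<and> (\<Sum>K\<in>D. measure lborel K) < d \<longrightarrow>
        (\<Sum>K\<in>D. norm (g (Sup K) - g (Inf K))) < e)"

text \<open>A function on the interval from \<open>a\<close> to \<open>b\<close> is the triple \<open>(a, b, f)\<close>. Curves are required to be
  \<open>extensional\<close>, so that two curves with the same domain and the same values there are equal.
  All derivatives are taken within the closed domain, hence one-sided at its ends.\<close>

type_synonym curve = "real \<times> real \<times> (real \<Rightarrow> complex)"

definition deriv_on :: "real \<Rightarrow> real \<Rightarrow> (real \<Rightarrow> complex) \<Rightarrow> real \<Rightarrow> complex" where
  "deriv_on a b f t = vector_derivative f (at t within {a..b})"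

fun is_curve :: "curve \<Rightarrow> bool" where
  "is_curve (a, b, f) \<longleftrightarrow>
     a < b \<and> f \<in> extensional {a..b} \<and>
     f differentiable_on {a..b} \<and>
     absolutely_continuous_on {a..b} (deriv_on a b f) \<and>
     (\<forall>t\<in>{a..b}. deriv_on a b f t \<noteq> 0)"

fun C_k :: "nat \<Rightarrow> curve \<Rightarrow> bool" where
  "C_k k (a, b, f) \<longleftrightarrow>
     (\<forall>j<k. ((deriv_on a b ^^ j) f) differentiable_on {a..b}) \<and>
     continuous_on {a..b} ((deriv_on a b ^^ k) f)"

definition C_infinity :: "curve \<Rightarrow> bool" where
  "C_infinity c \<longleftrightarrow> (\<forall>k. C_k k c)"

fun arclength_fun :: "curve \<Rightarrow> real \<Rightarrow> real" where
  "arclength_fun (a, b, f) t = integral {a..t} (\<lambda>u. norm (deriv_on a b f u))"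

fun arclength :: "curve \<Rightarrow> real" where
  "arclength (a, b, f) = arclength_fun (a, b, f) b"

fun arclength_param :: "curve \<Rightarrow> curve" where
  "arclength_param (a, b, f) =
     (0, arclength (a, b, f),
      restrict (\<lambda>s. f (inv_into {a..b} (arclength_fun (a, b, f)) s)) {0..arclength (a, b, f)})"

definition equivalent :: "curve \<Rightarrow> curve \<Rightarrow> bool" where
  "equivalent c d \<longleftrightarrow> arclength_param c = arclength_param d"

fun arclength_parametrized :: "curve \<Rightarrow> bool" where
  "arclength_parametrized (a, b, f) \<longleftrightarrow> a = 0 \<and> (\<forall>t\<in>{a..b}. norm (deriv_on a b f t) = 1)"

fun affine_image :: "complex \<Rightarrow> complex \<Rightarrow> curve \<Rightarrow> curve" where
  "affine_image c1 c2 (a, b, f) = (a, b, restrict (\<lambda>t. c1 * f t + c2) {a..b})"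

definition directly_similar :: "curve \<Rightarrow> curve \<Rightarrow> bool" where
  "directly_similar c d \<longleftrightarrow> (\<exists>c1 c2. c1 \<noteq> 0 \<and> equivalent c (affine_image c1 c2 d))"

text \<open>With \<open>F\<close> the arclength parametrization and \<open>F' = cis \<theta>\<close>, the signed curvature is
  \<open>\<theta>' = Im (cnj F' * F'')\<close>. Since \<open>F'\<close> is absolutely continuous, \<open>F''\<close> exists almost everywhere;
  the value elsewhere does not affect the energy.\<close>

definition curvature :: "curve \<Rightarrow> real \<Rightarrow> real" where
  "curvature c s = (case arclength_param c of (a, b, F) \<Rightarrow>
     Im (cnj (deriv_on a b F s) * deriv_on a b (deriv_on a b F) s))"

definition bending_energy :: "curve \<Rightarrow> ennreal" where
  "bending_energy c = (\<integral>\<^sup>+ s\<in>{0..arclength c}. ennreal ((curvature c s)\<^sup>2) \<partial>lborel) / 4"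

fun tangent_angle :: "curve \<Rightarrow> (real \<Rightarrow> real) \<Rightarrow> bool" where
  "tangent_angle (a, b, f) \<theta> \<longleftrightarrow>
     continuous_on {a..b} \<theta> \<and>
     (\<forall>t\<in>{a..b}. deriv_on a b f t = of_real (norm (deriv_on a b f t)) * cis (\<theta> t))"

fun is_s_curve :: "curve \<Rightarrow> bool" where
  "is_s_curve (a, b, f) \<longleftrightarrow> is_curve (a, b, f) \<and>
     (\<exists>\<theta>. tangent_angle (a, b, f) \<theta> \<and>
       (\<exists>c\<in>{a..b}.
          (mono_on {a..c} \<theta> \<and> antimono_on {c..b} \<theta> \<or>
           antimono_on {a..c} \<theta> \<and> mono_on {c..b} \<theta>) \<and>
          \<bar>\<theta> c - \<theta> a\<bar> \<le> pi \<and> \<bar>\<theta> b - \<theta> c\<bar> \<le> pi))"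

definition S_curves :: "real \<Rightarrow> real \<Rightarrow> curve set" where
  "S_curves \<alpha> \<beta> = {(a, b, f). is_s_curve (a, b, f) \<and>
     f a = 0 \<and> deriv_on a b f a / of_real (norm (deriv_on a b f a)) = cis \<alpha> \<and>
     f b = 1 \<and> deriv_on a b f b / of_real (norm (deriv_on a b f b)) = cis \<beta>}"

definition S_opt :: "real \<Rightarrow> real \<Rightarrow> curve set" where
  "S_opt \<alpha> \<beta> = {c \<in> S_curves \<alpha> \<beta>. arclength_parametrized c \<and>
     (\<forall>d\<in>S_curves \<alpha> \<beta>. bending_energy c \<le> bending_energy d)}"

text \<open>Meaningful only once existence and uniqueness of such a curve are known.\<close>

definition c1_curve :: "real \<Rightarrow> real \<Rightarrow> curve" where
  "c1_curve \<alpha> \<beta> = (THE c. c \<in> S_opt \<alpha> \<beta> \<and> C_infinity c)"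

text \<open>The interval integral is signed, so this is the antiderivative also for negative \<open>t\<close>.\<close>

definition elastica_xi :: "real \<Rightarrow> real" where
  "elastica_xi t = (LBINT u=ereal 0..ereal t. (sin u)\<^sup>2 / sqrt (1 + (sin u)\<^sup>2))"

lemma elastica_xi_0: "elastica_xi 0 = 0"
  by (simp add: elastica_xi_def)

lemma elastica_xi_has_derivative:
  "(elastica_xi has_real_derivative (sin t)\<^sup>2 / sqrt (1 + (sin t)\<^sup>2)) (at t)"
proof -
  let ?g = "\<lambda>u::real. (sin u)\<^sup>2 / sqrt (1 + (sin u)\<^sup>2)"
  let ?m = "\<bar>t\<bar> + 1"
  have nz: "sqrt (1 + (sin u)\<^sup>2) \<noteq> 0" for u :: real
    by (smt (verit) real_sqrt_eq_zero_cancel_iff zero_le_power2)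
  have "((\<lambda>u. LBINT y=ereal 0..ereal u. ?g y) has_vector_derivative ?g t) (at t within {-?m..?m})"
    by (rule interval_integral_FTC2) (auto intro!: continuous_intros nz)
  moreover have "at t within {-?m..?m} = at t"
    by (rule at_within_interior) auto
  ultimately show ?thesis
    by (simp add: elastica_xi_def[abs_def] has_real_derivative_iff_has_vector_derivative)
qed

definition rect_elastica :: "real \<Rightarrow> complex" where
  "rect_elastica t = of_real (sin t) + \<i> * of_real (elastica_xi t)"

definition rect_elastica_on :: "real \<Rightarrow> real \<Rightarrow> curve" where
  "rect_elastica_on t1 t2 = (t1, t2, restrict rect_elastica {t1..t2})"

end

theory Submission
  imports Defs
begin

text \<open>
  Let \<open>\<theta>\<close> be the tangent angle of an s-curve with chord \<open>1\<close>, as a function of arclength, and let \<open>\<kappa> = \<theta>'\<close>.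
  If \<open>\<theta>\<close> takes values in \<open>[g - \<pi>, g]\<close>, then \<open>(\<kappa> \<mp> m \<surd>(sin (g - \<theta>)))\<^sup>2 \<ge> 0\<close> integrates to the bound
  \<open>\<integral>\<kappa>\<^sup>2 \<ge> 2 m V - m\<^sup>2 sin g\<close>, where \<open>V\<close> depends only on the values of \<open>\<theta>\<close> at the ends and at the turning point;
  here \<open>\<integral> sin (g - \<theta>) = sin g\<close> because the chord is \<open>1\<close>. If the curve turns up to the angle \<open>g\<close> and back down, the bound is a
  function \<open>\<Psi>(g)\<close> for fixed \<open>m\<close>, and \<open>m\<close> can be chosen such that \<open>\<Psi>\<close> has a strict global minimum at a point \<open>g\<close> where an arc of
  the rectangular elastica attains the bound; otherwise there is a monotone elastic arc which is its own calibration.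
  Equality forces \<open>\<kappa>\<^sup>2 = m\<^sup>2 sin (g - \<theta>)\<close>. This differential equation is not Lipschitz where \<open>\<kappa> = 0\<close>, and its solutions may contain
  straight segments. The boundary values of \<open>\<kappa>\<close> (or smoothness, when \<open>\<bar>\<alpha> - \<beta>\<bar> = \<pi>\<close>) exclude these, so that
  \<open>\<kappa>' = - (m\<^sup>2/2) cos (\<theta> - g)\<close>, whose solution is unique.
\<close>

section \<open>Absolutely continuous monotone functions\<close>

text \<open>The equation \<open>\<kappa>\<^sup>2 = m\<^sup>2 sin (g - \<theta>)\<close> is
  stationarity with the chord as a constraint: the Lagrange multiplier is a constant vector of size
  \<open>m\<^sup>2\<close> whose direction is encoded by \<open>g\<close>. The length is free, so
  there is no constant term, and this is why only the rectangular elastica occurs. The two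
  components of the chord give two equations for \<open>g\<close> and \<open>m\<close>; for an arc
  with an inflection point, one of them is also \<open>\<Psi>'(g) = 0\<close>. Eliminating
  \<open>m\<close> leaves one equation in \<open>g\<close>, solved by the intermediate value
  theorem. Its sign at an end angle decides whether an arc with inflection exists; if that fails
  from both ends of the curve, the two failures are the boundary signs for the monotone equation.
  The case \<open>\<bar>\<alpha> - \<beta>\<bar> = \<pi>\<close> is exceptional because the
  curvature of the arc vanishes at both ends, where the tangents are opposite. Straight segments of
  equal length can then be added at both ends without changing chord or energy, so minimizers are
  not unique and only smoothness singles one out.\<close>

lemma absolutely_continuous_on_imp_continuous_on:
  fixes f :: "real \<Rightarrow> 'a::real_normed_vector"
  assumes "absolutely_continuous_on {a..b} f"
  shows "continuous_on {a..b} f"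
  unfolding continuous_on_iff
proof (intro ballI allI impI)
  fix x e :: real assume x: "x \<in> {a..b}" and "0 < e"
  then obtain d where "d > 0" and d: "\<And>D. D division_of (\<Union>D) \<Longrightarrow> (\<Union>D) \<subseteq> {a..b} \<Longrightarrow>
      (\<Sum>K\<in>D. measure lborel K) < d \<Longrightarrow> (\<Sum>K\<in>D. norm (f (Sup K) - f (Inf K))) < e"
    using assms unfolding absolutely_continuous_on_def by metis
  have *: "norm (f v - f u) < e" if "u \<le> v" "a \<le> u" "v \<le> b" "v - u < d" for u v
  proof -
    have "{cbox u v} division_of (\<Union>{cbox u v})"
      using that by (auto simp: division_of_def)
    then show ?thesis
      using d[of "{cbox u v}"] that by auto
  qed
  show "\<exists>d>0. \<forall>x'\<in>{a..b}. dist x' x < d \<longrightarrow> dist (f x') (f x) < e"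
  proof (intro exI[of _ d] conjI ballI impI)
    fix y assume y: "y \<in> {a..b}" "dist y x < d"
    show "dist (f y) (f x) < e"
      using *[of x y] *[of y x] x y
      by (cases "x \<le> y") (auto simp: dist_norm norm_minus_commute)
  qed fact
qed

lemma absolutely_continuous_on_subset:
  assumes "absolutely_continuous_on S f" "T \<subseteq> S"
  shows "absolutely_continuous_on T f"
  using assms unfolding absolutely_continuous_on_def by (meson order_trans)

text \<open>Extends \<open>f\<close> by its end values, since \<open>interval_measure\<close> asks
  for a monotone function on the whole line.\<close>

lemma clamp_mono_continuous:
  fixes f :: "real \<Rightarrow> real"
  assumes "a \<le> b" "mono_on {a..b} f" "continuous_on {a..b} f"
  defines "F \<equiv> \<lambda>x. f (max a (min b x))"
  shows "\<And>x y. x \<le> y \<Longrightarrow> F x \<le> F y" "continuous_on UNIV F"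
proof -
  show "F x \<le> F y" if "x \<le> y" for x y
    unfolding F_def using assms(1) that by (intro mono_onD[OF assms(2)]) auto
  show "continuous_on UNIV F"
    unfolding F_def by (rule continuous_on_compose2[OF assms(3)]) (use assms(1) in \<open>auto intro!: continuous_intros\<close>)
qed

text \<open>Absolute continuity speaks only of finite families of nonoverlapping intervals. The null
  set is covered by countably many such intervals inside an open set of small measure; every finite
  subfamily has Stieltjes measure at most \<open>e\<close>, and continuity from below extends this
  to the whole cover.\<close>

lemma emeasure_interval_measure_null:
  fixes f :: "real \<Rightarrow> real"
  assumes "a < b" and ac: "absolutely_continuous_on {a..b} f" and mono: "mono_on {a..b} f"
    and A: "A \<in> null_sets lborel" "A \<subseteq> {a..b}"
  shows "emeasure (interval_measure (\<lambda>x. f (max a (min b x)))) A = 0"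
proof -
  define F where "F = (\<lambda>x. f (max a (min b x)))"
  define \<mu> where "\<mu> = interval_measure F"
  have F: "\<And>x y. x \<le> y \<Longrightarrow> F x \<le> F y" "continuous_on UNIV F"
    using clamp_mono_continuous[OF less_imp_le[OF \<open>a < b\<close>] mono
        absolutely_continuous_on_imp_continuous_on[OF ac]] by (auto simp: F_def)
  have Ab [measurable]: "A \<in> sets borel"
    using A by (auto simp: null_sets_def)
  have "emeasure \<mu> A \<le> 0 + ennreal e" if "e > 0" for e
  proof -
    obtain d where "d > 0" and d: "\<And>D. D division_of (\<Union>D) \<Longrightarrow> (\<Union>D) \<subseteq> {a..b} \<Longrightarrow>
        (\<Sum>K\<in>D. measure lborel K) < d \<Longrightarrow> (\<Sum>K\<in>D. norm (f (Sup K) - f (Inf K))) < e"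
      using ac \<open>e > 0\<close> unfolding absolutely_continuous_on_def by metis
    obtain U where U: "open U" "A \<subseteq> U" "emeasure lborel (U - A) < d"
      using outer_regular_lborel[OF Ab \<open>d > 0\<close>] by metis
    have "emeasure lborel U \<le> emeasure lborel (U - A) + emeasure lborel A"
      using emeasure_subadditive[of "U - A" lborel A] U Ab by (simp add: Un_absorb2)
    then have U_d: "emeasure lborel U < d"
      using U A by (auto simp: null_sets_def)
    \<comment> \<open>With this gauge every interval of the covering contains a point of
      \<open>A\<close> and hence stays inside \<open>U\<close>.\<close>
    define g where "g = (\<lambda>x. if x \<in> A then U else UNIV)"
    have "gauge g" using U by (auto simp: gauge_def g_def)
    obtain \<D> where \<D>: "countable \<D>" "\<Union>\<D> \<subseteq> cbox a b"
      "\<And>K. K \<in> \<D> \<Longrightarrow> interior K \<noteq> {} \<and> (\<exists>c d. K = cbox c d)"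
      "pairwise (\<lambda>A B. interior A \<inter> interior B = {}) \<D>"
      "\<And>K. K \<in> \<D> \<Longrightarrow> \<exists>x \<in> A \<inter> K. K \<subseteq> g x" "A \<subseteq> \<Union>\<D>"
      using covering_lemma[of A a b g] A(2) \<open>a < b\<close> \<open>gauge g\<close> by (smt (verit) box_real(2) box_ne_empty(2) box_real(1) greaterThanLessThan_empty_iff interval_cbox linorder_not_le)
    have KU: "K \<subseteq> U" if "K \<in> \<D>" for K
      using \<D>(5)[OF that] by (auto simp: g_def)
    have fin: "emeasure \<mu> (\<Union>D) \<le> e" if "finite D" "D \<subseteq> \<D>" for D
    proof -
      have div: "D division_of (\<Union>D)"
        unfolding division_of_def
      proof (intro conjI ballI impI)
        fix K assume "K \<in> D"
        then have "interior K \<noteq> {} \<and> (\<exists>c d. K = cbox c d)" using \<D>(3) that by blast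
        then show "K \<noteq> {}" "\<exists>c d. K = cbox c d" by auto
        show "K \<subseteq> \<Union>D" using \<open>K \<in> D\<close> by auto
      next
        fix K1 K2 assume "K1 \<in> D" "K2 \<in> D" "K1 \<noteq> K2"
        then show "interior K1 \<inter> interior K2 = {}"
          using \<D>(4) that by (auto simp: pairwise_def)
      qed (use that in auto)
      have D_sets: "D \<subseteq> sets borel"
        using \<D>(3) that(2) by (metis borel_closed closed_cbox subset_iff)
      then have D_borel: "\<Union>D \<in> sets borel"
        using that(1) by (intro sets.finite_Union) auto
      have "(\<Sum>K\<in>D. measure lborel K) = measure lebesgue (\<Union>D)"
      proof -
        have "(\<Sum>K\<in>D. measure lborel K) = (\<Sum>K\<in>D. measure lebesgue K)"
          using div by (intro sum.cong refl) (auto simp: measure_completion)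
        then show ?thesis using content_division[OF div] by simp
      qed
      also have "\<dots> = measure lborel (\<Union>D)"
        using D_borel by (intro measure_completion) auto
      also have "\<dots> < d"
      proof -
        have "emeasure lborel (\<Union>D) \<le> emeasure lborel U"
          using KU that U by (intro emeasure_mono) auto
        then have "emeasure lborel (\<Union>D) < d" using U_d by order
        then show ?thesis
          by (metis \<open>0 < d\<close> emeasure_eq_ennreal_measure ennreal_less_iff measure_nonneg not_le order.strict_implies_not_eq order_less_imp_le top.not_eq_extremum top_greatest)
      qed
      finally have "(\<Sum>K\<in>D. norm (f (Sup K) - f (Inf K))) < e"
        using d[OF div] \<D>(2) that by auto
      moreover have "emeasure \<mu> K = ennreal (norm (f (Sup K) - f (Inf K)))" if "K \<in> D" for K
      proof -
        have "K \<in> \<D>" using that \<open>D \<subseteq> \<D>\<close> by blast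
        then have "interior K \<noteq> {} \<and> (\<exists>c d. K = cbox c d)" "K \<subseteq> {a..b}"
          using \<D>(2,3) by auto
        then obtain u v where K: "K = cbox u v" "K \<noteq> {}" "K \<subseteq> {a..b}"
          by auto
        then have "u \<le> v" "a \<le> u" "v \<le> b" by auto
        then have "f u \<le> f v" by (intro mono_onD[OF mono]) auto
        then show ?thesis
          using \<open>u \<le> v\<close> \<open>a \<le> u\<close> \<open>v \<le> b\<close> emeasure_interval_measure_Icc[OF \<open>u \<le> v\<close> F]
          by (simp add: K \<mu>_def F_def)
      qed
      moreover have "emeasure \<mu> (\<Union>K\<in>D. K) \<le> (\<Sum>K\<in>D. emeasure \<mu> K)"
        using that(1) D_sets by (intro emeasure_subadditive_finite) (auto simp: \<mu>_def)
      ultimately show ?thesis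
        by (simp add: sum_ennreal) (meson ennreal_leI less_imp_le order_trans)
    qed
    have "emeasure \<mu> A \<le> e"
    proof (cases "\<D> = {}")
      case True then show ?thesis using \<D>(6) by simp
    next
      case False
      define K where "K n = \<Union>(from_nat_into \<D> ` {..n})" for n :: nat
      have mem: "from_nat_into \<D> n \<in> \<D>" for n using False by (simp add: from_nat_into)
      have K_sets: "K n \<in> sets \<mu>" for n
      proof -
        have "from_nat_into \<D> i \<in> sets borel" for i
          using \<D>(3)[OF mem[of i]] by (metis borel_closed closed_cbox)
        then show ?thesis unfolding K_def \<mu>_def by (auto intro!: sets.finite_UN)
      qed
      have "(SUP n. emeasure \<mu> (K n)) = emeasure \<mu> (\<Union>n. K n)"
      proof (rule SUP_emeasure_incseq)
        show "incseq K" unfolding incseq_def K_def by (intro allI impI Union_mono image_mono) auto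
      qed (use K_sets in auto)
      moreover have "emeasure \<mu> (K n) \<le> e" for n
        unfolding K_def using mem by (intro fin) auto
      moreover have "A \<subseteq> (\<Union>n. K n)"
      proof -
        have "\<Union>\<D> \<subseteq> (\<Union>n. K n)"
        proof (rule Sup_least)
          fix S assume "S \<in> \<D>"
          then obtain n where "S = from_nat_into \<D> n" using \<D>(1) from_nat_into_surj by metis
          then show "S \<subseteq> (\<Union>n. K n)" by (auto simp: K_def)
        qed
        then show ?thesis using \<D>(6) by auto
      qed
      moreover have "emeasure \<mu> A \<le> emeasure \<mu> (\<Union>n. K n)"
        using calculation K_sets by (intro emeasure_mono) auto
      ultimately show ?thesis by (metis SUP_least order_trans)
    qed
    then show ?thesis by simp
  qed
  then have "emeasure \<mu> A \<le> 0"
    by (rule ennreal_le_epsilon) auto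
  then show ?thesis by (simp add: \<mu>_def F_def)
qed

text \<open>The Stieltjes measure of \<open>f\<close> has a density by the Radon-Nikodym theorem, and \<open>f'\<close> equals that density almost everywhere by Lebesgue
  differentiation. The library has the latter for right-sided averages; reflection gives the left-sided ones.\<close>

theorem absolutely_continuous_mono_FTC:
  fixes f :: "real \<Rightarrow> real"
  assumes "a < b" and ac: "absolutely_continuous_on {a..b} f" and mono: "mono_on {a..b} f"
  obtains h N where "negligible N" "\<And>x. x \<in> {a..b} - N \<Longrightarrow> (f has_real_derivative h x) (at x)"
    "\<And>s t. a \<le> s \<Longrightarrow> s \<le> t \<Longrightarrow> t \<le> b \<Longrightarrow> (h has_integral f t - f s) {s..t}"
proof -
  define F where "F = (\<lambda>x. f (max a (min b x)))"
  define \<mu> where "\<mu> = density (interval_measure F) (indicator {a<..b})"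
  have F: "\<And>x y. x \<le> y \<Longrightarrow> F x \<le> F y" "continuous_on UNIV F"
    using clamp_mono_continuous[OF less_imp_le[OF \<open>a < b\<close>] mono
        absolutely_continuous_on_imp_continuous_on[OF ac]] by (auto simp: F_def)
  have em: "emeasure \<mu> A = emeasure (interval_measure F) (A \<inter> {a<..b})" if "A \<in> sets borel" for A
  proof -
    have "emeasure \<mu> A = (\<integral>\<^sup>+x. indicator (A \<inter> {a<..b}) x \<partial>interval_measure F)"
      unfolding \<mu>_def using that
      by (subst emeasure_density) (auto intro!: nn_integral_cong simp: indicator_def simp del: nn_integral_indicator)
    then show ?thesis using that by (subst (asm) nn_integral_indicator) auto
  qed
  have "absolutely_continuous lborel \<mu>"
    unfolding absolutely_continuous_def
  proof
    fix A :: "real set" assume A: "A \<in> null_sets lborel"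
    then have "A \<inter> {a<..b} \<in> null_sets lborel"
      by (auto intro: null_set_Int2)
    then have "emeasure (interval_measure F) (A \<inter> {a<..b}) = 0"
      unfolding F_def by (intro emeasure_interval_measure_null[OF assms]) auto
    then show "A \<in> null_sets \<mu>"
      using A by (auto simp: null_sets_def em) (auto simp: \<mu>_def)
  qed
  then obtain g where g [measurable]: "g \<in> borel_measurable lborel" and "density lborel g = \<mu>"
    using sigma_finite_measure.Radon_Nikodym[OF lborel.sigma_finite_measure_axioms, of \<mu>] by (auto simp: \<mu>_def)
  have g_int: "(\<integral>\<^sup>+x. g x * indicator {s<..t} x \<partial>lborel) = ennreal (f t - f s)"
    if "a \<le> s" "s \<le> t" "t \<le> b" for s t
  proof -
    have "(\<integral>\<^sup>+x. g x * indicator {s<..t} x \<partial>lborel) = emeasure \<mu> {s<..t}"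
      unfolding \<open>density lborel g = \<mu>\<close>[symmetric] by (subst emeasure_density) auto
    also have "\<dots> = emeasure (interval_measure F) {s<..t}"
      using that by (subst em) (auto intro!: arg_cong[where f="emeasure _"])
    also have "\<dots> = ennreal (F t - F s)"
      using that F by (intro emeasure_interval_measure_Ioc)
        (auto simp: continuous_on_eq_continuous_at intro: continuous_at_imp_continuous_at_within)
    finally show ?thesis using that by (simp add: F_def)
  qed
  \<comment> \<open>\<open>enn2real\<close> sends the value infinity to 0. This alters the density
    on a null set only, because its integral over \<open>{a<..b}\<close> is finite.\<close>
  define h where "h = (\<lambda>x. if x \<in> {a<..b} then enn2real (g x) else 0)"
  have h_int: "(h has_integral f t - f s) {s..t}" if st: "a \<le> s" "s \<le> t" "t \<le> b" for s t
  proof -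
    have "(\<integral>\<^sup>+x. g x * indicator {s<..t} x \<partial>lborel) \<noteq> \<infinity>"
      by (simp add: g_int[OF st])
    then have "AE x in lborel. g x * indicator {s<..t} x \<noteq> \<infinity>"
      by (intro nn_integral_PInf_AE) auto
    then have eq: "AE x in lborel. ennreal (h x * indicator {s<..t} x) = g x * indicator {s<..t} x"
      by eventually_elim (use st in \<open>auto simp: h_def indicator_def less_top split: if_splits\<close>)
    have "(\<integral>\<^sup>+x. ennreal (h x * indicator {s<..t} x) \<partial>lborel) = ennreal (f t - f s)"
      using nn_integral_cong_AE[OF eq] g_int[OF st] by simp
    moreover have "f s \<le> f t" using st by (intro mono_onD[OF mono]) auto
    ultimately have "((\<lambda>x. h x * indicator {s<..t} x) has_integral f t - f s) UNIV"
      by (intro nn_integral_has_integral) (auto simp: h_def)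
    then have "((\<lambda>x. if x \<in> {s..t} then h x else 0) has_integral f t - f s) UNIV"
      by (rule has_integral_spike[of "{s}", rotated 2]) auto
    then show ?thesis by (simp only: has_integral_restrict_UNIV)
  qed
  have int: "h integrable_on cbox c d" for c d
  proof -
    have "(h has_integral (f b - f a)) UNIV"
    proof (rule has_integral_on_superset)
      show "(h has_integral (f b - f a)) {a..b}" using h_int \<open>a < b\<close> by simp
    qed (auto simp: h_def)
    then show ?thesis
      using integrable_on_subcbox by blast
  qed
  obtain N1 where N1: "negligible N1" "\<And>x e. \<lbrakk>x \<notin> N1; 0 < e\<rbrakk> \<Longrightarrow> \<exists>d>0. \<forall>k. 0 < k \<and> k < d \<longrightarrow>
      norm (integral (cbox x (x + k *\<^sub>R One)) h /\<^sub>R k ^ DIM(real) - h x) < e"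
    using integrable_ccontinuous_explicit[OF int] by blast
  have "(\<lambda>x. h (- x)) integrable_on cbox c d" for c d
    using int[of "-d" "-c"] Henstock_Kurzweil_Integration.integrable_reflect_real[where f=h and a="-d" and b="-c"] by simp
  then obtain N2 where N2: "negligible N2" "\<And>x e. \<lbrakk>x \<notin> N2; 0 < e\<rbrakk> \<Longrightarrow> \<exists>d>0. \<forall>k. 0 < k \<and> k < d \<longrightarrow>
      norm (integral (cbox x (x + k *\<^sub>R One)) (\<lambda>x. h (- x)) /\<^sub>R k ^ DIM(real) - h (- x)) < e"
    using integrable_ccontinuous_explicit[of "\<lambda>x. h (- x)"] by blast
  show thesis
  proof
    show "negligible (N1 \<union> uminus ` N2 \<union> {a, b})"
      using N1(1) N2(1)
      by (auto intro!: negligible_differentiable_image_negligible differentiable_on_minus differentiable_on_ident)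
    fix x assume x: "x \<in> {a..b} - (N1 \<union> uminus ` N2 \<union> {a, b})"
    then have "x \<notin> N1" "- x \<notin> N2" "a < x" "x < b" by (auto simp: image_iff)
    show "(f has_real_derivative h x) (at x)"
      unfolding has_field_derivative_iff LIM_def
    proof (intro allI impI)
      fix e :: real assume "e > 0"
      obtain d1 where d1: "d1 > 0" "\<And>k. 0 < k \<Longrightarrow> k < d1 \<Longrightarrow> \<bar>integral {x..x+k} h / k - h x\<bar> < e"
        using N1(2)[OF \<open>x \<notin> N1\<close> \<open>e > 0\<close>] by (auto simp: divide_inverse mult.commute)
      obtain d2 where d2: "d2 > 0" "\<And>k. 0 < k \<Longrightarrow> k < d2 \<Longrightarrow> \<bar>integral {-x..-x+k} (\<lambda>x. h (- x)) / k - h x\<bar> < e"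
        using N2(2)[OF \<open>- x \<notin> N2\<close> \<open>e > 0\<close>] by (auto simp: divide_inverse mult.commute)
      define d where "d = min (min d1 d2) (min (x - a) (b - x))"
      show "\<exists>s>0. \<forall>y. y \<noteq> x \<and> dist y x < s \<longrightarrow> dist ((f y - f x) / (y - x)) (h x) < e"
      proof (intro exI[of _ d] conjI allI impI)
        show "d > 0" using d1 d2 \<open>a < x\<close> \<open>x < b\<close> by (auto simp: d_def)
        fix y assume y: "y \<noteq> x \<and> dist y x < d"
        then have yy: "a \<le> y" "y \<le> b" "\<bar>y - x\<bar> < d1" "\<bar>y - x\<bar> < d2" by (auto simp: d_def dist_real_def)
        show "dist ((f y - f x) / (y - x)) (h x) < e"
        proof (cases "x < y")
          case True
          have "integral {x..y} h = f y - f x"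
            using h_int[of x y] True \<open>a < x\<close> yy by (auto intro: integral_unique)
          then show ?thesis using d1(2)[of "y - x"] True yy by (simp add: dist_real_def)
        next
          case False
          have "integral {y..x} h = f x - f y"
            using h_int[of y x] False \<open>x < b\<close> yy by (auto intro: integral_unique)
          then have "integral {-x..-y} (\<lambda>x. h (- x)) = f x - f y"
            using Henstock_Kurzweil_Integration.integral_reflect_real[of x y h] by simp
          then show ?thesis
            using d2(2)[of "x - y"] False yy y minus_divide_divide[of "f y - f x" "y - x"]
            by (simp add: dist_real_def)
        qed
      qed
    qed
  qed (use h_int in auto)
qed

section \<open>Transfer of absolute continuity, and the chain rule\<close>

lemma absolutely_continuous_on_dominated:
  fixes f :: "real \<Rightarrow> 'a::real_normed_vector" and g :: "real \<Rightarrow> 'b::real_normed_vector"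
  assumes ac: "absolutely_continuous_on S f" and "0 < \<delta>" "0 < M"
    and dom: "\<And>x y. x \<in> S \<Longrightarrow> y \<in> S \<Longrightarrow> \<bar>x - y\<bar> < \<delta> \<Longrightarrow> norm (g x - g y) \<le> M * norm (f x - f y)"
  shows "absolutely_continuous_on S g"
  unfolding absolutely_continuous_on_def
proof (intro allI impI)
  fix e :: real assume "e > 0"
  then have "e / M > 0" using \<open>M > 0\<close> by simp
  then obtain d where "d > 0" and d: "\<And>D. D division_of (\<Union>D) \<Longrightarrow> (\<Union>D) \<subseteq> S \<Longrightarrow>
      (\<Sum>K\<in>D. measure lborel K) < d \<Longrightarrow> (\<Sum>K\<in>D. norm (f (Sup K) - f (Inf K))) < e / M"
    using ac unfolding absolutely_continuous_on_def by metis
  show "\<exists>d>0. \<forall>D. D division_of (\<Union>D) \<and> (\<Union>D) \<subseteq> S \<and> (\<Sum>K\<in>D. measure lborel K) < d \<longrightarrow>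
        (\<Sum>K\<in>D. norm (g (Sup K) - g (Inf K))) < e"
  proof (intro exI[of _ "min d \<delta>"] conjI allI impI)
    fix D assume D: "D division_of (\<Union>D) \<and> (\<Union>D) \<subseteq> S \<and> (\<Sum>K\<in>D. measure lborel K) < min d \<delta>"
    have "norm (g (Sup K) - g (Inf K)) \<le> M * norm (f (Sup K) - f (Inf K))" if "K \<in> D" for K
    proof -
      have "K \<noteq> {}" "\<exists>a b. K = cbox a b" "K \<subseteq> S" using D that by (auto simp: division_of_def)
      then obtain u v where K: "K = {u..v}" "u \<le> v" by auto
      \<comment> \<open>A total length below \<open>\<delta>\<close> makes each single interval
        shorter than \<open>\<delta>\<close>, so a comparison of increments at small scale is
        enough.\<close>
      have "measure lborel K \<le> (\<Sum>K\<in>D. measure lborel K)"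
        using D that by (intro member_le_sum) auto
      then have "v - u < \<delta>" using D K by simp
      moreover have "u \<in> S" "v \<in> S" using K \<open>K \<subseteq> S\<close> by auto
      ultimately show ?thesis using dom[of v u] K by auto
    qed
    then have "(\<Sum>K\<in>D. norm (g (Sup K) - g (Inf K))) \<le> (\<Sum>K\<in>D. M * norm (f (Sup K) - f (Inf K)))"
      by (rule sum_mono)
    also have "\<dots> = M * (\<Sum>K\<in>D. norm (f (Sup K) - f (Inf K)))"
      by (simp add: sum_distrib_left)
    also have "\<dots> < M * (e / M)"
      using D d \<open>M > 0\<close> by (intro mult_strict_left_mono) auto
    finally show "(\<Sum>K\<in>D. norm (g (Sup K) - g (Inf K))) < e"
      using \<open>M > 0\<close> by simp
  qed (use \<open>d > 0\<close> \<open>\<delta> > 0\<close> in auto)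
qed

lemma absolutely_continuous_on_id: "absolutely_continuous_on S (\<lambda>x. x)"
  unfolding absolutely_continuous_on_def
proof (intro allI impI exI conjI)
  fix e :: real and D assume "e > 0"
    and D: "D division_of (\<Union>D) \<and> (\<Union>D) \<subseteq> S \<and> (\<Sum>K\<in>D. measure lborel K) < e"
  have "norm (Sup K - Inf K) = measure lborel K" if "K \<in> D" for K
  proof -
    have "K \<noteq> {}" "\<exists>a b. K = cbox a b" using D that by (auto simp: division_of_def)
    then show ?thesis by auto
  qed
  then show "(\<Sum>K\<in>D. norm (Sup K - Inf K)) < e" using D by simp
qed

text \<open>A strictly increasing Lipschitz map carries a division to a division and enlarges the
  total length at most by the factor \<open>C\<close>. Strictness keeps distinct intervals distinct,
  so sums over the image can be reindexed.\<close>

lemma absolutely_continuous_on_compose_mono: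
  assumes ac: "absolutely_continuous_on {a..b} f" and "0 < C"
    and \<tau>: "\<And>x y. x \<in> S \<Longrightarrow> y \<in> S \<Longrightarrow> x < y \<Longrightarrow> \<tau> x < \<tau> y"
    and lip: "\<And>x y. x \<in> S \<Longrightarrow> y \<in> S \<Longrightarrow> \<bar>\<tau> x - \<tau> y\<bar> \<le> C * \<bar>x - y\<bar>"
    and range: "\<tau> ` S \<subseteq> {a..b}"
  shows "absolutely_continuous_on S (\<lambda>x. f (\<tau> x))"
  unfolding absolutely_continuous_on_def
proof (intro allI impI)
  fix e :: real assume "e > 0"
  then obtain d where "d > 0" and d: "\<And>D. D division_of (\<Union>D) \<Longrightarrow> (\<Union>D) \<subseteq> {a..b} \<Longrightarrow>
      (\<Sum>K\<in>D. measure lborel K) < d \<Longrightarrow> (\<Sum>K\<in>D. norm (f (Sup K) - f (Inf K))) < e"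
    using ac unfolding absolutely_continuous_on_def by metis
  show "\<exists>d>0. \<forall>D. D division_of (\<Union>D) \<and> (\<Union>D) \<subseteq> S \<and> (\<Sum>K\<in>D. measure lborel K) < d \<longrightarrow>
        (\<Sum>K\<in>D. norm (f (\<tau> (Sup K)) - f (\<tau> (Inf K)))) < e"
  proof (intro exI[of _ "d / C"] conjI allI impI)
    fix D assume D: "D division_of (\<Union>D) \<and> (\<Union>D) \<subseteq> S \<and> (\<Sum>K\<in>D. measure lborel K) < d / C"
    define G where "G K = {\<tau> (Inf K)..\<tau> (Sup K)}" for K
    have K: "Inf K \<le> Sup K \<and> K = {Inf K..Sup K} \<and> Inf K \<in> S \<and> Sup K \<in> S \<and> \<tau> (Inf K) \<le> \<tau> (Sup K)"
      if "K \<in> D" for K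
    proof -
      have "K \<noteq> {}" "\<exists>a b. K = cbox a b" "K \<subseteq> S" using D that by (auto simp: division_of_def)
      then obtain u v where K: "K = {u..v}" "u \<le> v" "{u..v} \<subseteq> S" by auto
      then have "u \<in> S" "v \<in> S" by auto
      then have "\<tau> u \<le> \<tau> v" using \<tau>[of u v] K by (cases "u = v") auto
      then show ?thesis using K by auto
    qed
    have disj: "interior (G K1) \<inter> interior (G K2) = {} \<and> G K1 \<noteq> G K2"
      if "K1 \<in> D" "K2 \<in> D" "K1 \<noteq> K2" for K1 K2
    proof -
      note k = K[OF that(1)] K[OF that(2)]
      define u1 v1 u2 v2 where "u1 = Inf K1" and "v1 = Sup K1" and "u2 = Inf K2" and "v2 = Sup K2"
      note k = k[folded u1_def v1_def u2_def v2_def]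
      have "interior K1 \<inter> interior K2 = {}" using D that by (auto simp: division_of_def)
      moreover have "interior K1 = {u1<..<v1}" "interior K2 = {u2<..<v2}"
        using k by (metis interior_atLeastAtMost_real)+
      ultimately have e: "{u1<..<v1} \<inter> {u2<..<v2} = {}" by simp
      have cases: "v1 \<le> u1 \<or> v2 \<le> u2 \<or> v1 \<le> u2 \<or> v2 \<le> u1"
      proof (rule ccontr)
        assume "\<not> ?thesis"
        then have "max u1 u2 < min v1 v2" by auto
        then obtain z where "max u1 u2 < z" "z < min v1 v2" using dense by blast
        then have "z \<in> {u1<..<v1} \<inter> {u2<..<v2}" by auto
        with e show False by blast
      qed
      have mono: "\<tau> x \<le> \<tau> y" if "x \<in> S" "y \<in> S" "x \<le> y" for x y
        using \<tau>[OF that(1,2)] that by (cases "x = y") auto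
      have inj: "x = y" if "x \<in> S" "y \<in> S" "\<tau> x = \<tau> y" for x y
        using \<tau>[of x y] \<tau>[of y x] that by (cases x y rule: linorder_cases) auto
      have "u1 \<noteq> u2 \<or> v1 \<noteq> v2" using k that(3) by auto
      then have "\<tau> u1 \<noteq> \<tau> u2 \<or> \<tau> v1 \<noteq> \<tau> v2" using inj k by auto
      moreover have "G K1 = {\<tau> u1..\<tau> v1}" "G K2 = {\<tau> u2..\<tau> v2}"
        by (auto simp: G_def u1_def v1_def u2_def v2_def)
      moreover have "{\<tau> u1<..<\<tau> v1} \<inter> {\<tau> u2<..<\<tau> v2} = {}"
        using cases mono[of v1 u1] mono[of v2 u2] mono[of v1 u2] mono[of v2 u1] k by force
      ultimately show ?thesis using k by (auto simp: Icc_eq_Icc)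
    qed
    then have inj: "inj_on G D" by (auto simp: inj_on_def)
    have div: "(G ` D) division_of (\<Union>(G ` D))"
      unfolding division_of_def
    proof (intro conjI ballI impI)
      show "finite (G ` D)" using D by auto
      fix A assume "A \<in> G ` D"
      then obtain k where k: "k \<in> D" "A = G k" by auto
      show "A \<subseteq> \<Union>(G ` D)" using k by auto
      show "A \<noteq> {}" "\<exists>a b. A = cbox a b" using K[OF k(1)] k by (auto simp: G_def)
    next
      fix A B assume "A \<in> G ` D" "B \<in> G ` D" "A \<noteq> B"
      then show "interior A \<inter> interior B = {}" using disj by auto
    qed auto
    have "(\<Sum>A\<in>G ` D. measure lborel A) = (\<Sum>k\<in>D. \<tau> (Sup k) - \<tau> (Inf k))"
      using K by (subst sum.reindex[OF inj]) (auto simp: G_def intro!: sum.cong)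
    also have "\<dots> \<le> (\<Sum>k\<in>D. C * measure lborel k)"
    proof (rule sum_mono)
      fix k assume "k \<in> D"
      note k = K[OF this]
      have "measure lborel k = Sup k - Inf k" using k by (metis measure_lborel_Icc)
      then show "\<tau> (Sup k) - \<tau> (Inf k) \<le> C * measure lborel k"
        using k lip[of "Sup k" "Inf k"] by auto
    qed
    also have "\<dots> = C * (\<Sum>k\<in>D. measure lborel k)" by (simp add: sum_distrib_left)
    also have "\<dots> < d" using D \<open>C > 0\<close> by (simp add: field_simps)
    finally have "(\<Sum>A\<in>G ` D. norm (f (Sup A) - f (Inf A))) < e"
    proof (intro d[OF div])
      show "\<Union>(G ` D) \<subseteq> {a..b}"
        using K range by (fastforce simp: G_def)
    qed
    then show "(\<Sum>k\<in>D. norm (f (\<tau> (Sup k)) - f (\<tau> (Inf k)))) < e"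
      using K by (subst (asm) sum.reindex[OF inj]) (auto simp: G_def intro!: sum.cong)
  qed (use \<open>d > 0\<close> \<open>C > 0\<close> in auto)
qed

text \<open>The composition of \<open>P\<close> with \<open>\<theta>\<close> is again monotone
  because \<open>w\<close> is nonnegative, and absolutely continuous because \<open>w\<close> is
  bounded on the range of \<open>\<theta>\<close>. Both functions are then differentiable almost
  everywhere, and the pointwise chain rule identifies the derivatives. Nothing is asked of
  \<open>h\<close> where \<open>\<theta>\<close> has no derivative.\<close>

lemma absolutely_continuous_mono_chain:
  fixes \<theta> :: "real \<Rightarrow> real"
  assumes "a \<le> b" and ac: "absolutely_continuous_on {a..b} \<theta>" and mono: "mono_on {a..b} \<theta>"
    and P: "\<And>x. (P has_real_derivative w x) (at x)" and w: "continuous_on UNIV w" "\<And>x. 0 \<le> w x"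
    and h: "\<And>x y. a < x \<Longrightarrow> x < b \<Longrightarrow> (\<theta> has_real_derivative y) (at x) \<Longrightarrow> h x = y"
  shows "((\<lambda>u. w (\<theta> u) * h u) has_integral P (\<theta> b) - P (\<theta> a)) {a..b}"
proof (cases "a = b")
  case True
  then show ?thesis by (simp add: has_integral_refl)
next
  case False
  with \<open>a \<le> b\<close> have "a < b" by simp
  have range: "\<theta> x \<in> {\<theta> a..\<theta> b}" if "x \<in> {a..b}" for x
    using that \<open>a \<le> b\<close> by (auto intro!: mono_onD[OF mono])
  have "compact (w ` {\<theta> a..\<theta> b})"
    by (intro compact_continuous_image continuous_on_subset[OF w(1)]) auto
  then obtain M where M: "M > 0" "\<And>x. x \<in> {\<theta> a..\<theta> b} \<Longrightarrow> \<bar>w x\<bar> \<le> M"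
    using compact_imp_bounded bounded_pos[of "w ` {\<theta> a..\<theta> b}"] by auto
  have Pmono: "P x \<le> P y" if "x \<le> y" for x y
    using that DERIV_nonneg_imp_nondecreasing[of x y P] P w(2) by blast
  have lip: "norm (P x - P y) \<le> M * norm (x - y)" if "x \<in> {\<theta> a..\<theta> b}" "y \<in> {\<theta> a..\<theta> b}" for x y
    using that M P
    by (intro field_differentiable_bound[of "{\<theta> a..\<theta> b}"]) (auto intro: has_field_derivative_at_within)
  have ac': "absolutely_continuous_on {a..b} (\<lambda>x. P (\<theta> x))"
    by (rule absolutely_continuous_on_dominated[OF ac, of 1 M]) (use range M lip in auto)
  have mono': "mono_on {a..b} (\<lambda>x. P (\<theta> x))"
    using mono Pmono by (auto simp: mono_on_def)
  obtain h0 N0 where 0: "negligible N0" "\<And>x. x \<in> {a..b} - N0 \<Longrightarrow> (\<theta> has_real_derivative h0 x) (at x)"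
    using absolutely_continuous_mono_FTC[OF \<open>a < b\<close> ac mono] by metis
  obtain h1 N1 where 1: "negligible N1" "\<And>x. x \<in> {a..b} - N1 \<Longrightarrow> ((\<lambda>x. P (\<theta> x)) has_real_derivative h1 x) (at x)"
    "\<And>s t. a \<le> s \<Longrightarrow> s \<le> t \<Longrightarrow> t \<le> b \<Longrightarrow> (h1 has_integral P (\<theta> t) - P (\<theta> s)) {s..t}"
    using absolutely_continuous_mono_FTC[OF \<open>a < b\<close> ac' mono'] by metis
  show ?thesis
  proof (rule has_integral_spike[of "N0 \<union> N1 \<union> {a, b}"])
    show "negligible (N0 \<union> N1 \<union> {a, b})" using 0 1 by auto
    show "(h1 has_integral P (\<theta> b) - P (\<theta> a)) {a..b}" using 1(3) \<open>a \<le> b\<close> by simp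
    fix x assume x: "x \<in> {a..b} - (N0 \<union> N1 \<union> {a, b})"
    then have "h x = h0 x" using 0(2)[of x] h[of x "h0 x"] by auto
    moreover have "((\<lambda>x. P (\<theta> x)) has_real_derivative w (\<theta> x) * h0 x) (at x)"
      using 0(2)[of x] x by (intro DERIV_chain2[OF P]) auto
    ultimately show "w (\<theta> x) * h x = h1 x"
      using 1(2)[of x] x DERIV_unique by auto
  qed
qed

text \<open>The monotone case for \<open>- \<theta>\<close>, with the primitive
  \<open>- P (- x)\<close>, whose derivative \<open>w (- x)\<close> is again nonnegative.\<close>

lemma absolutely_continuous_antimono_chain:
  fixes \<theta> :: "real \<Rightarrow> real"
  assumes "a \<le> b" and ac: "absolutely_continuous_on {a..b} \<theta>" and mono: "antimono_on {a..b} \<theta>"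
    and P: "\<And>x. (P has_real_derivative w x) (at x)" and w: "continuous_on UNIV w" "\<And>x. 0 \<le> w x"
    and h: "\<And>x y. a < x \<Longrightarrow> x < b \<Longrightarrow> (\<theta> has_real_derivative y) (at x) \<Longrightarrow> h x = y"
  shows "((\<lambda>u. w (\<theta> u) * h u) has_integral P (\<theta> b) - P (\<theta> a)) {a..b}"
proof -
  have "((\<lambda>u. w (- (- \<theta> u)) * - h u) has_integral - P (- (- \<theta> b)) - - P (- (- \<theta> a))) {a..b}"
  proof (rule absolutely_continuous_mono_chain[where P = "\<lambda>x. - P (- x)" and w = "\<lambda>x. w (- x)" and \<theta> = "\<lambda>u. - \<theta> u"])
    show "absolutely_continuous_on {a..b} (\<lambda>u. - \<theta> u)"
      by (rule absolutely_continuous_on_dominated[OF ac, of 1 1]) auto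
    show "mono_on {a..b} (\<lambda>u. - \<theta> u)"
      using mono by (auto simp: monotone_on_def)
    show "((\<lambda>x. - P (- x)) has_real_derivative w (- x)) (at x)" for x
    proof -
      have "((\<lambda>x. P (- x)) has_real_derivative w (- x) * (- 1)) (at x)"
        by (rule DERIV_chain2[where f = P and g = uminus, OF P]) (auto intro!: derivative_eq_intros)
      from DERIV_minus[OF this] show ?thesis by simp
    qed
    show "continuous_on UNIV (\<lambda>x. w (- x))"
      by (intro continuous_on_compose2[OF w(1)] continuous_intros) auto
    fix x y assume "a < x" "x < b" "((\<lambda>u. - \<theta> u) has_real_derivative y) (at x)"
    then show "- h x = y" using h[of x "- y"] DERIV_minus[of "\<lambda>u. - \<theta> u" y x] by simp
  qed (use \<open>a \<le> b\<close> w in auto)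
  then have "((\<lambda>u. - (w (\<theta> u) * h u)) has_integral - (P (\<theta> b) - P (\<theta> a))) {a..b}"
    by simp
  from has_integral_neg[OF this] show ?thesis by simp
qed

text \<open>Increments of \<open>\<theta>\<close> are bounded by a multiple of those of the
  derivative: normalizing a vector is Lipschitz away from 0, and a chord of the unit circle controls
  the angle between two directions once this angle is below 1. Uniform continuity of
  \<open>\<theta>\<close> provides the scale at which this is so.\<close>

lemma tangent_angle_absolutely_continuous:
  assumes ac: "absolutely_continuous_on {a..b} (deriv_on a b f)"
    and nz: "\<And>t. t \<in> {a..b} \<Longrightarrow> deriv_on a b f t \<noteq> 0"
    and \<theta>: "tangent_angle (a, b, f) \<theta>"
  shows "absolutely_continuous_on {a..b} \<theta>"
proof (cases "a \<le> b")
  case False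
  then show ?thesis
    using absolutely_continuous_on_dominated[OF ac, of 1 1 \<theta>] by auto
next
  case True
  let ?g = "deriv_on a b f"
  have cont: "continuous_on {a..b} ?g" "continuous_on {a..b} \<theta>"
    using absolutely_continuous_on_imp_continuous_on[OF ac] \<theta> by auto
  obtain x0 where x0: "x0 \<in> {a..b}" "\<And>x. x \<in> {a..b} \<Longrightarrow> norm (?g x0) \<le> norm (?g x)"
    using continuous_attains_inf[of "{a..b}" "\<lambda>x. norm (?g x)"] True continuous_on_norm[OF cont(1)] by auto
  define m where "m = norm (?g x0)"
  have "m > 0" using nz x0 by (auto simp: m_def)
  obtain \<delta> where \<delta>: "\<delta> > 0" "\<And>x y. x \<in> {a..b} \<Longrightarrow> y \<in> {a..b} \<Longrightarrow> dist y x < \<delta> \<Longrightarrow> dist (\<theta> y) (\<theta> x) < 1"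
    using compact_uniformly_continuous[OF cont(2)] unfolding uniformly_continuous_on_def
    by (metis compact_Icc zero_less_one)
  have sin_ge: "\<bar>u\<bar> / 2 \<le> \<bar>sin u\<bar>" if "\<bar>u\<bar> < 1" for u :: real
  proof -
    have *: "u / 2 \<le> sin u" if u: "0 \<le> u" "u < 1" for u :: real
    proof (cases "u = 0")
      case False
      then obtain z where z: "0 < z" "z < u" "sin u - sin 0 = (u - 0) * cos z"
        using MVT2[of 0 u sin cos] u by auto
      \<comment> \<open>Since \<open>z < 1 < \<pi>/3\<close>, the cosine is at least 1/2, which is
        the slope needed.\<close>
      have "cos (pi/3) \<le> cos z" using z that pi_gt3 by (intro cos_monotone_0_pi_le) auto
      then have "u * (1/2) \<le> u * cos z" using that by (intro mult_left_mono) (auto simp: cos_60)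
      then show ?thesis using z by simp
    qed auto
    show ?thesis using *[of u] *[of "-u"] that by (cases "u \<ge> 0") auto
  qed
  have cis_ge: "\<bar>x - y\<bar> \<le> 2 * norm (cis x - cis y)" if "\<bar>x - y\<bar> < 1" for x y
  proof -
    have "\<bar>sin (x - y)\<bar> = \<bar>Im ((cis x - cis y) * cnj (cis y))\<bar>"
      by (simp add: sin_diff algebra_simps)
    also have "\<dots> \<le> norm ((cis x - cis y) * cnj (cis y))" by (rule abs_Im_le_cmod)
    also have "\<dots> = norm (cis x - cis y)" by (simp add: norm_mult)
    finally show ?thesis using sin_ge[OF that] by simp
  qed
  have unit: "norm (u / of_real (norm u) - v / of_real (norm v)) \<le> 2 / m * norm (u - v)"
    if "norm u \<ge> m" "norm v \<ge> m" for u v :: complex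
  proof -
    have nz: "norm u > 0" "norm v > 0" using that \<open>m > 0\<close> by linarith+
    have "u / of_real (norm u) - v / of_real (norm v) =
        (u - v) / of_real (norm u) + v * of_real ((norm v - norm u) / (norm u * norm v))"
      using nz by (simp add: field_simps)
    also have "norm \<dots> \<le> norm (u - v) / norm u + norm v * (\<bar>norm v - norm u\<bar> / (norm u * norm v))"
      using norm_triangle_ineq[of "(u - v) / of_real (norm u)" "v * of_real ((norm v - norm u) / (norm u * norm v))"]
      by (simp only: norm_mult norm_divide norm_of_real abs_divide abs_mult abs_norm_cancel)
    also have "\<dots> = (norm (u - v) + \<bar>norm v - norm u\<bar>) / norm u" using nz by (simp add: field_simps)
    also have "\<dots> \<le> (norm (u - v) + norm (u - v)) / norm u"
      using norm_triangle_ineq3[of v u] nz by (intro divide_right_mono) (auto simp: norm_minus_commute)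
    also have "\<dots> \<le> (norm (u - v) + norm (u - v)) / m"
      using that nz \<open>m > 0\<close> by (intro divide_left_mono mult_pos_pos) auto
    finally show ?thesis by simp
  qed
  show ?thesis
  proof (rule absolutely_continuous_on_dominated[OF ac \<delta>(1)])
    show "4 / m > 0" using \<open>m > 0\<close> by simp
    fix x y assume xy: "x \<in> {a..b}" "y \<in> {a..b}" "\<bar>x - y\<bar> < \<delta>"
    have cis_eq: "cis (\<theta> z) = ?g z / of_real (norm (?g z))" if "z \<in> {a..b}" for z
    proof -
      have "?g z = of_real (norm (?g z)) * cis (\<theta> z)" using \<theta> that by auto
      then show ?thesis using nz[OF that] by (metis nonzero_mult_div_cancel_left norm_eq_zero of_real_eq_0_iff)
    qed
    have "\<bar>\<theta> x - \<theta> y\<bar> < 1" using \<delta>(2)[of y x] xy by (simp add: dist_real_def)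
    then have "\<bar>\<theta> x - \<theta> y\<bar> \<le> 2 * norm (cis (\<theta> x) - cis (\<theta> y))" by (rule cis_ge)
    also have "\<dots> \<le> 2 * (2 / m * norm (?g x - ?g y))"
      unfolding cis_eq[OF xy(1)] cis_eq[OF xy(2)]
      using x0(2) xy by (intro mult_left_mono unit) (auto simp: m_def)
    finally show "norm (\<theta> x - \<theta> y) \<le> 4 / m * norm (?g x - ?g y)" by simp
  qed
qed

section \<open>Rectangular elastica\<close>

text \<open>Cutting the sine off at 0 makes this continuous and nonnegative on the whole line, as
  the chain rule for profiles demands of a weight. The calibrations only use arguments in
  \<open>[0, \<pi>]\<close>, where it is the square root of the sine.\<close>

definition sqsin :: "real \<Rightarrow> real" where
  "sqsin v = sqrt (max 0 (sin v))"

definition sqsin_int :: "real \<Rightarrow> real" where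
  "sqsin_int v = (LBINT u=ereal 0..ereal v. sqsin u)"

lemma continuous_on_sqsin [continuous_intros]:
  fixes S :: "real set"
  shows "continuous_on S f \<Longrightarrow> continuous_on S (\<lambda>x. sqsin (f x))"
  unfolding sqsin_def by (auto intro!: continuous_intros)

lemma sqsin_nonneg [simp]: "0 \<le> sqsin v"
  by (simp add: sqsin_def)

lemma sqsin_power2: "0 \<le> v \<Longrightarrow> v \<le> pi \<Longrightarrow> (sqsin v)\<^sup>2 = sin v"
  by (simp add: sqsin_def sin_ge_zero)

lemma sqsin_pos: "0 < v \<Longrightarrow> v < pi \<Longrightarrow> 0 < sqsin v"
  by (simp add: sqsin_def sin_gt_zero)

lemma sqsin_0 [simp]: "sqsin 0 = 0" and sqsin_pi [simp]: "sqsin pi = 0"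
  by (simp_all add: sqsin_def)

lemma sqsin_pi_minus [simp]: "sqsin (pi - v) = sqsin v"
  by (simp add: sqsin_def)

lemma sqsin_int_has_derivative: "(sqsin_int has_real_derivative sqsin t) (at t)"
proof -
  let ?m = "\<bar>t\<bar> + 1"
  have "((\<lambda>u. LBINT y=ereal 0..ereal u. sqsin y) has_vector_derivative sqsin t) (at t within {-?m..?m})"
    by (rule interval_integral_FTC2) (auto intro!: continuous_intros)
  moreover have "at t within {-?m..?m} = at t"
    by (rule at_within_interior) auto
  ultimately show ?thesis
    by (simp add: sqsin_int_def[abs_def] has_real_derivative_iff_has_vector_derivative)
qed

lemmas sqsin_int_derivative_chain [derivative_intros] = DERIV_chain2[OF sqsin_int_has_derivative]

lemma continuous_on_sqsin_int [continuous_intros]: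
  fixes S :: "real set"
  assumes "continuous_on S f"
  shows "continuous_on S (\<lambda>x. sqsin_int (f x))"
proof -
  have "continuous_on UNIV sqsin_int"
    by (rule DERIV_continuous_on[OF sqsin_int_has_derivative])
  then show ?thesis by (rule continuous_on_compose2[OF _ assms]) auto
qed

lemma sqsin_int_0 [simp]: "sqsin_int 0 = 0"
  by (simp add: sqsin_int_def)

lemma sqsin_int_mono: "x \<le> y \<Longrightarrow> sqsin_int x \<le> sqsin_int y"
  using DERIV_nonneg_imp_nondecreasing[of x y sqsin_int] sqsin_int_has_derivative sqsin_nonneg by blast

lemma sqsin_int_strict_mono:
  assumes "0 \<le> x" "x < y" "y \<le> pi"
  shows "sqsin_int x < sqsin_int y"
proof (rule DERIV_pos_imp_increasing_open[OF \<open>x < y\<close>])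
  fix z assume "x < z" "z < y"
  then have "0 < sqsin z" using assms by (intro sqsin_pos) auto
  then show "\<exists>d. (sqsin_int has_real_derivative d) (at z) \<and> 0 < d"
    using sqsin_int_has_derivative by blast
qed (intro continuous_intros)

text \<open>A crude bound, enough to locate a critical arch when both end angles are
  \<open>- \<pi>/2\<close>.\<close>

lemma sqsin_int_pi_le: "sqsin_int pi \<le> pi"
proof -
  obtain z where "sqsin_int pi - sqsin_int 0 = (pi - 0) * sqsin z"
    using MVT2[of 0 pi sqsin_int sqsin] sqsin_int_has_derivative by auto
  moreover have "sqsin z \<le> 1" by (simp add: sqsin_def)
  ultimately show ?thesis using pi_gt_zero by (simp add: mult_left_le)
qed

lemma DERIV_eq_imp_diff_eq:
  fixes f g :: "real \<Rightarrow> real"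
  assumes "\<And>x. (f has_real_derivative d x) (at x)" "\<And>x. (g has_real_derivative d x) (at x)"
  shows "f x - f y = g x - g y"
proof -
  have "((\<lambda>x. f x - g x) has_real_derivative 0) (at x)" for x
    using DERIV_diff[OF assms(1)[of x] assms(2)[of x]] by simp
  then show ?thesis using DERIV_isconst_all[of "\<lambda>x. f x - g x" x y] by force
qed

lemma sqsin_int_pi_minus: "sqsin_int (pi - v) = sqsin_int pi - sqsin_int v"
proof -
  have "- sqsin_int (pi - v) - - sqsin_int (pi - 0) = sqsin_int v - sqsin_int 0"
    by (rule DERIV_eq_imp_diff_eq[where d = sqsin]) (auto intro!: derivative_eq_intros)
  then show ?thesis by simp
qed

text \<open>The tangent angle of the rectangular elastica \<open>R\<close>: \<open>R' = cis omega / \<surd>(1 + sin\<^sup>2)\<close>.\<close>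

definition omega :: "real \<Rightarrow> real" where
  "omega t = pi / 2 - 2 * arcsin (cos t / sqrt 2)"

lemma cos_div_sqrt2: "\<bar>cos t / sqrt 2\<bar> < 1" "\<bar>cos t / sqrt 2\<bar> \<le> 1 / sqrt 2" "(cos t / sqrt 2)\<^sup>2 = (cos t)\<^sup>2 / 2"
proof -
  have "\<bar>cos t\<bar> / sqrt 2 \<le> 1 / sqrt 2" by (intro divide_right_mono) auto
  then show "\<bar>cos t / sqrt 2\<bar> \<le> 1 / sqrt 2" by simp
  moreover have "1 / sqrt 2 < 1" by simp
  ultimately show "\<bar>cos t / sqrt 2\<bar> < 1" by linarith
qed (simp add: power_divide)

lemma sqrt_1_plus_sin: "sqrt (1 - (cos t / sqrt 2)\<^sup>2) = sqrt (1 + (sin t)\<^sup>2) / sqrt 2"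
proof -
  have eq: "1 - (cos t)\<^sup>2 / 2 = (1 + (sin t)\<^sup>2) / 2" by (simp add: cos_squared_eq field_simps)
  show ?thesis by (simp only: cos_div_sqrt2(3) eq real_sqrt_divide)
qed

lemma sqrt_1_plus_sin_pos: "0 < sqrt (1 + (sin t)\<^sup>2)" "0 < 1 + (sin (t::real))\<^sup>2"
  by (auto intro: add_pos_nonneg)

lemma cos_div_sqrt2_bounds: "- 1 < cos t / sqrt 2" "cos t / sqrt 2 < 1" "- 1 \<le> cos t / sqrt 2" "cos t / sqrt 2 \<le> 1"
    "- (1 / sqrt 2) \<le> cos t / sqrt 2" "cos t / sqrt 2 \<le> 1 / sqrt 2"
  using cos_div_sqrt2(1,2)[of t] by linarith+

lemma arcsin_inverse_sqrt2: "arcsin (1 / sqrt 2) = pi / 4" "arcsin (- (1 / sqrt 2)) = - (pi / 4)"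
proof -
  show *: "arcsin (1 / sqrt 2) = pi / 4"
    by (simp add: arcsin_unique[of "pi/4"] sin_45 real_div_sqrt field_simps)
  have "- 1 \<le> 1 / sqrt 2" by (rule order_trans[of _ 0]) auto
  then show "arcsin (- (1 / sqrt 2)) = - (pi / 4)"
    using arcsin_minus[of "1 / sqrt 2"] * by simp
qed

lemma omega_has_derivative: "(omega has_real_derivative 2 * sin t / sqrt (1 + (sin t)\<^sup>2)) (at t)"
proof -
  have "((\<lambda>t. cos t / sqrt 2) has_real_derivative - sin t / sqrt 2) (at t)"
    by (rule DERIV_cdivide[OF DERIV_cos])
  then have "((\<lambda>t. arcsin (cos t / sqrt 2)) has_real_derivative
      inverse (sqrt (1 - (cos t / sqrt 2)\<^sup>2)) * (- sin t / sqrt 2)) (at t)"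
    by (rule DERIV_chain2[where f = arcsin and g = "\<lambda>t. cos t / sqrt 2", OF DERIV_arcsin[OF cos_div_sqrt2_bounds(1,2)]])
  moreover have "inverse (sqrt (1 - (cos t / sqrt 2)\<^sup>2)) * (- sin t / sqrt 2) = - sin t / sqrt (1 + (sin t)\<^sup>2)"
    unfolding sqrt_1_plus_sin using sqrt_1_plus_sin_pos[of t] by (simp add: field_simps)
  ultimately have "((\<lambda>t. arcsin (cos t / sqrt 2)) has_real_derivative - sin t / sqrt (1 + (sin t)\<^sup>2)) (at t)" by simp
  from DERIV_diff[OF DERIV_const DERIV_cmult[OF this]] show ?thesis
    unfolding omega_def[abs_def] by simp
qed

lemma continuous_on_omega: "continuous_on S omega"
  by (rule DERIV_continuous_on[OF has_field_derivative_at_within[OF omega_has_derivative]])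

lemma sin_omega: "sin (omega t) = (sin t)\<^sup>2"
proof -
  have "sin (omega t) = cos (2 * arcsin (cos t / sqrt 2))"
    by (simp add: omega_def sin_diff)
  also have "\<dots> = 1 - 2 * (cos t / sqrt 2)\<^sup>2"
    by (simp only: cos_double_sin sin_arcsin[OF cos_div_sqrt2_bounds(3,4)])
  finally show ?thesis by (simp add: cos_div_sqrt2(3) sin_squared_eq)
qed

lemma cos_omega: "cos (omega t) = cos t * sqrt (1 + (sin t)\<^sup>2)"
proof -
  have "cos (omega t) = sin (2 * arcsin (cos t / sqrt 2))"
    by (simp add: omega_def cos_diff)
  also have "\<dots> = 2 * (cos t / sqrt 2) * sqrt (1 - (cos t / sqrt 2)\<^sup>2)"
    by (simp only: sin_double sin_arcsin[OF cos_div_sqrt2_bounds(3,4)] cos_arcsin[OF cos_div_sqrt2_bounds(3,4)])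
  finally show ?thesis by (simp add: sqrt_1_plus_sin)
qed

lemma omega_bounds: "0 \<le> omega t" "omega t \<le> pi"
proof -
  have "arcsin (cos t / sqrt 2) \<le> arcsin (1 / sqrt 2)" "arcsin (- (1 / sqrt 2)) \<le> arcsin (cos t / sqrt 2)"
    using cos_div_sqrt2_bounds[of t] by (intro arcsin_le_arcsin; simp)+
  then show "0 \<le> omega t" "omega t \<le> pi" by (auto simp: omega_def arcsin_inverse_sqrt2)
qed

lemma omega_0: "omega 0 = 0" and omega_pi: "omega pi = pi"
  using arcsin_inverse_sqrt2 by (simp_all add: omega_def)

lemma omega_minus: "omega (- t) = omega t" and omega_plus_pi: "omega (t + pi) = pi - omega t"
  using arcsin_minus[OF cos_div_sqrt2_bounds(3,4)[of t]] by (simp_all add: omega_def)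

lemma omega_2pi_minus: "omega (2 * pi - t) = omega t"
  by (simp add: omega_def cos_diff)

lemmas elastica_xi_derivative_chain [derivative_intros] = DERIV_chain2[OF elastica_xi_has_derivative]

lemma elastica_xi_plus_pi: "elastica_xi (t + pi) = elastica_xi t + elastica_xi pi"
  and elastica_xi_minus: "elastica_xi (- t) = - elastica_xi t"
proof -
  have "elastica_xi (t + pi) - elastica_xi (0 + pi) = elastica_xi t - elastica_xi 0"
    by (rule DERIV_eq_imp_diff_eq[where f = "\<lambda>t. elastica_xi (t + pi)" and g = elastica_xi])
      (rule derivative_eq_intros elastica_xi_has_derivative refl | simp)+
  then show "elastica_xi (t + pi) = elastica_xi t + elastica_xi pi" by (simp add: elastica_xi_0)
  have "- elastica_xi (- t) - - elastica_xi (- 0) = elastica_xi t - elastica_xi 0"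
    by (rule DERIV_eq_imp_diff_eq[where f = "\<lambda>t. - elastica_xi (- t)" and g = elastica_xi])
      (rule derivative_eq_intros elastica_xi_has_derivative refl | simp)+
  then show "elastica_xi (- t) = - elastica_xi t" by (simp add: elastica_xi_0)
qed

lemma elastica_xi_2pi_minus: "elastica_xi (2 * pi - t) = 2 * elastica_xi pi - elastica_xi t"
  using elastica_xi_plus_pi[of "- t"] elastica_xi_plus_pi[of "- t + pi"] elastica_xi_minus[of t]
  by (simp add: algebra_simps)

text \<open>Substitution of the tangent angle: \<open>sqsin (omega t) = sin t\<close> on this half
  period, so both sides have the derivative
  \<open>2 sin\<^sup>2 t / \<surd>(1 + sin\<^sup>2 t)\<close>. It turns the primitive used by the
  calibration into a height on the elastica.\<close>

lemma sqsin_int_omega: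
  assumes "0 \<le> t" "t \<le> pi"
  shows "sqsin_int (omega t) = 2 * elastica_xi t"
proof (cases "t = 0")
  case False
  with assms have "0 < t" by simp
  have d: "((\<lambda>t. sqsin_int (omega t) - 2 * elastica_xi t) has_real_derivative 0) (at x)" if "0 < x" "x < t" for x
  proof -
    have "sqsin (omega x) = sin x"
      using that assms sin_ge_zero[of x] by (simp add: sqsin_def sin_omega)
    then show ?thesis
      by (auto intro!: derivative_eq_intros omega_has_derivative elastica_xi_has_derivative simp: power2_eq_square)
  qed
  have "sqsin_int (omega t) - 2 * elastica_xi t = sqsin_int (omega 0) - 2 * elastica_xi 0"
  proof (rule DERIV_isconst_end[OF \<open>0 < t\<close>])
    show "continuous_on {0..t} (\<lambda>t. sqsin_int (omega t) - 2 * elastica_xi t)"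
      by (intro continuous_intros continuous_on_omega
          DERIV_continuous_on[OF has_field_derivative_at_within[OF elastica_xi_has_derivative]])
  qed (use d in auto)
  then show ?thesis by (simp add: omega_0 elastica_xi_0)
qed (simp add: omega_0 elastica_xi_0)

lemma omega_mono:
  assumes "0 \<le> s" "s \<le> t" "t \<le> pi"
  shows "omega s \<le> omega t"
proof (rule DERIV_nonneg_imp_nondecreasing[OF \<open>s \<le> t\<close>])
  fix x assume "s \<le> x" "x \<le> t"
  then have "0 \<le> sin x" using assms by (intro sin_ge_zero) auto
  then show "\<exists>y. (omega has_real_derivative y) (at x) \<and> 0 \<le> y"
    using omega_has_derivative[of x] sqrt_1_plus_sin_pos(1)[of x] by (meson divide_nonneg_pos mult_nonneg_nonneg zero_le_numeral)
qed

text \<open>Translates the angle \<open>x = g - \<theta>\<close> into a point of the elastica. The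
  values of \<open>sin t\<close> and \<open>elastica_xi t\<close> convert the critical equations
  into the two components of the chord; the strict bounds on \<open>t\<close> later keep arcs
  shorter than a full period.\<close>

lemma omega_surj:
  assumes "0 \<le> x" "x \<le> pi"
  shows "\<exists>t. 0 \<le> t \<and> t \<le> pi \<and> omega t = pi - x \<and> sin t = sqsin x \<and>
    sqsin_int (pi - x) = 2 * elastica_xi t \<and> (x < pi \<longrightarrow> 0 < t) \<and> (0 < x \<longrightarrow> t < pi)"
proof -
  obtain t where t: "0 \<le> t" "t \<le> pi" "omega t = pi - x"
    using IVT'[of omega 0 "pi - x" pi] assms omega_0 omega_pi continuous_on_omega by auto
  have "sin x = (sin t)\<^sup>2" using sin_omega[of t] t by simp
  then have "sin t = sqsin x" using t sin_ge_zero[of t] by (simp add: sqsin_def)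
  moreover have "sqsin_int (pi - x) = 2 * elastica_xi t" using sqsin_int_omega[of t] t by simp
  moreover have "x < pi \<longrightarrow> 0 < t" using t omega_0 by (cases "t = 0") auto
  moreover have "0 < x \<longrightarrow> t < pi" using t omega_pi by (cases "t = pi") auto
  ultimately show ?thesis using t by blast
qed

text \<open>From \<open>sin (g - a) = cos g (tan g cos a - sin a)\<close> the square of the ratio is
  \<open>(tan g cos a - sin a) / cos g\<close>, where the numerator does not decrease and the
  denominator strictly decreases. This is why the energy bound has only one critical point.\<close>

lemma sqsin_ratio_strict_mono:
  assumes "- pi/2 \<le> a" "a \<le> pi/2" "a \<le> g1" "0 \<le> g1" "g1 < g2" "g2 < pi/2"
  shows "sqsin (g1 - a) / cos g1 < sqsin (g2 - a) / cos g2"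
proof -
  have c: "0 < cos g1" "0 < cos g2" "cos g2 < cos g1"
    using assms by (auto intro!: cos_gt_zero_pi cos_monotone_0_pi)
  have "0 \<le> cos a" using assms by (intro cos_ge_zero) auto
  define q where "q g = tan g * cos a - sin a" for g
  have q: "sin (g - a) = q g * cos g" if "cos g > 0" for g
    using that by (simp add: q_def tan_def sin_diff field_simps)
  have s: "0 \<le> sin (g1 - a)" "0 < sin (g2 - a)"
    using assms by (auto intro!: sin_ge_zero sin_gt_zero)
  have qpos: "0 \<le> q g1" "0 < q g2" using s q c by (simp_all add: zero_le_mult_iff zero_less_mult_iff)
  have "tan g1 \<le> tan g2" using assms tan_monotone[of g1 g2] by auto
  then have "q g1 \<le> q g2" unfolding q_def using \<open>0 \<le> cos a\<close> by (simp add: mult_right_mono)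
  have "q g1 / cos g1 \<le> q g2 / cos g1" using \<open>q g1 \<le> q g2\<close> c by (simp add: divide_right_mono)
  also have "\<dots> < q g2 / cos g2" using qpos c by (simp add: divide_strict_left_mono)
  finally have lt: "q g1 / cos g1 < q g2 / cos g2" .
  have sq: "sqsin (g - a) / cos g = sqrt (q g / cos g)" if "0 < cos g" "0 \<le> q g" for g
  proof -
    have "sqsin (g - a) / cos g = sqrt (q g * cos g) / sqrt (cos g * cos g)"
      using that q by (simp add: sqsin_def)
    also have "\<dots> = sqrt ((q g * cos g) / (cos g * cos g))"
      by (simp only: real_sqrt_divide)
    also have "\<dots> = sqrt (q g / cos g)"
      using that by simp
    finally show ?thesis .
  qed
  show ?thesis using sq[of g1] sq[of g2] lt qpos c by simp
qed

section \<open>Critical arcs\<close>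

text \<open>The function \<open>\<Psi>\<close> of the overview, with \<open>a\<close> and
  \<open>b\<close> the end angles and \<open>g\<close> the angle at which the curve turns
  back.\<close>

definition arch_energy :: "real \<Rightarrow> real \<Rightarrow> real \<Rightarrow> real \<Rightarrow> real" where
  "arch_energy a b m g = 2 * m * (sqsin_int (g - a) + sqsin_int (g - b)) - m\<^sup>2 * sin g"

lemma arch_energy_has_derivative:
  "(arch_energy a b m has_real_derivative m * (2 * (sqsin (g - a) + sqsin (g - b)) - m * cos g)) (at g)"
  unfolding arch_energy_def[abs_def]
  by (auto intro!: derivative_eq_intros simp: algebra_simps power2_eq_square)

lemma continuous_on_arch_energy: "continuous_on S (arch_energy a b m)"
  by (rule DERIV_continuous_on[OF has_field_derivative_at_within[OF arch_energy_has_derivative]])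

text \<open>While \<open>cos g > 0\<close>, the derivative has the sign of twice the sum of the two
  ratios \<open>sqsin (g - a) / cos g\<close> and \<open>sqsin (g - b) / cos g\<close> minus
  \<open>m\<close>, and the ratios increase; from \<open>\<pi>/2\<close> on,
  \<open>- m cos g\<close> is itself nonnegative. The hypothesis \<open>crit\<close> is an
  inequality so that the lemma also applies at the \<open>g\<close> of a monotone arc, which need
  not be critical for \<open>\<Psi>\<close>.\<close>

lemma arch_energy_increasing:
  assumes "- pi/2 \<le> b" "b \<le> a" "a \<le> pi/2" "0 < m" "a \<le> g0" "0 \<le> g0" "g0 < g" "g \<le> b + pi"
    and crit: "m * cos g0 \<le> 2 * (sqsin (g0 - a) + sqsin (g0 - b))"
  shows "arch_energy a b m g0 < arch_energy a b m g"
proof (rule DERIV_pos_imp_increasing_open[OF \<open>g0 < g\<close>])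
  fix z assume z: "g0 < z" "z < g"
  have "m * cos z < 2 * (sqsin (z - a) + sqsin (z - b))"
  proof (cases "z < pi/2")
    case True
    have c: "0 < cos g0" "0 < cos z" using assms z True by (auto intro!: cos_gt_zero_pi)
    have "m \<le> 2 * (sqsin (g0 - a) / cos g0 + sqsin (g0 - b) / cos g0)"
      using crit c by (simp add: field_simps)
    also have "\<dots> < 2 * (sqsin (z - a) / cos z + sqsin (z - b) / cos z)"
      using sqsin_ratio_strict_mono[of a g0 z] sqsin_ratio_strict_mono[of b g0 z] assms z True by auto
    finally show ?thesis using c by (simp add: field_simps)
  next
    case False
    have "cos z = - sin (z - pi/2)" by (simp add: sin_diff)
    moreover have "0 \<le> sin (z - pi/2)" using False z assms by (intro sin_ge_zero) auto
    ultimately have "m * cos z \<le> 0" using assms by (simp add: mult_nonneg_nonpos)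
    moreover have "0 < sqsin (z - a)" using z assms by (intro sqsin_pos) auto
    ultimately show ?thesis using sqsin_nonneg[of "z - b"] by argo
  qed
  then show "\<exists>y. (arch_energy a b m has_real_derivative y) (at z) \<and> 0 < y"
    using \<open>0 < m\<close> arch_energy_has_derivative[of a b m z]
    by (intro exI[of _ "m * (2 * (sqsin (z - a) + sqsin (z - b)) - m * cos z)"] conjI mult_pos_pos) auto
qed (rule continuous_on_arch_energy)

lemma arch_energy_decreasing:
  assumes "- pi/2 \<le> b" "b \<le> a" "a \<le> pi/2" "0 < m" "a \<le> g" "0 \<le> g" "g < g0" "g0 < pi/2"
    and crit: "2 * (sqsin (g0 - a) + sqsin (g0 - b)) \<le> m * cos g0"
  shows "arch_energy a b m g0 < arch_energy a b m g"
proof (rule DERIV_neg_imp_decreasing_open[OF \<open>g < g0\<close>])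
  fix z assume z: "g < z" "z < g0"
  have c: "0 < cos g0" "0 < cos z" using assms z by (auto intro!: cos_gt_zero_pi)
  have "2 * (sqsin (z - a) / cos z + sqsin (z - b) / cos z) < 2 * (sqsin (g0 - a) / cos g0 + sqsin (g0 - b) / cos g0)"
    using sqsin_ratio_strict_mono[of a z g0] sqsin_ratio_strict_mono[of b z g0] assms z by auto
  also have "\<dots> \<le> m" using crit c by (simp add: field_simps)
  finally have "2 * (sqsin (z - a) + sqsin (z - b)) < m * cos z" using c by (simp add: field_simps)
  then show "\<exists>y. (arch_energy a b m has_real_derivative y) (at z) \<and> y < 0"
    using \<open>0 < m\<close> arch_energy_has_derivative[of a b m z]
    by (intro exI[of _ "m * (2 * (sqsin (z - a) + sqsin (z - b)) - m * cos z)"] conjI mult_pos_neg) auto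
qed (rule continuous_on_arch_energy)

text \<open>The two equations are the components of the chord of the arc sought, and the first is
  also the vanishing of the derivative of \<open>\<Psi>\<close> at \<open>g\<close>. Eliminating
  \<open>m\<close> leaves \<open>h g = 0\<close>. For \<open>0 < a\<close> the hypothesis
  \<open>lo\<close> says \<open>h a < 0\<close>; for \<open>a \<le> 0\<close> the negative value is
  found at 0.\<close>

lemma arch_critical_exists:
  assumes ab: "- pi/2 \<le> b" "b \<le> a" "a \<le> pi/2" "b < 0"
    and lo: "0 < a \<Longrightarrow> 2 * sqsin (a - b) * sin a < sqsin_int (a - b) * cos a"
  obtains g m where "max a 0 < g" "g < pi/2" "0 < m" "2 * (sqsin (g - a) + sqsin (g - b)) = m * cos g"
    "sqsin_int (g - a) + sqsin_int (g - b) = m * sin g"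
proof -
  define h where "h g = 2 * (sqsin (g - a) + sqsin (g - b)) * sin g - (sqsin_int (g - a) + sqsin_int (g - b)) * cos g" for g
  define l where "l = max a 0"
  have "a \<noteq> pi/2"
  proof
    assume "a = pi/2"
    moreover have "0 < a" "sin a = 1" "cos a = 0" unfolding \<open>a = pi/2\<close> by simp_all
    ultimately have "2 * sqsin (a - b) < 0" using lo by simp
    then show False using sqsin_nonneg[of "a - b"] by linarith
  qed
  then have "a < pi/2" using ab by simp
  then have "l < pi/2" by (auto simp: l_def max_def)
  have hl: "h l < 0"
  proof (cases "0 < a")
    case True then show ?thesis using lo by (simp add: h_def l_def)
  next
    case False
    moreover have "sqsin_int 0 \<le> sqsin_int (- a)" using False by (intro sqsin_int_mono) auto
    moreover have "sqsin_int 0 < sqsin_int (- b)" using ab pi_gt_zero by (intro sqsin_int_strict_mono) auto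
    ultimately show ?thesis by (simp add: h_def l_def)
  qed
  have "\<exists>g1. l < g1 \<and> g1 \<le> pi/2 \<and> 0 < h g1"
  proof (cases "a = - pi/2")
    case False
    then have "0 < cos a" using ab \<open>a < pi/2\<close> by (intro cos_gt_zero_pi) auto
    then have "0 < sqsin (pi/2 - a)" by (simp add: sqsin_def sin_diff)
    then have "0 < sqsin (pi/2 - a) + sqsin (pi/2 - b)" by (rule add_pos_nonneg) simp
    then have "0 < h (pi/2)" by (simp add: h_def)
    then show ?thesis using \<open>l < pi/2\<close> by blast
  next
    case True
    then have eq: "b = - pi/2" "l = 0" using ab by (auto simp: l_def)
    \<comment> \<open>Here \<open>h (pi/2) = 0\<close>, so a positive value is found at another point.\<close>
    define g1 where "g1 = arccos (3/10)"
    have g1: "cos g1 = 3/10" "0 < g1" "g1 < pi/2"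
      using arccos_lt_bounded[of "3/10"] arccos_less_arccos[of 0 "3/10"] by (auto simp: g1_def)
    have sg: "sin g1 > 0" "(sin g1)\<^sup>2 = 91/100"
      using g1(2,3) unfolding sin_squared_eq g1(1) by (auto intro!: sin_gt_zero simp: power2_eq_square)
    \<comment> \<open>With \<open>r = cos g1\<close> and the bound \<open>\<pi>\<close> for
      \<open>sqsin_int\<close>, positivity of \<open>h g1\<close> reduces to
      \<open>\<pi> \<surd>r < 2 \<surd>(1 - r\<^sup>2)\<close>. The value \<open>r = 3/10\<close>
      satisfies it with room for a rough estimate of \<open>\<pi>\<close>.\<close>
    have "pi < 315/100" using pi_approx by simp
    then have "pi\<^sup>2 < (315/100)\<^sup>2" by (intro power_strict_mono) auto
    moreover have "(pi * sqrt (3/10))\<^sup>2 = pi\<^sup>2 * (3/10)" "(2 * sin g1)\<^sup>2 = 4 * (91/100)"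
      by (simp_all only: power_mult_distrib sg) simp_all
    ultimately have "(pi * sqrt (3/10))\<^sup>2 < (2 * sin g1)\<^sup>2" by (simp add: power_divide)
    then have lt: "pi * sqrt (3/10) < 2 * sin g1" using sg by (intro power2_less_imp_less[of _ "2 * sin g1"]) auto
    have Y: "sqsin_int (g1 - a) \<le> pi"
      using sqsin_int_mono[of "g1 - a" pi] sqsin_int_pi_le True g1 by simp
    have S: "sqsin (g1 - a) = sqrt (3/10)"
      using True g1 by (simp add: sqsin_def sin_add)
    define r where "r = sqrt (3/10)"
    have r: "r * r = 3/10" "0 < r" by (simp_all add: r_def)
    have "h g1 = 4 * r * sin g1 - 2 * sqsin_int (g1 - a) * (3/10)"
      using S True by (simp add: h_def eq g1 r_def)
    then have hg1: "h g1 = 2 * r * (2 * sin g1 - sqsin_int (g1 - a) * r)"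
      by (simp only: r(1)[symmetric]) (simp add: algebra_simps)
    have "sqsin_int (g1 - a) * r \<le> pi * r" using Y r by (intro mult_right_mono) auto
    moreover have "pi * r < 2 * sin g1" using lt by (simp only: r_def)
    ultimately have "0 < 2 * sin g1 - sqsin_int (g1 - a) * r" by linarith
    then have "0 < h g1" unfolding hg1 using r(2) by (intro mult_pos_pos) auto
    then show ?thesis using g1 eq by auto
  qed
  then obtain g1 where g1: "l < g1" "g1 \<le> pi/2" "0 < h g1" by blast
  have "continuous_on {l..g1} h" unfolding h_def by (intro continuous_intros)
  then obtain g where g: "l \<le> g" "g \<le> g1" "h g = 0" using IVT'[of h l 0 g1] hl g1 by auto
  then have "l < g" "g < g1" using hl g1 by (cases "g = l"; cases "g = g1"; force)+
  then have gg: "a < g" "0 < g" "g < pi/2" using g1 by (auto simp: l_def)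
  have c: "0 < cos g" using gg by (intro cos_gt_zero_pi) auto
  define m where "m = 2 * (sqsin (g - a) + sqsin (g - b)) / cos g"
  show thesis
  proof
    have "0 < sqsin (g - a)" using gg ab by (intro sqsin_pos) auto
    then have "0 < sqsin (g - a) + sqsin (g - b)" by (rule add_pos_nonneg) simp
    then show "0 < m" using c unfolding m_def by (intro divide_pos_pos mult_pos_pos) simp_all
    show "2 * (sqsin (g - a) + sqsin (g - b)) = m * cos g" using c by (simp add: m_def)
    show "sqsin_int (g - a) + sqsin_int (g - b) = m * sin g" using c g(3) by (simp add: m_def h_def field_simps)
  qed (use gg in auto)
qed

text \<open>Complements the arches when \<open>b < 0 < a\<close>: the hypotheses \<open>lo\<close>
  are the negated arch conditions for the curve and for its reversed mirror image, and they are
  precisely the signs of \<open>h\<close> at \<open>a\<close> and \<open>b + \<pi>\<close>. The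
  location of \<open>g\<close> puts \<open>[b, a]\<close> into \<open>[g - \<pi>, g]\<close>, the
  range in which a calibration is valid.\<close>

lemma monotone_critical_exists:
  assumes ab: "- pi/2 \<le> b" "b < 0" "0 < a" "a \<le> pi/2"
    and lo: "sqsin_int (a - b) * cos a \<le> 2 * sqsin (a - b) * sin a"
      "sqsin_int (a - b) * cos b \<le> 2 * sqsin (a - b) * sin (- b)"
  obtains g m where "a \<le> g" "g \<le> b + pi" "0 < m" "2 * (sqsin (g - b) - sqsin (g - a)) = m * cos g"
    "sqsin_int (g - b) - sqsin_int (g - a) = m * sin g"
proof -
  define h where "h g = 2 * (sqsin (g - b) - sqsin (g - a)) * sin g - (sqsin_int (g - b) - sqsin_int (g - a)) * cos g" for g
  have "a \<le> b + pi" using ab by simp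
  have "0 \<le> h a" using lo by (simp add: h_def)
  moreover have "h (b + pi) \<le> 0"
  proof -
    have "b + pi - a = pi - (a - b)" by simp
    then have "sqsin (b + pi - a) = sqsin (a - b)" "sqsin_int (b + pi - a) = sqsin_int pi - sqsin_int (a - b)"
      by (simp_all only: sqsin_pi_minus sqsin_int_pi_minus)
    then show ?thesis using lo by (simp add: h_def)
  qed
  moreover have "continuous_on {a..b + pi} h" unfolding h_def by (intro continuous_intros)
  ultimately obtain g where g: "a \<le> g" "g \<le> b + pi" "h g = 0"
    using IVT2'[of h "b + pi" 0 a] \<open>a \<le> b + pi\<close> by auto
  have s: "0 < sin g" using g ab by (intro sin_gt_zero) auto
  define m where "m = (sqsin_int (g - b) - sqsin_int (g - a)) / sin g"
  show thesis
  proof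
    have "sqsin_int (g - a) < sqsin_int (g - b)" using g ab by (intro sqsin_int_strict_mono) auto
    then show "0 < m" using s by (simp add: m_def)
    show "2 * (sqsin (g - b) - sqsin (g - a)) = m * cos g" using s g(3) by (simp add: m_def h_def field_simps)
    show "sqsin_int (g - b) - sqsin_int (g - a) = m * sin g" using s by (simp add: m_def)
  qed (use g in auto)
qed

text \<open>The image of \<open>R\<close> on \<open>[t1, t2]\<close> under rotation by \<open>g - \<pi>\<close> and scaling by \<open>2/m\<close> has chord \<open>1\<close> and end directions \<open>a\<close>, \<open>b\<close>.
  The curvature of that image at parameter \<open>t\<close> is \<open>m sin t\<close>.\<close>

definition elastica_arc :: "real \<Rightarrow> real \<Rightarrow> real \<Rightarrow> real \<Rightarrow> real \<Rightarrow> real \<Rightarrow> bool" where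
  "elastica_arc a b g m t1 t2 \<longleftrightarrow> 0 < m \<and> t1 < t2 \<and> t2 < t1 + 2 * pi \<and>
     (\<exists>k::int. of_int k * pi \<le> t1 \<and> t2 \<le> (of_int k + 2) * pi) \<and>
     a = g - pi + omega t1 \<and> b = g - pi + omega t2 \<and>
     sin t2 - sin t1 = - (m / 2) * cos g \<and> elastica_xi t2 - elastica_xi t1 = m / 2 * sin g"

text \<open>The inflection point sits at parameter \<open>\<pi>\<close>, where the tangent angle is
  \<open>g\<close>. The start \<open>t\<close> lies before it and the end \<open>2 \<pi> - s\<close>
  after it; strictness of the bounds excludes a full period.\<close>

lemma elastica_arc_of_arch:
  assumes "0 < m" "0 < g - a" "g - a < pi" "0 < g - b" "g - b < pi"
    and eq: "2 * (sqsin (g - a) + sqsin (g - b)) = m * cos g" "sqsin_int (g - a) + sqsin_int (g - b) = m * sin g"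
  obtains t1 t2 where "elastica_arc a b g m t1 t2" "sin t1 = sqsin (g - a)" "sin t2 = - sqsin (g - b)"
proof -
  obtain t where t: "0 \<le> t" "t \<le> pi" "omega t = pi - (g - a)" "sin t = sqsin (g - a)"
    "sqsin_int (pi - (g - a)) = 2 * elastica_xi t" "0 < t" "t < pi"
    using omega_surj[of "g - a"] assms(2-5) less_imp_le by blast
  obtain s where s: "0 \<le> s" "s \<le> pi" "omega s = pi - (g - b)" "sin s = sqsin (g - b)"
    "sqsin_int (pi - (g - b)) = 2 * elastica_xi s" "0 < s" "s < pi"
    using omega_surj[of "g - b"] assms(2-5) less_imp_le by blast
  have pi: "sqsin_int pi = 2 * elastica_xi pi" using sqsin_int_omega[of pi] omega_pi by simp
  show thesis
  proof
    show "elastica_arc a b g m t (2 * pi - s)"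
      unfolding elastica_arc_def
    proof (intro conjI exI[of _ 0])
      show "elastica_xi (2 * pi - s) - elastica_xi t = m / 2 * sin g"
        using eq(2) t(5) s(5) pi by (simp add: elastica_xi_2pi_minus sqsin_int_pi_minus)
      show "sin (2 * pi - s) - sin t = - (m / 2) * cos g"
        using eq(1) t(4) s(4) by (simp add: sin_diff)
    qed (use assms(1) t(1-3,6,7) s(1-3,6,7) in \<open>auto simp: omega_2pi_minus\<close>)
  qed (use t(4) s(4) in \<open>auto simp: sin_diff\<close>)
qed

text \<open>Both parameters lie in \<open>[\<pi>, 2 \<pi>]\<close>, where the curvature
  \<open>m sin t\<close> is nonpositive, so the tangent angle falls from \<open>a\<close> to
  \<open>b\<close> throughout.\<close>

lemma elastica_arc_of_monotone:
  assumes "0 < m" "0 \<le> g - a" "g - a < g - b" "g - b \<le> pi"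
    and eq: "2 * (sqsin (g - b) - sqsin (g - a)) = m * cos g" "sqsin_int (g - b) - sqsin_int (g - a) = m * sin g"
  obtains t1 t2 where "elastica_arc a b g m t1 t2" "sin t1 = - sqsin (g - a)" "sin t2 = - sqsin (g - b)"
proof -
  have "g - a \<le> pi" "0 \<le> g - b" using assms by linarith+
  obtain t where t: "0 \<le> t" "t \<le> pi" "omega t = pi - (g - a)" "sin t = sqsin (g - a)"
    "sqsin_int (pi - (g - a)) = 2 * elastica_xi t"
    using omega_surj[of "g - a"] \<open>0 \<le> g - a\<close> \<open>g - a \<le> pi\<close> by blast
  obtain s where s: "0 \<le> s" "s \<le> pi" "omega s = pi - (g - b)" "sin s = sqsin (g - b)"
    "sqsin_int (pi - (g - b)) = 2 * elastica_xi s"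
    using omega_surj[of "g - b"] \<open>0 \<le> g - b\<close> \<open>g - b \<le> pi\<close> by blast
  have "s < t" using omega_mono[of t s] t s assms by force
  show thesis
  proof
    show "elastica_arc a b g m (2 * pi - t) (2 * pi - s)"
      unfolding elastica_arc_def
    proof (intro conjI exI[of _ 0])
      show "elastica_xi (2 * pi - s) - elastica_xi (2 * pi - t) = m / 2 * sin g"
        using eq(2) t(5) s(5) by (simp add: elastica_xi_2pi_minus sqsin_int_pi_minus)
      show "sin (2 * pi - s) - sin (2 * pi - t) = - (m / 2) * cos g"
        using eq(1) t(4) s(4) by (simp add: sin_diff)
    qed (use assms(1) t(1-3) s(1-3) \<open>s < t\<close> in \<open>auto simp: omega_2pi_minus\<close>)
  qed (use t(4) s(4) in \<open>auto simp: sin_diff\<close>)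
qed

text \<open>Reflection in the real axis. A shift by half a period changes the sign of
  \<open>sin t\<close>, and \<open>omega (t + \<pi>) = \<pi> - omega t\<close> explains the new
  angle \<open>\<pi> - g\<close>.\<close>

lemma elastica_arc_neg:
  assumes "elastica_arc a b g m t1 t2"
  shows "elastica_arc (- a) (- b) (pi - g) m (t1 + pi) (t2 + pi)"
proof -
  obtain k :: int where "of_int k * pi \<le> t1" "t2 \<le> (of_int k + 2) * pi"
    using assms by (auto simp: elastica_arc_def)
  then have "of_int (k + 1) * pi \<le> t1 + pi \<and> t2 + pi \<le> (of_int (k + 1) + 2) * pi"
    by (simp add: algebra_simps)
  then have "\<exists>k::int. of_int k * pi \<le> t1 + pi \<and> t2 + pi \<le> (of_int k + 2) * pi" by blast
  moreover note A = assms[unfolded elastica_arc_def]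
  ultimately show ?thesis
    unfolding elastica_arc_def
  proof (intro conjI)
    show "sin (t2 + pi) - sin (t1 + pi) = - (m / 2) * cos (pi - g)" using A by simp
    show "elastica_xi (t2 + pi) - elastica_xi (t1 + pi) = m / 2 * sin (pi - g)"
      using A by (simp add: elastica_xi_plus_pi)
    show "- a = pi - g - pi + omega (t1 + pi)" "- b = pi - g - pi + omega (t2 + pi)"
      using A by (auto simp: omega_plus_pi)
  qed (use A in auto)
qed

text \<open>Reversal here means the curve \<open>1 - F (L - s)\<close>, a half turn of the reversed
  curve about the midpoint of the chord. It keeps the chord and runs through the same tangent angles
  backwards, hence \<open>g\<close> stays.\<close>

lemma elastica_arc_rev:
  assumes "elastica_arc a b g m t1 t2"
  shows "elastica_arc b a g m (- t2) (- t1)"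
proof -
  obtain k :: int where "of_int k * pi \<le> t1" "t2 \<le> (of_int k + 2) * pi"
    using assms by (auto simp: elastica_arc_def)
  then have "of_int (- k - 2) * pi \<le> - t2 \<and> - t1 \<le> (of_int (- k - 2) + 2) * pi"
    by (simp add: algebra_simps)
  then have "\<exists>k::int. of_int k * pi \<le> - t2 \<and> - t1 \<le> (of_int k + 2) * pi" by blast
  moreover note A = assms[unfolded elastica_arc_def]
  ultimately show ?thesis
    unfolding elastica_arc_def
  proof (intro conjI)
    show "sin (- t1) - sin (- t2) = - (m / 2) * cos g" using A by simp
    show "elastica_xi (- t1) - elastica_xi (- t2) = m / 2 * sin g"
      using A by (simp add: elastica_xi_minus)
    show "b = g - pi + omega (- t2)" "a = g - pi + omega (- t1)"
      using A by (auto simp: omega_minus)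
  qed (use A in auto)
qed

section \<open>Energy bounds for tangent angles\<close>

lemma has_integral_0_nonneg_imp_negligible:
  fixes f :: "'a::euclidean_space \<Rightarrow> real"
  assumes f: "(f has_integral 0) S" and nonneg: "\<And>x. x \<in> S \<Longrightarrow> 0 \<le> f x"
  shows "negligible {x \<in> S. f x \<noteq> 0}"
proof -
  define F where "F = (\<lambda>x. if x \<in> S then f x else 0)"
  have F: "(F has_integral 0) UNIV" "\<And>x. 0 \<le> F x"
    using f nonneg by (auto simp: F_def has_integral_restrict_UNIV)
  then have "F \<in> borel_measurable lebesgue" "integral\<^sup>N lebesgue F = 0"
    using has_integral_iff_nn_integral_lebesgue[of F 0] by auto
  then have "AE x in lebesgue. ennreal (F x) = 0"
    using nn_integral_0_iff_AE[of "\<lambda>x. ennreal (F x)" lebesgue] by auto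
  then have "AE x in lebesgue. F x = 0"
    by eventually_elim (use F(2) in \<open>auto simp: ennreal_eq_0_iff intro: antisym\<close>)
  then obtain N where "negligible N" "{x. F x \<noteq> 0} \<subseteq> N"
    unfolding eventually_ae_filter_negligible by blast
  moreover from this have "{x \<in> S. f x \<noteq> 0} \<subseteq> N" by (auto simp: F_def)
  ultimately show ?thesis by (metis negligible_subset)
qed

lemma has_integral_flip:
  fixes f :: "real \<Rightarrow> 'a::real_normed_vector"
  assumes "(f has_integral I) {a..b}"
  shows "((\<lambda>x. f (L - x)) has_integral I) {L - b..L - a}"
proof -
  have "((\<lambda>x. f ((-1) *\<^sub>R x + L)) has_integral (1 / \<bar>-1\<bar> ^ DIM(real)) *\<^sub>R I)
      ((\<lambda>x. (1 / (-1)) *\<^sub>R x + - ((1 / (-1)) *\<^sub>R L)) ` cbox a b)"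
    using assms by (intro has_integral_affinity) auto
  moreover have "(\<lambda>x. (1 / (-1)) *\<^sub>R x + - ((1 / (-1)) *\<^sub>R L)) ` cbox a b = {L - b..L - a}"
    by (auto simp: image_iff intro!: bexI[of _ "L - x" for x])
  ultimately show ?thesis by simp
qed

text \<open>\<open>h\<close> is the curvature. The chain rule for nonnegative \<open>w\<close> expresses that \<open>\<theta>\<close> is absolutely continuous with \<open>\<theta>' = h\<close> almost
  everywhere, in the only form that is needed.\<close>

definition s_profile :: "real \<Rightarrow> real \<Rightarrow> real \<Rightarrow> (real \<Rightarrow> real) \<Rightarrow> (real \<Rightarrow> real) \<Rightarrow> bool" where
  "s_profile a b L \<theta> h \<longleftrightarrow> 0 < L \<and> \<theta> 0 = a \<and> \<theta> L = b \<and> continuous_on {0..L} \<theta> \<and>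
     (\<exists>c\<in>{0..L}. (mono_on {0..c} \<theta> \<and> antimono_on {c..L} \<theta> \<or> antimono_on {0..c} \<theta> \<and> mono_on {c..L} \<theta>) \<and>
        \<bar>\<theta> c - a\<bar> \<le> pi \<and> \<bar>b - \<theta> c\<bar> \<le> pi) \<and>
     (\<forall>P w s t. (\<forall>x. (P has_real_derivative w x) (at x)) \<longrightarrow> continuous_on UNIV w \<longrightarrow> (\<forall>x. 0 \<le> w x) \<longrightarrow>
        0 \<le> s \<longrightarrow> s \<le> t \<longrightarrow> t \<le> L \<longrightarrow> ((\<lambda>u. w (\<theta> u) * h u) has_integral P (\<theta> t) - P (\<theta> s)) {s..t}) \<and>
     ((\<lambda>s. cis (\<theta> s)) has_integral 1) {0..L}"

lemma s_profile_chain: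
  assumes "s_profile a b L \<theta> h" "\<And>x. (P has_real_derivative w x) (at x)" "continuous_on UNIV w" "\<And>x. 0 \<le> w x"
    "0 \<le> s" "s \<le> t" "t \<le> L"
  shows "((\<lambda>u. w (\<theta> u) * h u) has_integral P (\<theta> t) - P (\<theta> s)) {s..t}"
  using assms unfolding s_profile_def by blast

lemma s_profile_angle_integral:
  assumes "s_profile a b L \<theta> h" "0 \<le> s" "s \<le> t" "t \<le> L"
  shows "(h has_integral \<theta> t - \<theta> s) {s..t}"
  using s_profile_chain[OF assms(1), of "\<lambda>x. x" "\<lambda>_. 1" s t] assms by auto

lemma s_profile_sqsin_integral:
  assumes "s_profile a b L \<theta> h" "0 \<le> s" "s \<le> t" "t \<le> L"
  shows "((\<lambda>u. sqsin (g - \<theta> u) * h u) has_integral sqsin_int (g - \<theta> s) - sqsin_int (g - \<theta> t)) {s..t}"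
proof -
  have "((\<lambda>u. sqsin (g - \<theta> u) * h u) has_integral (- sqsin_int (g - \<theta> t)) - (- sqsin_int (g - \<theta> s))) {s..t}"
  proof (rule s_profile_chain[OF assms(1), where P = "\<lambda>x. - sqsin_int (g - x)" and w = "\<lambda>x. sqsin (g - x)"])
    show "((\<lambda>x. - sqsin_int (g - x)) has_real_derivative sqsin (g - x)) (at x)" for x
      by (auto intro!: derivative_eq_intros)
    show "continuous_on UNIV (\<lambda>x. sqsin (g - x))" by (intro continuous_intros)
  qed (use assms in auto)
  then show ?thesis by simp
qed

lemma cis_integral_sin:
  assumes "((\<lambda>s. cis (\<theta> s)) has_integral 1) S"
  shows "((\<lambda>s. sin (g - \<theta> s)) has_integral sin g) S"
proof -
  have "bounded_linear (\<lambda>z. Im (cis g * cnj z))"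
    by (intro bounded_linear_compose[OF bounded_linear_Im] bounded_linear_compose[OF bounded_linear_mult_right] bounded_linear_cnj)
  from has_integral_linear[OF assms this] show ?thesis by (simp add: o_def sin_diff)
qed

lemma s_profile_chord:
  assumes "s_profile a b L \<theta> h"
  shows "((\<lambda>s. sin (g - \<theta> s)) has_integral sin g) {0..L}" "((\<lambda>s. cos (\<theta> s - g)) has_integral cos g) {0..L}"
proof -
  have sin: "((\<lambda>s. sin (g - \<theta> s)) has_integral sin g) {0..L}" for g
    using assms by (intro cis_integral_sin) (simp add: s_profile_def)
  then show "((\<lambda>s. sin (g - \<theta> s)) has_integral sin g) {0..L}" .
  show "((\<lambda>s. cos (\<theta> s - g)) has_integral cos g) {0..L}"
    using sin[of "g + pi/2"] by (simp add: sin_add sin_diff cos_add cos_diff mult.commute)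
qed

section \<open>Reflection and reversal of profiles\<close>

lemma s_profile_neg:
  assumes "s_profile a b L \<theta> h"
  shows "s_profile (- a) (- b) L (\<lambda>s. - \<theta> s) (\<lambda>s. - h s)"
proof -
  obtain c where c: "c \<in> {0..L}" "mono_on {0..c} \<theta> \<and> antimono_on {c..L} \<theta> \<or> antimono_on {0..c} \<theta> \<and> mono_on {c..L} \<theta>"
    "\<bar>\<theta> c - a\<bar> \<le> pi" "\<bar>b - \<theta> c\<bar> \<le> pi"
    using assms by (auto simp: s_profile_def)
  have c': "\<exists>c\<in>{0..L}. (mono_on {0..c} (\<lambda>s. - \<theta> s) \<and> antimono_on {c..L} (\<lambda>s. - \<theta> s) \<or>
      antimono_on {0..c} (\<lambda>s. - \<theta> s) \<and> mono_on {c..L} (\<lambda>s. - \<theta> s)) \<and> \<bar>- \<theta> c - - a\<bar> \<le> pi \<and> \<bar>- b - - \<theta> c\<bar> \<le> pi"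
  proof (rule bexI[OF _ c(1)], intro conjI)
    show "(mono_on {0..c} (\<lambda>s. - \<theta> s) \<and> antimono_on {c..L} (\<lambda>s. - \<theta> s) \<or>
      antimono_on {0..c} (\<lambda>s. - \<theta> s) \<and> mono_on {c..L} (\<lambda>s. - \<theta> s))"
      using c(2) by (auto simp: monotone_on_def)
  qed (use c in auto)
  have chain: "((\<lambda>u. w (- \<theta> u) * - h u) has_integral P (- \<theta> t) - P (- \<theta> s)) {s..t}"
    if P: "\<forall>x. (P has_real_derivative w x) (at x)" and w: "continuous_on UNIV w" "\<forall>x. 0 \<le> w x"
      and st: "0 \<le> s" "s \<le> t" "t \<le> L" for P w s t
  proof -
    have "((\<lambda>u. w (- \<theta> u) * h u) has_integral - P (- \<theta> t) - - P (- \<theta> s)) {s..t}"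
    proof (rule s_profile_chain[OF assms, where P = "\<lambda>x. - P (- x)" and w = "\<lambda>x. w (- x)"])
      show "((\<lambda>x. - P (- x)) has_real_derivative w (- x)) (at x)" for x
      proof -
        have "((\<lambda>x. P (- x)) has_real_derivative w (- x) * (- 1)) (at x)"
          by (rule DERIV_chain2[where f = P and g = uminus, OF P[rule_format]]) (auto intro!: derivative_eq_intros)
        from DERIV_minus[OF this] show ?thesis by simp
      qed
      show "continuous_on UNIV (\<lambda>x. w (- x))"
        by (rule continuous_on_compose2[OF w(1)]) (auto intro!: continuous_intros)
    qed (use w st in auto)
    from has_integral_neg[OF this] show ?thesis by simp
  qed
  have "((\<lambda>s. cis (\<theta> s)) has_integral 1) {0..L}" using assms by (simp add: s_profile_def)
  from has_integral_linear[OF this bounded_linear_cnj]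
  have cis: "((\<lambda>s. cis (- \<theta> s)) has_integral 1) {0..L}" by (simp add: o_def cis_cnj)
  have "continuous_on {0..L} (\<lambda>s. - \<theta> s)" using assms by (auto simp: s_profile_def intro!: continuous_intros)
  moreover have "0 < L" "- \<theta> 0 = - a" "- \<theta> L = - b" using assms by (auto simp: s_profile_def)
  ultimately show ?thesis
    unfolding s_profile_def using c' cis by (intro conjI allI impI chain) (assumption | erule spec)+
qed

lemma monotone_on_flip:
  fixes \<theta> :: "real \<Rightarrow> real"
  shows "mono_on {x..y} \<theta> \<Longrightarrow> antimono_on {L - y..L - x} (\<lambda>s. \<theta> (L - s))"
    and "antimono_on {x..y} \<theta> \<Longrightarrow> mono_on {L - y..L - x} (\<lambda>s. \<theta> (L - s))"
  by (auto simp: monotone_on_def)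

lemma s_profile_rev:
  assumes "s_profile a b L \<theta> h"
  shows "s_profile b a L (\<lambda>s. \<theta> (L - s)) (\<lambda>s. - h (L - s))"
proof -
  obtain c where c: "c \<in> {0..L}" "mono_on {0..c} \<theta> \<and> antimono_on {c..L} \<theta> \<or> antimono_on {0..c} \<theta> \<and> mono_on {c..L} \<theta>"
    "\<bar>\<theta> c - a\<bar> \<le> pi" "\<bar>b - \<theta> c\<bar> \<le> pi"
    using assms by (auto simp: s_profile_def)
  let ?\<theta> = "\<lambda>s. \<theta> (L - s)"
  have c': "\<exists>c\<in>{0..L}. (mono_on {0..c} ?\<theta> \<and> antimono_on {c..L} ?\<theta> \<or>
      antimono_on {0..c} ?\<theta> \<and> mono_on {c..L} ?\<theta>) \<and> \<bar>?\<theta> c - b\<bar> \<le> pi \<and> \<bar>a - ?\<theta> c\<bar> \<le> pi"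
  proof (intro bexI[of _ "L - c"] conjI)
    show "mono_on {0..L - c} ?\<theta> \<and> antimono_on {L - c..L} ?\<theta> \<or> antimono_on {0..L - c} ?\<theta> \<and> mono_on {L - c..L} ?\<theta>"
      using c(2) monotone_on_flip(1)[of 0 c \<theta> L] monotone_on_flip(1)[of c L \<theta> L]
        monotone_on_flip(2)[of 0 c \<theta> L] monotone_on_flip(2)[of c L \<theta> L] by auto
  qed (use c in auto)
  have chain: "((\<lambda>u. w (\<theta> (L - u)) * - h (L - u)) has_integral P (\<theta> (L - t)) - P (\<theta> (L - s))) {s..t}"
    if P: "\<forall>x. (P has_real_derivative w x) (at x)" and w: "continuous_on UNIV w" "\<forall>x. 0 \<le> w x"
      and st: "0 \<le> s" "s \<le> t" "t \<le> L" for P w s t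
  proof -
    have "((\<lambda>u. w (\<theta> u) * h u) has_integral P (\<theta> (L - s)) - P (\<theta> (L - t))) {L - t..L - s}"
      using P w st by (intro s_profile_chain[OF assms]) auto
    from has_integral_neg[OF has_integral_flip[OF this, of L]] show ?thesis by simp
  qed
  have "((\<lambda>s. cis (\<theta> s)) has_integral 1) {0..L}" using assms by (simp add: s_profile_def)
  from has_integral_flip[OF this, of L]
  have cis: "((\<lambda>s. cis (?\<theta> s)) has_integral 1) {0..L}" by simp
  have "continuous_on {0..L} \<theta>" using assms by (auto simp: s_profile_def)
  then have "continuous_on {0..L} ?\<theta>"
    by (rule continuous_on_compose2) (auto intro!: continuous_intros)
  moreover have "0 < L" "\<theta> (L - 0) = b" "\<theta> (L - L) = a" using assms by (auto simp: s_profile_def)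
  ultimately show ?thesis
    unfolding s_profile_def using c' cis by (intro conjI allI impI chain) (assumption | erule spec)+
qed

text \<open>Expands the square of \<open>h - q\<close>. The mixed term integrates to differences of
  \<open>sqsin_int\<close> by the chain rule and the last term to \<open>m\<^sup>2 sin g\<close> by
  the chord, so the bound sees \<open>\<theta>\<close> only at the ends and at \<open>c\<close>. The
  range hypothesis makes the square of \<open>sqsin\<close> equal to the sine. Independent signs
  before and after \<open>c\<close> let one lemma serve arches and monotone arcs.\<close>

lemma s_profile_calibration:
  fixes g m :: real
  assumes prof: "s_profile a b L \<theta> h" and int: "(\<lambda>u. (h u)\<^sup>2) integrable_on {0..L}" and c: "c \<in> {0..L}"
    and range: "\<And>s. s \<in> {0..L} \<Longrightarrow> g - pi \<le> \<theta> s \<and> \<theta> s \<le> g" and \<sigma>: "\<sigma>1\<^sup>2 = 1" "\<sigma>2\<^sup>2 = (1::real)"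
  defines "q \<equiv> \<lambda>u. (if u \<le> c then \<sigma>1 else \<sigma>2) * m * sqsin (g - \<theta> u)"
    and "B \<equiv> 2 * m * (\<sigma>1 * (sqsin_int (g - a) - sqsin_int (g - \<theta> c)) + \<sigma>2 * (sqsin_int (g - \<theta> c) - sqsin_int (g - b))) - m\<^sup>2 * sin g"
  shows "B \<le> integral {0..L} (\<lambda>u. (h u)\<^sup>2)"
    and "integral {0..L} (\<lambda>u. (h u)\<^sup>2) = B \<Longrightarrow> negligible {u \<in> {0..L}. h u \<noteq> q u}"
proof -
  let ?E = "integral {0..L} (\<lambda>u. (h u)\<^sup>2)"
  have L: "0 < L" "\<theta> 0 = a" "\<theta> L = b" using prof by (auto simp: s_profile_def)
  define r where "r u = (if u \<le> c then \<sigma>1 else \<sigma>2)" for u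
  have "((\<lambda>u. r u * (sqsin (g - \<theta> u) * h u)) has_integral
      \<sigma>1 * (sqsin_int (g - a) - sqsin_int (g - \<theta> c)) + \<sigma>2 * (sqsin_int (g - \<theta> c) - sqsin_int (g - b))) {0..L}"
  proof (rule has_integral_combine[of 0 c])
    have "((\<lambda>u. \<sigma>1 * (sqsin (g - \<theta> u) * h u)) has_integral \<sigma>1 * (sqsin_int (g - a) - sqsin_int (g - \<theta> c))) {0..c}"
      using s_profile_sqsin_integral[OF prof, of 0 c g] c L by (intro has_integral_mult_right) auto
    then show "((\<lambda>u. r u * (sqsin (g - \<theta> u) * h u)) has_integral \<sigma>1 * (sqsin_int (g - a) - sqsin_int (g - \<theta> c))) {0..c}"
      by (rule has_integral_eq[rotated]) (auto simp: r_def)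
    have "((\<lambda>u. \<sigma>2 * (sqsin (g - \<theta> u) * h u)) has_integral \<sigma>2 * (sqsin_int (g - \<theta> c) - sqsin_int (g - b))) {c..L}"
      using s_profile_sqsin_integral[OF prof, of c L g] c L by (intro has_integral_mult_right) auto
    \<comment> \<open>At \<open>c\<close> itself \<open>r\<close> takes the value
      \<open>\<sigma>1\<close>; this one point is discarded.\<close>
    then show "((\<lambda>u. r u * (sqsin (g - \<theta> u) * h u)) has_integral \<sigma>2 * (sqsin_int (g - \<theta> c) - sqsin_int (g - b))) {c..L}"
      by (rule has_integral_spike[of "{c}", rotated 2]) (auto simp: r_def)
  qed (use c in auto)
  then have "((\<lambda>u. (h u)\<^sup>2 - 2 * m * (r u * (sqsin (g - \<theta> u) * h u)) + m\<^sup>2 * sin (g - \<theta> u)) has_integral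
      ?E - 2 * m * (\<sigma>1 * (sqsin_int (g - a) - sqsin_int (g - \<theta> c)) + \<sigma>2 * (sqsin_int (g - \<theta> c) - sqsin_int (g - b)))
        + m\<^sup>2 * sin g) {0..L}"
    using int s_profile_chord(1)[OF prof]
    by (intro has_integral_add has_integral_diff has_integral_mult_right integrable_integral) auto
  then have *: "((\<lambda>u. (h u - q u)\<^sup>2) has_integral ?E - B) {0..L}"
  proof (rule has_integral_eq[rotated, THEN has_integral_eq_rhs])
    fix u assume u: "u \<in> {0..L}"
    have "(r u)\<^sup>2 = 1" using \<sigma> by (simp add: r_def)
    moreover have "(sqsin (g - \<theta> u))\<^sup>2 = sin (g - \<theta> u)" using range[OF u] by (intro sqsin_power2) auto
    moreover have "(q u)\<^sup>2 = (r u)\<^sup>2 * m\<^sup>2 * (sqsin (g - \<theta> u))\<^sup>2" by (simp add: q_def r_def power_mult_distrib)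
    ultimately have "(q u)\<^sup>2 = m\<^sup>2 * sin (g - \<theta> u)" by simp
    then show "(h u)\<^sup>2 - 2 * m * (r u * (sqsin (g - \<theta> u) * h u)) + m\<^sup>2 * sin (g - \<theta> u) = (h u - q u)\<^sup>2"
      by (simp add: power2_diff) (simp add: q_def r_def)
  qed (simp add: B_def)
  have "0 \<le> ?E - B" by (rule has_integral_nonneg[OF *]) auto
  then show "B \<le> ?E" by simp
  assume "?E = B"
  then show "negligible {u \<in> {0..L}. h u \<noteq> q u}"
    using has_integral_0_nonneg_imp_negligible[of "\<lambda>u. (h u - q u)\<^sup>2" "{0..L}"] * by simp
qed

text \<open>Replaces a curvature known almost everywhere by a continuous representative, which makes
  \<open>\<theta>\<close> continuously differentiable up to both ends.\<close>

lemma s_profile_continuous_curvature: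
  assumes prof: "s_profile a b L \<theta> h" and \<kappa>: "continuous_on {0..L} \<kappa>" and ae: "negligible {u \<in> {0..L}. h u \<noteq> \<kappa> u}"
  shows "\<And>s t. 0 \<le> s \<Longrightarrow> s \<le> t \<Longrightarrow> t \<le> L \<Longrightarrow> (\<kappa> has_integral \<theta> t - \<theta> s) {s..t}"
    and "\<And>s. s \<in> {0..L} \<Longrightarrow> (\<theta> has_real_derivative \<kappa> s) (at s within {0..L})"
proof -
  show *: "(\<kappa> has_integral \<theta> t - \<theta> s) {s..t}" if "0 \<le> s" "s \<le> t" "t \<le> L" for s t
    using that by (intro has_integral_spike[OF ae _ s_profile_angle_integral[OF prof that]]) auto
  fix s assume s: "s \<in> {0..L}"
  have "((\<lambda>t. integral {0..t} \<kappa>) has_real_derivative \<kappa> s) (at s within {0..L})"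
    using integral_has_real_derivative[OF \<kappa> s] .
  then have "((\<lambda>t. integral {0..t} \<kappa> + \<theta> 0) has_real_derivative \<kappa> s) (at s within {0..L})"
    by (auto intro!: derivative_eq_intros)
  then show "(\<theta> has_real_derivative \<kappa> s) (at s within {0..L})"
  proof (rule has_field_derivative_transform_within[of _ _ _ _ 1])
    fix u assume "u \<in> {0..L}"
    then have "integral {0..u} \<kappa> = \<theta> u - \<theta> 0" by (intro integral_unique *) auto
    then show "integral {0..u} \<kappa> + \<theta> 0 = \<theta> u" by simp
  qed (use s in auto)
qed

text \<open>Where \<open>\<kappa>\<close> vanishes the first integral \<open>\<kappa>\<^sup>2 = m\<^sup>2 sin (g - \<theta>)\<close> does not determine \<open>\<kappa>'\<close>: a straight
  segment could be inserted. The boundary values of \<open>\<kappa>\<close> exclude this, because along a straight segment the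
  defect \<open>\<kappa> + (m\<^sup>2/2) \<integral> cos (\<theta> - g)\<close> changes, always with the same sign.\<close>

lemma elastica_ode:
  assumes "0 < L" "0 < m" and \<theta>: "\<And>s. s \<in> {0..L} \<Longrightarrow> (\<theta> has_real_derivative \<kappa> s) (at s within {0..L})"
    and \<kappa>: "continuous_on {0..L} \<kappa>" and sq: "\<And>s. s \<in> {0..L} \<Longrightarrow> (\<kappa> s)\<^sup>2 = m\<^sup>2 * sin (g - \<theta> s)"
    and chord: "((\<lambda>s. cos (\<theta> s - g)) has_integral cos g) {0..L}" and ends: "\<kappa> L - \<kappa> 0 = - (m\<^sup>2 / 2) * cos g"
    and conv: "\<And>s t u. s \<in> {0..L} \<Longrightarrow> t \<in> {0..L} \<Longrightarrow> \<kappa> s = 0 \<Longrightarrow> \<kappa> t = 0 \<Longrightarrow> s \<le> u \<Longrightarrow> u \<le> t \<Longrightarrow> \<kappa> u = 0"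
    and eps: "\<epsilon> \<noteq> 0" "\<And>s. s \<in> {0..L} \<Longrightarrow> \<kappa> s = 0 \<Longrightarrow> cos (\<theta> s - g) = \<epsilon>"
    and s: "s \<in> {0..L}"
  shows "(\<kappa> has_real_derivative - (m\<^sup>2 / 2) * cos (\<theta> s - g)) (at s within {0..L})"
proof -
  have nz: "(\<kappa> has_real_derivative - (m\<^sup>2 / 2) * cos (\<theta> s - g)) (at s within {0..L})"
    if s: "s \<in> {0..L}" "\<kappa> s \<noteq> 0" for s
  proof -
    obtain d where "d > 0" and d: "\<And>u. u \<in> {0..L} \<Longrightarrow> dist u s < d \<Longrightarrow> dist (\<kappa> u) (\<kappa> s) < \<bar>\<kappa> s\<bar>"
      using \<kappa> s unfolding continuous_on_iff by (metis zero_less_abs_iff)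
    have X: "m\<^sup>2 * sin (g - \<theta> s) = (\<kappa> s)\<^sup>2" using sq[OF s(1)] by simp
    have X2: "0 < m\<^sup>2 * sin (g - \<theta> s)" unfolding X using s(2) by simp
    \<comment> \<open>Near a point with nonzero curvature the sign of \<open>\<kappa>\<close> is
      constant, so the first integral can be solved for \<open>\<kappa>\<close> and
      differentiated.\<close>
    have "((\<lambda>u. sgn (\<kappa> s) * sqrt (m\<^sup>2 * sin (g - \<theta> u))) has_real_derivative
        sgn (\<kappa> s) * (inverse (sqrt (m\<^sup>2 * sin (g - \<theta> s))) / 2 * (m\<^sup>2 * (cos (g - \<theta> s) * (0 - \<kappa> s))))) (at s within {0..L})"
      using X2 \<theta>[OF s(1)]
      by (intro DERIV_cmult DERIV_chain2[OF DERIV_real_sqrt] DERIV_chain2[OF DERIV_sin] DERIV_diff DERIV_const) auto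
    moreover have "sgn (\<kappa> s) * (inverse (sqrt (m\<^sup>2 * sin (g - \<theta> s))) / 2 * (m\<^sup>2 * (cos (g - \<theta> s) * (0 - \<kappa> s))))
        = - (m\<^sup>2 / 2) * cos (\<theta> s - g)"
    proof -
      have "cos (g - \<theta> s) = cos (\<theta> s - g)" by (metis cos_minus minus_diff_eq)
      then show ?thesis using s(2) unfolding X by (simp add: sgn_real_def field_simps)
    qed
    ultimately have "((\<lambda>u. sgn (\<kappa> s) * sqrt (m\<^sup>2 * sin (g - \<theta> u))) has_real_derivative - (m\<^sup>2 / 2) * cos (\<theta> s - g)) (at s within {0..L})"
      by (rule DERIV_cong)
    then show ?thesis
    proof (rule has_field_derivative_transform_within[OF _ \<open>d > 0\<close> s(1)])
      fix u assume u: "u \<in> {0..L}" "dist u s < d"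
      then have "dist (\<kappa> u) (\<kappa> s) < \<bar>\<kappa> s\<bar>" by (rule d)
      then have "sgn (\<kappa> u) = sgn (\<kappa> s)" by (auto simp: dist_real_def sgn_real_def)
      then show "sgn (\<kappa> s) * sqrt (m\<^sup>2 * sin (g - \<theta> u)) = \<kappa> u"
        using sq[OF u(1)] by (metis mult.commute abs_mult_sgn real_sqrt_abs)
    qed
  qed
  have cont_\<theta>: "continuous_on {0..L} \<theta>" using \<theta> by (rule DERIV_continuous_on)
  have cont_c: "continuous_on {0..L} (\<lambda>s. cos (\<theta> s - g))" by (intro continuous_intros cont_\<theta>)
  define J where "J s = integral {0..s} (\<lambda>s. cos (\<theta> s - g))" for s
  have J: "(J has_real_derivative cos (\<theta> s - g)) (at s within {0..L})" if "s \<in> {0..L}" for s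
    unfolding J_def using integral_has_real_derivative[OF cont_c that] .
  \<comment> \<open>The defect, whose constancy is the claim. It is constant on either side of the
    zero set \<open>Z\<close> of \<open>\<kappa>\<close>, and \<open>conv\<close> makes
    \<open>Z\<close> an interval.\<close>
  define D where "D s = \<kappa> s + m\<^sup>2 / 2 * J s" for s
  have cont_J: "continuous_on {0..L} J" using J by (rule DERIV_continuous_on)
  then have cont_D: "continuous_on {0..L} D" unfolding D_def by (intro continuous_intros \<kappa>)
  have const: "D p = D q" if pq: "0 \<le> p" "p \<le> q" "q \<le> L" and nzpq: "\<And>u. p < u \<Longrightarrow> u < q \<Longrightarrow> \<kappa> u \<noteq> 0" for p q
  proof (cases "p = q")
    case False
    then have "p < q" using pq by simp
    have "(D has_real_derivative 0) (at u)" if u: "p < u" "u < q" for u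
    proof -
      have "(D has_real_derivative - (m\<^sup>2 / 2) * cos (\<theta> u - g) + m\<^sup>2 / 2 * cos (\<theta> u - g)) (at u within {0..L})"
        unfolding D_def using u pq nzpq by (intro DERIV_add DERIV_cmult nz J) auto
      moreover have "at u within {0..L} = at u" using u pq by (intro at_within_interior) auto
      ultimately show ?thesis by simp
    qed
    moreover have "continuous_on {p..q} D" by (rule continuous_on_subset[OF cont_D]) (use pq in auto)
    ultimately show ?thesis using DERIV_isconst_end[OF \<open>p < q\<close>, of D] by auto
  qed auto
  define Z where "Z = {s \<in> {0..L}. \<kappa> s = 0}"
  have "D s = D 0" if "s \<in> {0..L}" for s
  proof (cases "Z = {}")
    case True
    then show ?thesis using const[of 0 s] that by (fastforce simp: Z_def)
  next
    case False
    have "closed Z" unfolding Z_def using continuous_closed_preimage_constant[OF \<kappa>] by auto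
    moreover have "Z \<subseteq> {0..L}" by (auto simp: Z_def)
    ultimately have "compact Z" by (metis bounded_closed_interval bounded_subset compact_eq_bounded_closed)
    have "is_interval Z" unfolding is_interval_1 Z_def using conv by auto
    then have "connected Z" by (rule is_interval_connected)
    then obtain p q where pq: "Z = {p..q}"
      using connected_compact_interval_1[of Z] \<open>compact Z\<close> by blast
    then have "p \<le> q" using False by auto
    have "p \<in> Z" "q \<in> Z" using pq \<open>p \<le> q\<close> by auto
    then have p: "0 \<le> p" "q \<le> L" "\<kappa> p = 0" "\<kappa> q = 0" by (auto simp: Z_def)
    have out: "\<kappa> u \<noteq> 0" if "0 \<le> u" "u \<le> L" "u < p \<or> q < u" for u
    proof
      assume "\<kappa> u = 0"
      then have "u \<in> Z" using that by (auto simp: Z_def)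
      then show False using that pq by auto
    qed
    have left: "D u = D 0" if "0 \<le> u" "u \<le> p" for u
      using const[of 0 u] that out \<open>p \<le> q\<close> p by auto
    have right: "D u = D q" if "q \<le> u" "u \<le> L" for u
      using const[of q u] that out \<open>p \<le> q\<close> p by auto
    have J0: "J 0 = 0" by (simp add: J_def)
    \<comment> \<open>The chord together with the boundary values of \<open>\<kappa>\<close> gives
      \<open>D\<close> the same value at both ends, so \<open>J\<close> does not change across
      \<open>Z = {p..q}\<close>. As \<open>J\<close> has the constant slope
      \<open>\<epsilon>\<close>, which is not 0, on \<open>Z\<close>, this leaves a single
      point.\<close>
    have "J L = cos g" using chord by (simp add: J_def integral_unique)
    then have "D L = D 0" using ends J0 by (simp add: D_def)
    then have "D q = D p" using left[of p] right[of L] \<open>p \<le> q\<close> p by simp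
    then have "J q = J p" using p \<open>0 < m\<close> by (simp add: D_def)
    have "p = q"
    proof (rule ccontr)
      assume "p \<noteq> q"
      then have "p < q" using \<open>p \<le> q\<close> by simp
      have "((\<lambda>u. J u - \<epsilon> * u) has_real_derivative 0) (at u)" if u: "p < u" "u < q" for u
      proof -
        have "u \<in> Z" using u pq by auto
        then have "cos (\<theta> u - g) = \<epsilon>" "u \<in> {0..L}" using eps by (auto simp: Z_def)
        then have "((\<lambda>u. J u - \<epsilon> * u) has_real_derivative \<epsilon> - \<epsilon> * 1) (at u within {0..L})"
          using J[of u] by (intro DERIV_diff DERIV_cmult DERIV_ident) auto
        moreover have "at u within {0..L} = at u" using u p by (intro at_within_interior) auto
        ultimately show ?thesis by simp
      qed
      moreover have "continuous_on {p..q} (\<lambda>u. J u - \<epsilon> * u)"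
        using p by (intro continuous_intros continuous_on_subset[OF cont_J]) auto
      ultimately have "J q - \<epsilon> * q = J p - \<epsilon> * p"
        using DERIV_isconst_end[OF \<open>p < q\<close>, of "\<lambda>u. J u - \<epsilon> * u"] by auto
      then show False using \<open>J q = J p\<close> eps(1) \<open>p < q\<close> by simp
    qed
    then show ?thesis using left[of s] right[of s] left[of p] that p by fastforce
  qed
  then have \<kappa>_eq: "D 0 - m\<^sup>2 / 2 * J u = \<kappa> u" if "u \<in> {0..L}" for u
    using that by (metis D_def add_diff_cancel_right')
  have "((\<lambda>u. D 0 - m\<^sup>2 / 2 * J u) has_real_derivative 0 - m\<^sup>2 / 2 * cos (\<theta> s - g)) (at s within {0..L})"
    by (intro DERIV_diff DERIV_cmult DERIV_const J s)
  from has_field_derivative_transform_within[OF this zero_less_one s \<kappa>_eq] show ?thesis by simp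
qed

section \<open>Optimality of the critical arcs\<close>

text \<open>What equality in the energy bound reveals. If \<open>\<bar>a - b\<bar> = \<pi>\<close>,
  straight segments at the two ends can compensate each other and the second-order equation may fail
  there; the constant sign of \<open>\<kappa>\<close> is what remains to be combined with
  smoothness.\<close>

definition critical_profile ::
  "real \<Rightarrow> real \<Rightarrow> real \<Rightarrow> real \<Rightarrow> real \<Rightarrow> (real \<Rightarrow> real) \<Rightarrow> (real \<Rightarrow> real) \<Rightarrow> real \<Rightarrow> real \<Rightarrow> bool" where
  "critical_profile a b g m L \<theta> h k0 k1 \<longleftrightarrow>
     (\<exists>\<kappa>. continuous_on {0..L} \<kappa> \<and> negligible {s \<in> {0..L}. h s \<noteq> \<kappa> s} \<and> \<kappa> 0 = k0 \<and> \<kappa> L = k1 \<and>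
        (\<forall>s\<in>{0..L}. (\<kappa> s)\<^sup>2 = m\<^sup>2 * sin (g - \<theta> s)) \<and>
        (\<bar>a - b\<bar> < pi \<longrightarrow>
           (\<forall>s\<in>{0..L}. (\<kappa> has_real_derivative - (m\<^sup>2 / 2) * cos (\<theta> s - g)) (at s within {0..L}))) \<and>
        (\<bar>a - b\<bar> = pi \<longrightarrow> (\<forall>s\<in>{0..L}. \<kappa> s \<le> 0) \<or> (\<forall>s\<in>{0..L}. 0 \<le> \<kappa> s)))"

lemma sqsin_eq_0_iff: "0 \<le> v \<Longrightarrow> v \<le> pi \<Longrightarrow> sqsin v = 0 \<longleftrightarrow> v = 0 \<or> v = pi"
  using sqsin_pos[of v] by (cases "v = 0 \<or> v = pi") auto

lemma arch_energy_critical: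
  assumes "sqsin_int (g - a) + sqsin_int (g - b) = m * sin g"
  shows "arch_energy a b m g = m\<^sup>2 * sin g"
  using assms by (simp add: arch_energy_def power2_eq_square)

text \<open>On this range \<open>sin (g - \<theta>)\<close> is nonnegative, and its integral is
  \<open>sin g\<close>. This excludes \<open>- \<pi> < g < 0\<close>.\<close>

lemma s_profile_sin_nonneg:
  assumes prof: "s_profile a b L \<theta> h" and range: "\<And>s. s \<in> {0..L} \<Longrightarrow> g - pi \<le> \<theta> s \<and> \<theta> s \<le> g" and "- pi < g"
  shows "0 \<le> g"
proof (rule ccontr)
  assume "\<not> 0 \<le> g"
  then have "sin (- g) > 0" using assms by (intro sin_gt_zero) auto
  moreover have "0 \<le> sin g"
    by (rule has_integral_nonneg[OF s_profile_chord(1)[OF prof]]) (use range in \<open>auto intro!: sin_ge_zero simp: algebra_simps\<close>)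
  ultimately show False by simp
qed

text \<open>The competitor is calibrated with its own turning angle \<open>\<theta> c\<close> in
  place of \<open>g\<close>, with sign + while it rises and - while it falls. Since
  \<open>sqsin_int 0 = 0\<close>, the bound becomes a value of \<open>\<Psi>\<close> that depends on
  the competitor through \<open>\<theta> c\<close> alone.\<close>

lemma up_profile_bound:
  assumes prof: "s_profile a b L \<theta> h" and int: "(\<lambda>u. (h u)\<^sup>2) integrable_on {0..L}"
    and ab: "- pi/2 \<le> b" "b \<le> a" "a \<le> pi/2"
    and c: "c \<in> {0..L}" "mono_on {0..c} \<theta>" "antimono_on {c..L} \<theta>" "\<bar>\<theta> c - a\<bar> \<le> pi" "\<bar>b - \<theta> c\<bar> \<le> pi"
  shows "a \<le> \<theta> c" "\<theta> c \<le> b + pi" "0 \<le> \<theta> c" "\<And>s. s \<in> {0..L} \<Longrightarrow> b \<le> \<theta> s \<and> \<theta> s \<le> \<theta> c"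
    "arch_energy a b m (\<theta> c) \<le> integral {0..L} (\<lambda>u. (h u)\<^sup>2)"
    "integral {0..L} (\<lambda>u. (h u)\<^sup>2) = arch_energy a b m (\<theta> c) \<Longrightarrow>
       negligible {u \<in> {0..L}. h u \<noteq> (if u \<le> c then 1 else - 1) * m * sqsin (\<theta> c - \<theta> u)}"
proof -
  have L: "0 < L" "\<theta> 0 = a" "\<theta> L = b" using prof by (auto simp: s_profile_def)
  have r1: "a \<le> \<theta> s \<and> \<theta> s \<le> \<theta> c" if "s \<in> {0..c}" for s
    using that c(1) L(2) monotone_onD[OF c(2), of 0 s] monotone_onD[OF c(2), of s c] by auto
  have r2: "b \<le> \<theta> s \<and> \<theta> s \<le> \<theta> c" if "s \<in> {c..L}" for s
    using that c(1) L(3) monotone_onD[OF c(3), of s L] monotone_onD[OF c(3), of c s] by auto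
  show range: "b \<le> \<theta> s \<and> \<theta> s \<le> \<theta> c" if "s \<in> {0..L}" for s
    using r1[of s] r2[of s] that ab by (cases "s \<le> c") auto
  show "a \<le> \<theta> c" "\<theta> c \<le> b + pi" using r1[of c] c(1,5) by auto
  then have R: "\<theta> c - pi \<le> \<theta> s \<and> \<theta> s \<le> \<theta> c" if "s \<in> {0..L}" for s
    using range[OF that] by auto
  have "- pi < \<theta> c" using \<open>a \<le> \<theta> c\<close> ab pi_gt_zero by linarith
  with prof R show "0 \<le> \<theta> c" by (rule s_profile_sin_nonneg)
  note cal = s_profile_calibration[OF prof int c(1) R, of 1 "- 1" m, simplified]
  show "arch_energy a b m (\<theta> c) \<le> integral {0..L} (\<lambda>u. (h u)\<^sup>2)"
    using cal(1) by (simp add: arch_energy_def)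
  assume "integral {0..L} (\<lambda>u. (h u)\<^sup>2) = arch_energy a b m (\<theta> c)"
  then show "negligible {u \<in> {0..L}. h u \<noteq> (if u \<le> c then 1 else - 1) * m * sqsin (\<theta> c - \<theta> u)}"
    using cal(2) by (simp add: arch_energy_def)
qed

lemma arch_critical_profile:
  assumes prof: "s_profile a b L \<theta> h" and ab: "- pi/2 \<le> b" "b \<le> a" "a < g" "g < pi/2" and "0 < m"
    and eq: "2 * (sqsin (g - a) + sqsin (g - b)) = m * cos g"
    and c: "c \<in> {0..L}" "mono_on {0..c} \<theta>" "antimono_on {c..L} \<theta>" "\<theta> c = g"
    and range: "\<And>s. s \<in> {0..L} \<Longrightarrow> b \<le> \<theta> s \<and> \<theta> s \<le> g"
    and neg: "negligible {u \<in> {0..L}. h u \<noteq> (if u \<le> c then 1 else - 1) * m * sqsin (g - \<theta> u)}"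
  shows "critical_profile a b g m L \<theta> h (m * sqsin (g - a)) (- m * sqsin (g - b))"
proof -
  have L: "0 < L" "\<theta> 0 = a" "\<theta> L = b" "continuous_on {0..L} \<theta>" using prof by (auto simp: s_profile_def)
  \<comment> \<open>One of the two terms always vanishes, because \<open>\<theta> c = g\<close>. In
    this form continuity across \<open>c\<close> needs no case distinction.\<close>
  define \<kappa> where "\<kappa> u = m * sqsin (g - \<theta> (min u c)) - m * sqsin (g - \<theta> (max u c))" for u
  have \<kappa>: "\<kappa> u = (if u \<le> c then 1 else - 1) * m * sqsin (g - \<theta> u)" for u
    using c(4) by (auto simp: \<kappa>_def max_def min_def)
  have cont: "continuous_on {0..L} \<kappa>"
    unfolding \<kappa>_def
    by (intro continuous_intros continuous_on_compose2[OF L(4)]) (use c in auto)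
  have ae: "negligible {u \<in> {0..L}. h u \<noteq> \<kappa> u}" using neg by (simp add: \<kappa>)
  have R: "0 \<le> g - \<theta> s" "g - \<theta> s < pi" if "s \<in> {0..L}" for s using range[OF that] ab by auto
  have sq: "(\<kappa> s)\<^sup>2 = m\<^sup>2 * sin (g - \<theta> s)" if "s \<in> {0..L}" for s
    using sqsin_power2[of "g - \<theta> s"] R[OF that] by (simp add: \<kappa> power_mult_distrib)
  \<comment> \<open>The other zero of \<open>sqsin\<close>, at \<open>\<pi>\<close>, is out of reach
    since \<open>g - \<theta> s < \<pi>\<close>. Hence the cosine equals 1 at every zero of
    \<open>\<kappa>\<close>.\<close>
  have zero: "\<kappa> s = 0 \<longleftrightarrow> \<theta> s = g" if "s \<in> {0..L}" for s
    using sqsin_eq_0_iff[of "g - \<theta> s"] R[OF that] \<open>0 < m\<close> by (auto simp: \<kappa>)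
  have ends: "\<kappa> 0 = m * sqsin (g - a)" "\<kappa> L = - m * sqsin (g - b)"
    using c(1,4) L by (auto simp: \<kappa>_def max_def min_def)
  have "(\<kappa> has_real_derivative - (m\<^sup>2 / 2) * cos (\<theta> s - g)) (at s within {0..L})" if "s \<in> {0..L}" for s
  proof (rule elastica_ode[where \<epsilon> = 1, OF L(1) \<open>0 < m\<close> s_profile_continuous_curvature(2)[OF prof cont ae] cont sq
        s_profile_chord(2)[OF prof] _ _ _ _ that])
    have "\<kappa> L - \<kappa> 0 = - (m / 2) * (2 * (sqsin (g - a) + sqsin (g - b)))" unfolding ends by (simp add: algebra_simps)
    then show "\<kappa> L - \<kappa> 0 = - (m\<^sup>2 / 2) * cos g" unfolding eq by (simp add: power2_eq_square)
    fix s t u assume st: "s \<in> {0..L}" "t \<in> {0..L}" "\<kappa> s = 0" "\<kappa> t = 0" "s \<le> u" "u \<le> t"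
    then have "\<theta> s = g" "\<theta> t = g" "u \<in> {0..L}" using zero by auto
    moreover have "g \<le> \<theta> u"
    proof (cases "u \<le> c")
      case True
      then show ?thesis using monotone_onD[OF c(2), of s u] st \<open>\<theta> s = g\<close> by auto
    next
      case False
      then show ?thesis using monotone_onD[OF c(3), of u t] st \<open>\<theta> t = g\<close> by auto
    qed
    ultimately show "\<kappa> u = 0" using zero range[of u] by auto
  qed (use zero in auto)
  moreover have "\<bar>a - b\<bar> \<noteq> pi" using ab by auto
  ultimately show ?thesis
    unfolding critical_profile_def using cont ae ends sq by (intro exI[of _ \<kappa>]) auto
qed

text \<open>A competitor that turns up first costs at least \<open>\<Psi>\<close> at its turning
  angle, and \<open>\<Psi>\<close> has its strict minimum at \<open>g\<close>; equality therefore
  forces \<open>\<theta> c = g\<close> and then equality in the calibration.\<close>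

lemma arch_optimal:
  assumes prof: "s_profile a b L \<theta> h" and int: "(\<lambda>u. (h u)\<^sup>2) integrable_on {0..L}"
    and ab: "- pi/2 \<le> b" "b \<le> a" "a \<le> pi/2"
    and g: "max a 0 < g" "g < pi/2" and "0 < m"
    and eq: "2 * (sqsin (g - a) + sqsin (g - b)) = m * cos g" "sqsin_int (g - a) + sqsin_int (g - b) = m * sin g"
  shows "m\<^sup>2 * sin g \<le> integral {0..L} (\<lambda>u. (h u)\<^sup>2) \<and>
    (integral {0..L} (\<lambda>u. (h u)\<^sup>2) = m\<^sup>2 * sin g \<longrightarrow>
      critical_profile a b g m L \<theta> h (m * sqsin (g - a)) (- m * sqsin (g - b)))"
proof -
  let ?E = "integral {0..L} (\<lambda>u. (h u)\<^sup>2)"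
  note E = arch_energy_critical[OF eq(2)]
  have L: "0 < L" "\<theta> 0 = a" "\<theta> L = b" using prof by (auto simp: s_profile_def)
  have dec: "m\<^sup>2 * sin g < arch_energy a b m g'" if "a \<le> g'" "0 \<le> g'" "g' < g" for g'
    using arch_energy_decreasing[of b a m g' g] that ab g \<open>0 < m\<close> eq(1) E by auto
  have inc: "m\<^sup>2 * sin g < arch_energy a b m g'" if "g < g'" "g' \<le> b + pi" for g'
    using arch_energy_increasing[of b a m g g'] that ab g \<open>0 < m\<close> eq(1) E by auto
  obtain c where c: "c \<in> {0..L}" "mono_on {0..c} \<theta> \<and> antimono_on {c..L} \<theta> \<or> antimono_on {0..c} \<theta> \<and> mono_on {c..L} \<theta>"
    "\<bar>\<theta> c - a\<bar> \<le> pi" "\<bar>b - \<theta> c\<bar> \<le> pi"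
    using prof by (auto simp: s_profile_def)
  show ?thesis
  proof (cases "mono_on {0..c} \<theta> \<and> antimono_on {c..L} \<theta>")
    case True
    note up = up_profile_bound[OF prof int ab c(1) conjunct1[OF True] conjunct2[OF True] c(3,4)]
    show ?thesis
    proof (cases "\<theta> c = g")
      case True
      note up = up[unfolded True]
      show ?thesis
      proof (intro conjI impI)
        show "m\<^sup>2 * sin g \<le> ?E" using up(5)[of m] E by simp
        assume "?E = m\<^sup>2 * sin g"
        then show "critical_profile a b g m L \<theta> h (m * sqsin (g - a)) (- m * sqsin (g - b))"
          using up(6)[of m] E \<open>mono_on {0..c} \<theta> \<and> antimono_on {c..L} \<theta>\<close> ab g
          by (intro arch_critical_profile[OF prof _ _ _ _ \<open>0 < m\<close> eq(1) c(1) _ _ True up(4)]) auto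
      qed
    next
      case False
      then have "m\<^sup>2 * sin g < arch_energy a b m (\<theta> c)"
        using dec[of "\<theta> c"] inc[of "\<theta> c"] up(1,2,3) by (cases "\<theta> c < g") auto
      then show ?thesis using up(5)[of m] by linarith
    qed
  next
    case False
    then have mono: "antimono_on {0..c} \<theta>" "mono_on {c..L} \<theta>" using c by auto
    have r1: "\<theta> c \<le> \<theta> s \<and> \<theta> s \<le> a" if "s \<in> {0..c}" for s
      using that c(1) L(2) monotone_onD[OF mono(1), of 0 s] monotone_onD[OF mono(1), of s c] by auto
    have r2: "\<theta> c \<le> \<theta> s \<and> \<theta> s \<le> b" if "s \<in> {c..L}" for s
      using that c(1) L(3) monotone_onD[OF mono(2), of s L] monotone_onD[OF mono(2), of c s] by auto
    have R: "a - pi \<le> \<theta> s \<and> \<theta> s \<le> a" if "s \<in> {0..L}" for s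
      using r1[of s] r2[of s] that ab c(3) by (cases "s \<le> c") auto
    have "- pi < a" using ab pi_gt_zero by linarith
    with prof R have "0 \<le> a" by (rule s_profile_sin_nonneg)
    \<comment> \<open>A competitor that turns down first stays below \<open>a\<close>, so
      \<open>a\<close> serves as calibration angle. With the sign - on both parts the terms at
      \<open>c\<close> cancel, and the bound is \<open>\<Psi>\<close> at \<open>a\<close>, strictly
      above the minimum.\<close>
    have "arch_energy a b m a \<le> ?E"
      using s_profile_calibration(1)[OF prof int c(1) R, of "- 1" "- 1" m] by (simp add: arch_energy_def)
    moreover have "m\<^sup>2 * sin g < arch_energy a b m a" using dec[of a] \<open>0 \<le> a\<close> g by auto
    ultimately show ?thesis by linarith
  qed
qed

text \<open>If the competitor never exceeds the angle \<open>g\<close>, the calibration of the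
  monotone arc itself applies. If it overshoots, the arch bound does: \<open>\<Psi>\<close>
  increases beyond \<open>g\<close>, and \<open>\<Psi> g\<close> is already at least
  \<open>m\<^sup>2 sin g\<close>.\<close>

lemma monotone_optimal_up:
  assumes prof: "s_profile a b L \<theta> h" and int: "(\<lambda>u. (h u)\<^sup>2) integrable_on {0..L}"
    and ab: "- pi/2 \<le> b" "b < 0" "0 < a" "a \<le> pi/2" and g: "a \<le> g" "g \<le> b + pi" and "0 < m"
    and eq: "2 * (sqsin (g - b) - sqsin (g - a)) = m * cos g" "sqsin_int (g - b) - sqsin_int (g - a) = m * sin g"
    and c: "c \<in> {0..L}" "mono_on {0..c} \<theta>" "antimono_on {c..L} \<theta>" "\<bar>\<theta> c - a\<bar> \<le> pi" "\<bar>b - \<theta> c\<bar> \<le> pi"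
  shows "m\<^sup>2 * sin g \<le> integral {0..L} (\<lambda>u. (h u)\<^sup>2) \<and>
    (integral {0..L} (\<lambda>u. (h u)\<^sup>2) = m\<^sup>2 * sin g \<longrightarrow>
      negligible {u \<in> {0..L}. h u \<noteq> - m * sqsin (g - \<theta> u)})"
proof -
  let ?E = "integral {0..L} (\<lambda>u. (h u)\<^sup>2)"
  have ba: "b \<le> a" using ab by simp
  note up = up_profile_bound[OF prof int ab(1) ba ab(4) c]
  show ?thesis
  proof (cases "\<theta> c \<le> g")
    case True
    then have R: "g - pi \<le> \<theta> s \<and> \<theta> s \<le> g" if "s \<in> {0..L}" for s
      using up(4)[OF that] g by auto
    have "m\<^sup>2 * sin g = 2 * m * (sqsin_int (g - b) - sqsin_int (g - a)) - m\<^sup>2 * sin g"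
      unfolding eq(2) by (simp add: power2_eq_square)
    then show ?thesis
      using s_profile_calibration[OF prof int c(1) R, of "- 1" "- 1" m] by (simp add: algebra_simps)
  next
    case False
    have "m * cos g \<le> 2 * (sqsin (g - a) + sqsin (g - b))"
      unfolding eq(1)[symmetric] using sqsin_nonneg[of "g - a"] by argo
    then have "arch_energy a b m g < arch_energy a b m (\<theta> c)"
      using arch_energy_increasing[of b a m g "\<theta> c"] ab ba g \<open>0 < m\<close> False up(2) by auto
    moreover have "m\<^sup>2 * sin g \<le> arch_energy a b m g"
    proof -
      have "0 \<le> sqsin_int (g - a)" using sqsin_int_mono[of 0 "g - a"] g by simp
      then have "m * (m * sin g) \<le> m * (sqsin_int (g - a) + sqsin_int (g - b))"
        using eq(2) \<open>0 < m\<close> by (intro mult_left_mono) auto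
      then show ?thesis by (simp add: arch_energy_def power2_eq_square)
    qed
    ultimately show ?thesis using up(5)[of m] by linarith
  qed
qed

lemma monotone_critical_profile:
  assumes prof: "s_profile a b L \<theta> h"
    and ab: "- pi/2 \<le> b" "b < 0" "0 < a" "a \<le> pi/2" and g: "a \<le> g" "g \<le> b + pi" and "0 < m"
    and eq: "2 * (sqsin (g - b) - sqsin (g - a)) = m * cos g"
    and neg: "negligible {u \<in> {0..L}. h u \<noteq> - m * sqsin (g - \<theta> u)}"
  shows "critical_profile a b g m L \<theta> h (- m * sqsin (g - a)) (- m * sqsin (g - b))"
proof -
  have L: "0 < L" "\<theta> 0 = a" "\<theta> L = b" "continuous_on {0..L} \<theta>" using prof by (auto simp: s_profile_def)
  define \<kappa> where "\<kappa> u = - m * sqsin (g - \<theta> u)" for u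
  have cont: "continuous_on {0..L} \<kappa>" unfolding \<kappa>_def by (intro continuous_intros L)
  have ae: "negligible {u \<in> {0..L}. h u \<noteq> \<kappa> u}" using neg by (simp add: \<kappa>_def)
  have nonpos: "\<kappa> s \<le> 0" for s using \<open>0 < m\<close> by (simp add: \<kappa>_def)
  have anti: "\<theta> t \<le> \<theta> s" if "0 \<le> s" "s \<le> t" "t \<le> L" for s t
    using has_integral_nonneg[OF has_integral_neg[OF s_profile_continuous_curvature(1)[OF prof cont ae that]]] nonpos
    by fastforce
  have range: "b \<le> \<theta> s \<and> \<theta> s \<le> a" if "s \<in> {0..L}" for s
    using anti[of 0 s] anti[of s L] that L by auto
  have R: "0 \<le> g - \<theta> s" "g - \<theta> s \<le> pi" if "s \<in> {0..L}" for s using range[OF that] g by auto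
  have sq: "(\<kappa> s)\<^sup>2 = m\<^sup>2 * sin (g - \<theta> s)" if "s \<in> {0..L}" for s
    using sqsin_power2[of "g - \<theta> s"] R[OF that] by (simp add: \<kappa>_def power_mult_distrib)
  have ends: "\<kappa> 0 = - m * sqsin (g - a)" "\<kappa> L = - m * sqsin (g - b)" using L by (auto simp: \<kappa>_def)
  have ode: "(\<kappa> has_real_derivative - (m\<^sup>2 / 2) * cos (\<theta> s - g)) (at s within {0..L})"
    if "\<bar>a - b\<bar> < pi" and s: "s \<in> {0..L}" for s
  proof -
    have "a - b < pi" using that ab by simp
    \<comment> \<open>As \<open>a - b < \<pi>\<close>, the angle cannot reach both \<open>g\<close>
      and \<open>g - \<pi>\<close>. All zeros of \<open>\<kappa>\<close> thus share one value of
      \<open>g - \<theta>\<close>, and straight segments cannot compensate each other.\<close>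
    then obtain z where z: "z = 0 \<or> z = pi" "\<And>s. s \<in> {0..L} \<Longrightarrow> \<kappa> s = 0 \<longleftrightarrow> g - \<theta> s = z"
    proof (cases "a < g")
      case True
      then have "\<kappa> s = 0 \<longleftrightarrow> g - \<theta> s = pi" if "s \<in> {0..L}" for s
        using sqsin_eq_0_iff[OF R[OF that]] range[OF that] \<open>0 < m\<close> by (auto simp: \<kappa>_def)
      then show ?thesis using that by blast
    next
      case False
      then have "\<kappa> s = 0 \<longleftrightarrow> g - \<theta> s = 0" if "s \<in> {0..L}" for s
        using sqsin_eq_0_iff[OF R[OF that]] range[OF that] \<open>0 < m\<close> \<open>a - b < pi\<close> g by (auto simp: \<kappa>_def)
      then show ?thesis using that by blast
    qed
    show ?thesis
    proof (rule elastica_ode[where \<epsilon> = "cos z", OF L(1) \<open>0 < m\<close> s_profile_continuous_curvature(2)[OF prof cont ae] cont sq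
          s_profile_chord(2)[OF prof] _ _ _ _ s])
      have "\<kappa> L - \<kappa> 0 = - (m / 2) * (2 * (sqsin (g - b) - sqsin (g - a)))" unfolding ends by (simp add: algebra_simps)
      then show "\<kappa> L - \<kappa> 0 = - (m\<^sup>2 / 2) * cos g" unfolding eq by (simp add: power2_eq_square)
      fix s t u assume st: "s \<in> {0..L}" "t \<in> {0..L}" "\<kappa> s = 0" "\<kappa> t = 0" "s \<le> u" "u \<le> t"
      then have "g - \<theta> s = z" "g - \<theta> t = z" "u \<in> {0..L}" using z(2) by auto
      moreover have "\<theta> t \<le> \<theta> u" "\<theta> u \<le> \<theta> s" using anti st by auto
      ultimately show "\<kappa> u = 0" using z(2)[of u] by auto
    next
      fix s assume "s \<in> {0..L}" "\<kappa> s = 0"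
      then have "g - \<theta> s = z" using z by auto
      then show "cos (\<theta> s - g) = cos z" by (metis cos_minus minus_diff_eq)
    qed (use z(1) in auto)
  qed
  show ?thesis
    unfolding critical_profile_def using cont ae ends sq ode nonpos by (intro exI[of _ \<kappa>]) auto
qed

text \<open>Reversal and reflection together turn a profile that goes down first into one that goes
  up first and replace \<open>(a, b, g)\<close> by \<open>(- b, - a, \<pi> - g)\<close>; both
  critical equations are invariant under this.\<close>

lemma monotone_optimal:
  assumes prof: "s_profile a b L \<theta> h" and int: "(\<lambda>u. (h u)\<^sup>2) integrable_on {0..L}"
    and ab: "- pi/2 \<le> b" "b < 0" "0 < a" "a \<le> pi/2" and g: "a \<le> g" "g \<le> b + pi" and "0 < m"
    and eq: "2 * (sqsin (g - b) - sqsin (g - a)) = m * cos g" "sqsin_int (g - b) - sqsin_int (g - a) = m * sin g"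
  shows "m\<^sup>2 * sin g \<le> integral {0..L} (\<lambda>u. (h u)\<^sup>2) \<and>
    (integral {0..L} (\<lambda>u. (h u)\<^sup>2) = m\<^sup>2 * sin g \<longrightarrow>
      critical_profile a b g m L \<theta> h (- m * sqsin (g - a)) (- m * sqsin (g - b)))"
proof -
  let ?E = "integral {0..L} (\<lambda>u. (h u)\<^sup>2)"
  obtain c where c: "c \<in> {0..L}" "mono_on {0..c} \<theta> \<and> antimono_on {c..L} \<theta> \<or> antimono_on {0..c} \<theta> \<and> mono_on {c..L} \<theta>"
    "\<bar>\<theta> c - a\<bar> \<le> pi" "\<bar>b - \<theta> c\<bar> \<le> pi"
    using prof by (auto simp: s_profile_def)
  have "m\<^sup>2 * sin g \<le> ?E \<and> (?E = m\<^sup>2 * sin g \<longrightarrow> negligible {u \<in> {0..L}. h u \<noteq> - m * sqsin (g - \<theta> u)})"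
  proof (cases "mono_on {0..c} \<theta> \<and> antimono_on {c..L} \<theta>")
    case True
    then show ?thesis using monotone_optimal_up[OF prof int ab g \<open>0 < m\<close> eq c(1) _ _ c(3,4)] by blast
  next
    case False
    then have mono: "antimono_on {0..c} \<theta>" "mono_on {c..L} \<theta>" using c by auto
    let ?\<theta> = "\<lambda>s. - \<theta> (L - s)" and ?h = "\<lambda>s. h (L - s)"
    have prof': "s_profile (- b) (- a) L ?\<theta> ?h" using s_profile_neg[OF s_profile_rev[OF prof]] by simp
    have int': "((\<lambda>u. (?h u)\<^sup>2) has_integral ?E) {0..L}"
      using has_integral_flip[OF integrable_integral[OF int], of L] by simp
    have mono': "mono_on {0..L - c} ?\<theta>" "antimono_on {L - c..L} ?\<theta>"
      using monotone_on_flip(2)[OF mono(1), of L] monotone_on_flip(1)[OF mono(2), of L]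
      by (auto simp: monotone_on_def)
    have "pi - g - - b = pi - (g - b)" "pi - g - - a = pi - (g - a)" by simp_all
    then have refl: "sqsin (pi - g - - b) = sqsin (g - b)" "sqsin (pi - g - - a) = sqsin (g - a)"
        "sqsin_int (pi - g - - b) = sqsin_int pi - sqsin_int (g - b)" "sqsin_int (pi - g - - a) = sqsin_int pi - sqsin_int (g - a)"
      by (simp_all only: sqsin_pi_minus sqsin_int_pi_minus)
    have "m\<^sup>2 * sin (pi - g) \<le> integral {0..L} (\<lambda>u. (?h u)\<^sup>2) \<and>
      (integral {0..L} (\<lambda>u. (?h u)\<^sup>2) = m\<^sup>2 * sin (pi - g) \<longrightarrow>
       negligible {u \<in> {0..L}. ?h u \<noteq> - m * sqsin (pi - g - ?\<theta> u)})"
    proof (rule monotone_optimal_up[OF prof' _ _ _ _ _ _ _ \<open>0 < m\<close> _ _ _ mono'])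
      show "2 * (sqsin (pi - g - - a) - sqsin (pi - g - - b)) = m * cos (pi - g)"
        "sqsin_int (pi - g - - a) - sqsin_int (pi - g - - b) = m * sin (pi - g)"
        unfolding refl using eq by simp_all
    qed (use ab g c int' in \<open>auto simp: integrable_on_def\<close>)
    moreover have "integral {0..L} (\<lambda>u. (?h u)\<^sup>2) = ?E" using int' by (rule integral_unique)
    moreover have "negligible {u \<in> {0..L}. h u \<noteq> - m * sqsin (g - \<theta> u)}"
      if "negligible {u \<in> {0..L}. ?h u \<noteq> - m * sqsin (pi - g - ?\<theta> u)}"
    proof (rule negligible_subset)
      show "negligible ((\<lambda>u. L - u) ` {u \<in> {0..L}. ?h u \<noteq> - m * sqsin (pi - g - ?\<theta> u)})"
        by (rule negligible_differentiable_image_negligible[OF _ that]) (auto intro!: derivative_intros)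
      show "{u \<in> {0..L}. h u \<noteq> - m * sqsin (g - \<theta> u)} \<subseteq> (\<lambda>u. L - u) ` {u \<in> {0..L}. ?h u \<noteq> - m * sqsin (pi - g - ?\<theta> u)}"
      proof
        fix u assume u: "u \<in> {u \<in> {0..L}. h u \<noteq> - m * sqsin (g - \<theta> u)}"
        have "pi - g - - \<theta> u = pi - (g - \<theta> u)" by simp
        then have "sqsin (pi - g - - \<theta> u) = sqsin (g - \<theta> u)" by (simp only: sqsin_pi_minus)
        then have "L - u \<in> {u \<in> {0..L}. ?h u \<noteq> - m * sqsin (pi - g - ?\<theta> u)}" using u by simp
        then show "u \<in> (\<lambda>u. L - u) ` {u \<in> {0..L}. ?h u \<noteq> - m * sqsin (pi - g - ?\<theta> u)}"
          by (rule image_eqI[rotated]) simp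
      qed
    qed
    ultimately show ?thesis by simp
  qed
  then show ?thesis using monotone_critical_profile[OF prof ab g \<open>0 < m\<close> eq(1)] by blast
qed

section \<open>Symmetries of the equality case, and existence of optimal arcs\<close>

lemma critical_profile_neg:
  assumes "critical_profile a b g m L \<theta> h k0 k1"
  shows "critical_profile (- a) (- b) (pi - g) m L (\<lambda>s. - \<theta> s) (\<lambda>s. - h s) (- k0) (- k1)"
proof -
  obtain \<kappa> where \<kappa>: "continuous_on {0..L} \<kappa>" "negligible {s \<in> {0..L}. h s \<noteq> \<kappa> s}" "\<kappa> 0 = k0" "\<kappa> L = k1"
    "\<forall>s\<in>{0..L}. (\<kappa> s)\<^sup>2 = m\<^sup>2 * sin (g - \<theta> s)"
    "\<bar>a - b\<bar> < pi \<longrightarrow> (\<forall>s\<in>{0..L}. (\<kappa> has_real_derivative - (m\<^sup>2 / 2) * cos (\<theta> s - g)) (at s within {0..L}))"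
    "\<bar>a - b\<bar> = pi \<longrightarrow> (\<forall>s\<in>{0..L}. \<kappa> s \<le> 0) \<or> (\<forall>s\<in>{0..L}. 0 \<le> \<kappa> s)"
    using assms unfolding critical_profile_def by blast
  have sin: "sin (pi - g - - \<theta> s) = sin (g - \<theta> s)" for s
  proof -
    have "pi - g - - \<theta> s = pi - (g - \<theta> s)" by simp
    then show ?thesis by (simp only: sin_pi_minus)
  qed
  have cos: "cos (- \<theta> s - (pi - g)) = - cos (\<theta> s - g)" for s
  proof -
    have "- \<theta> s - (pi - g) = - (pi + (\<theta> s - g))" by simp
    then show ?thesis by (simp only: cos_minus cos_periodic_pi2)
  qed
  have "\<bar>a - b\<bar> < pi \<longrightarrow> (\<forall>s\<in>{0..L}. ((\<lambda>s. - \<kappa> s) has_real_derivative - (m\<^sup>2 / 2) * cos (- \<theta> s - (pi - g))) (at s within {0..L}))"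
    using \<kappa>(6) unfolding cos by (auto dest!: bspec intro: DERIV_minus[THEN DERIV_cong])
  then show ?thesis
    unfolding critical_profile_def sin using \<kappa>
    by (intro exI[of _ "\<lambda>s. - \<kappa> s"]) (auto intro!: continuous_intros)
qed

lemma critical_profile_rev:
  assumes "critical_profile a b g m L \<theta> h k0 k1" "0 < L"
  shows "critical_profile b a g m L (\<lambda>s. \<theta> (L - s)) (\<lambda>s. - h (L - s)) (- k1) (- k0)"
proof -
  obtain \<kappa> where \<kappa>: "continuous_on {0..L} \<kappa>" "negligible {s \<in> {0..L}. h s \<noteq> \<kappa> s}" "\<kappa> 0 = k0" "\<kappa> L = k1"
    "\<forall>s\<in>{0..L}. (\<kappa> s)\<^sup>2 = m\<^sup>2 * sin (g - \<theta> s)"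
    "\<bar>a - b\<bar> < pi \<longrightarrow> (\<forall>s\<in>{0..L}. (\<kappa> has_real_derivative - (m\<^sup>2 / 2) * cos (\<theta> s - g)) (at s within {0..L}))"
    "\<bar>a - b\<bar> = pi \<longrightarrow> (\<forall>s\<in>{0..L}. \<kappa> s \<le> 0) \<or> (\<forall>s\<in>{0..L}. 0 \<le> \<kappa> s)"
    using assms unfolding critical_profile_def by blast
  have img: "(\<lambda>s. L - s) ` {0..L} = {0..L}" by (auto simp: image_iff intro!: bexI[of _ "L - x" for x])
  let ?\<kappa> = "\<lambda>s. - \<kappa> (L - s)"
  have cont: "continuous_on {0..L} ?\<kappa>"
    by (intro continuous_on_minus continuous_on_compose2[OF \<kappa>(1)] continuous_intros) auto
  have neg: "negligible {s \<in> {0..L}. - h (L - s) \<noteq> ?\<kappa> s}"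
  proof (rule negligible_subset)
    show "negligible ((\<lambda>u. L - u) ` {s \<in> {0..L}. h s \<noteq> \<kappa> s})"
      by (rule negligible_differentiable_image_negligible[OF _ \<kappa>(2)]) (auto intro!: derivative_intros)
    show "{s \<in> {0..L}. - h (L - s) \<noteq> ?\<kappa> s} \<subseteq> (\<lambda>u. L - u) ` {s \<in> {0..L}. h s \<noteq> \<kappa> s}"
      by (auto intro!: image_eqI[of _ _ "L - x" for x])
  qed
  have der: "(?\<kappa> has_real_derivative - (m\<^sup>2 / 2) * cos (\<theta> (L - s) - g)) (at s within {0..L})"
    if "\<bar>b - a\<bar> < pi" "s \<in> {0..L}" for s
  proof -
    have "(\<kappa> has_real_derivative - (m\<^sup>2 / 2) * cos (\<theta> (L - s) - g)) (at (L - s) within (\<lambda>s. L - s) ` {0..L})"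
      using \<kappa>(6) that unfolding img by (auto simp: abs_minus_commute)
    then have "((\<kappa> \<circ> (\<lambda>s. L - s)) has_real_derivative - (m\<^sup>2 / 2) * cos (\<theta> (L - s) - g) * (0 - 1)) (at s within {0..L})"
      by (rule DERIV_image_chain) (intro DERIV_diff DERIV_const DERIV_ident)
    from DERIV_minus[OF this] show ?thesis by (simp add: o_def)
  qed
  show ?thesis
    unfolding critical_profile_def using \<kappa> cont neg der
    by (intro exI[of _ ?\<kappa>]) (auto simp: abs_minus_commute)
qed

text \<open>An arc bundled with the bound it certifies for all profiles with the same end angles, so
  that a symmetry can be applied to both at once. The number \<open>m\<^sup>2 sin g\<close> is the
  integral of the squared curvature of the arc itself.\<close>

definition optimal_arc :: "real \<Rightarrow> real \<Rightarrow> real \<Rightarrow> real \<Rightarrow> real \<Rightarrow> real \<Rightarrow> bool" where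
  "optimal_arc a b g m t1 t2 \<longleftrightarrow> elastica_arc a b g m t1 t2 \<and>
     (\<forall>L \<theta> h. s_profile a b L \<theta> h \<longrightarrow> (\<lambda>u. (h u)\<^sup>2) integrable_on {0..L} \<longrightarrow>
        m\<^sup>2 * sin g \<le> integral {0..L} (\<lambda>u. (h u)\<^sup>2) \<and>
        (integral {0..L} (\<lambda>u. (h u)\<^sup>2) = m\<^sup>2 * sin g \<longrightarrow>
          critical_profile a b g m L \<theta> h (m * sin t1) (m * sin t2)))"

lemma optimal_arcD:
  assumes "optimal_arc a b g m t1 t2" "s_profile a b L \<theta> h" "(\<lambda>u. (h u)\<^sup>2) integrable_on {0..L}"
  shows "m\<^sup>2 * sin g \<le> integral {0..L} (\<lambda>u. (h u)\<^sup>2)"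
    and "integral {0..L} (\<lambda>u. (h u)\<^sup>2) = m\<^sup>2 * sin g \<Longrightarrow>
      critical_profile a b g m L \<theta> h (m * sin t1) (m * sin t2)"
  using assms unfolding optimal_arc_def by blast+

lemma optimal_arc_neg:
  assumes "optimal_arc a b g m t1 t2"
  shows "optimal_arc (- a) (- b) (pi - g) m (t1 + pi) (t2 + pi)"
  unfolding optimal_arc_def
proof (intro conjI allI impI elastica_arc_neg)
  show "elastica_arc a b g m t1 t2" using assms by (simp add: optimal_arc_def)
  fix L \<theta> h assume prof: "s_profile (- a) (- b) L \<theta> h" and int: "(\<lambda>u. (h u)\<^sup>2) integrable_on {0..L}"
  let ?\<theta> = "\<lambda>s. - \<theta> s" and ?h = "\<lambda>s. - h s"
  have *: "m\<^sup>2 * sin g \<le> integral {0..L} (\<lambda>u. (?h u)\<^sup>2) \<and> (integral {0..L} (\<lambda>u. (?h u)\<^sup>2) = m\<^sup>2 * sin g \<longrightarrow>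
      critical_profile a b g m L ?\<theta> ?h (m * sin t1) (m * sin t2))"
    using optimal_arcD[OF assms, of L ?\<theta> ?h] s_profile_neg[OF prof] int by simp
  then show "m\<^sup>2 * sin (pi - g) \<le> integral {0..L} (\<lambda>u. (h u)\<^sup>2)" by simp
  assume "integral {0..L} (\<lambda>u. (h u)\<^sup>2) = m\<^sup>2 * sin (pi - g)"
  with * have "critical_profile a b g m L ?\<theta> ?h (m * sin t1) (m * sin t2)" by simp
  from critical_profile_neg[OF this]
  show "critical_profile (- a) (- b) (pi - g) m L \<theta> h (m * sin (t1 + pi)) (m * sin (t2 + pi))" by simp
qed

lemma optimal_arc_rev:
  assumes "optimal_arc a b g m t1 t2"
  shows "optimal_arc b a g m (- t2) (- t1)"
  unfolding optimal_arc_def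
proof (intro conjI allI impI elastica_arc_rev)
  show "elastica_arc a b g m t1 t2" using assms by (simp add: optimal_arc_def)
  fix L \<theta> h assume prof: "s_profile b a L \<theta> h" and int: "(\<lambda>u. (h u)\<^sup>2) integrable_on {0..L}"
  let ?\<theta> = "\<lambda>s. \<theta> (L - s)" and ?h = "\<lambda>s. - h (L - s)"
  have int': "((\<lambda>u. (?h u)\<^sup>2) has_integral integral {0..L} (\<lambda>u. (h u)\<^sup>2)) {0..L}"
    using has_integral_flip[OF integrable_integral[OF int], of L] by simp
  have *: "m\<^sup>2 * sin g \<le> integral {0..L} (\<lambda>u. (?h u)\<^sup>2) \<and> (integral {0..L} (\<lambda>u. (?h u)\<^sup>2) = m\<^sup>2 * sin g \<longrightarrow>
      critical_profile a b g m L ?\<theta> ?h (m * sin t1) (m * sin t2))"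
    using optimal_arcD[OF assms s_profile_rev[OF prof] has_integral_integrable[OF int']] by blast
  then show "m\<^sup>2 * sin g \<le> integral {0..L} (\<lambda>u. (h u)\<^sup>2)" using integral_unique[OF int'] by simp
  assume "integral {0..L} (\<lambda>u. (h u)\<^sup>2) = m\<^sup>2 * sin g"
  with * have "critical_profile a b g m L ?\<theta> ?h (m * sin t1) (m * sin t2)" using integral_unique[OF int'] by simp
  from critical_profile_rev[OF this] prof
  show "critical_profile b a g m L \<theta> h (m * sin (- t2)) (m * sin (- t1))" by (simp add: s_profile_def)
qed

lemma optimal_arc_exists_arch:
  assumes ab: "- pi/2 \<le> b" "b \<le> a" "a \<le> pi/2" "b < 0"
    and lo: "0 < a \<Longrightarrow> 2 * sqsin (a - b) * sin a < sqsin_int (a - b) * cos a"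
  shows "\<exists>g m t1 t2. optimal_arc a b g m t1 t2"
proof -
  obtain g m where g: "max a 0 < g" "g < pi/2" "0 < m" "2 * (sqsin (g - a) + sqsin (g - b)) = m * cos g"
    "sqsin_int (g - a) + sqsin_int (g - b) = m * sin g"
    using arch_critical_exists[OF ab lo] by metis
  have "0 < g - a" "g - a < pi" "0 < g - b" "g - b < pi" using g ab by auto
  then obtain t1 t2 where "elastica_arc a b g m t1 t2" "sin t1 = sqsin (g - a)" "sin t2 = - sqsin (g - b)"
    using elastica_arc_of_arch[OF g(3) _ _ _ _ g(4,5)] by metis
  then have "optimal_arc a b g m t1 t2"
    unfolding optimal_arc_def using arch_optimal[OF _ _ ab(1-3) g] by simp
  then show ?thesis by blast
qed

theorem optimal_arc_exists:
  assumes "- pi/2 \<le> a" "a \<le> pi/2" "- pi/2 \<le> b" "b \<le> pi/2" "(a, b) \<noteq> (0, 0)"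
  shows "\<exists>g m t1 t2. optimal_arc a b g m t1 t2"
proof -
  \<comment> \<open>The exchange of \<open>(a, b)\<close> for \<open>(- b, - a)\<close> preserves
    \<open>b \<le> a\<close> and puts the condition for an arch at the other end of the
    curve.\<close>
  have flip: "\<exists>g m t1 t2. optimal_arc a b g m t1 t2" if "\<exists>g m t1 t2. optimal_arc (- b) (- a) g m t1 t2" for a b
    using that optimal_arc_rev optimal_arc_neg by (metis minus_minus)
  have wlog: "\<exists>g m t1 t2. optimal_arc a b g m t1 t2"
    if ab: "- pi/2 \<le> b" "b \<le> a" "a \<le> pi/2" "(a, b) \<noteq> (0, 0)" for a b
  proof -
    consider "a \<le> 0" | "0 \<le> b" "0 < a" | "b < 0" "0 < a" by linarith
    then show ?thesis
    proof cases
      case 1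
      then show ?thesis using ab by (intro optimal_arc_exists_arch) auto
    next
      case 2
      show ?thesis
        by (rule flip, rule optimal_arc_exists_arch) (use 2 ab in auto)
    next
      case 3
      show ?thesis
      proof (cases "2 * sqsin (a - b) * sin a < sqsin_int (a - b) * cos a")
        case True
        then show ?thesis using ab 3 by (intro optimal_arc_exists_arch) auto
      next
        case F1: False
        show ?thesis
        proof (cases "2 * sqsin (a - b) * sin (- b) < sqsin_int (a - b) * cos b")
          case True
          show ?thesis by (rule flip, rule optimal_arc_exists_arch) (use True ab 3 in auto)
        next
          case False
          obtain g m where g: "a \<le> g" "g \<le> b + pi" "0 < m" "2 * (sqsin (g - b) - sqsin (g - a)) = m * cos g"
            "sqsin_int (g - b) - sqsin_int (g - a) = m * sin g"
            using monotone_critical_exists[of b a] ab 3 F1 False by (metis not_le)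
          have "0 \<le> g - a" "g - a < g - b" "g - b \<le> pi" using g 3 by auto
          then obtain t1 t2 where "elastica_arc a b g m t1 t2" "sin t1 = - sqsin (g - a)" "sin t2 = - sqsin (g - b)"
            using elastica_arc_of_monotone[OF g(3) _ _ _ g(4,5)] by metis
          then have "optimal_arc a b g m t1 t2"
            unfolding optimal_arc_def using monotone_optimal[OF _ _ ab(1) 3 ab(3) g] by simp
          then show ?thesis by blast
        qed
      qed
    qed
  qed
  show ?thesis
  proof (cases "b \<le> a")
    case True
    then show ?thesis using wlog[of b a] assms by auto
  next
    case False
    then obtain g m t1 t2 where "optimal_arc b a g m t1 t2" using wlog[of a b] assms by auto
    then show ?thesis using optimal_arc_rev by blast
  qed
qed

section \<open>Reduction to arclength parametrization\<close>

lemma deriv_on_eqI: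
  assumes "a < b" "t \<in> {a..b}" "(f has_vector_derivative d) (at t within {a..b})"
  shows "deriv_on a b f t = d"
  using vector_derivative_within_cbox[of a b t f d] assms by (simp add: deriv_on_def)

lemma has_vector_derivative_within_cong:
  assumes "\<And>u. u \<in> S \<Longrightarrow> f u = g u" "t \<in> S"
  shows "(f has_vector_derivative d) (at t within S) \<longleftrightarrow> (g has_vector_derivative d) (at t within S)"
  using assms has_vector_derivative_transform[of t S f g d] has_vector_derivative_transform[of t S g f d] by auto

lemma deriv_on_cong:
  assumes "\<And>u. u \<in> {a..b} \<Longrightarrow> f u = g u" "t \<in> {a..b}"
  shows "deriv_on a b f t = deriv_on a b g t"
  unfolding deriv_on_def vector_derivative_def
  using has_vector_derivative_within_cong[OF assms] by simp

lemma is_curve_has_vector_derivative: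
  assumes "is_curve (a, b, f)" "t \<in> {a..b}"
  shows "(f has_vector_derivative deriv_on a b f t) (at t within {a..b})"
  using assms vector_derivative_works[of f "at t within {a..b}"]
  by (auto simp: differentiable_on_def deriv_on_def)

text \<open>The speed is continuous and nowhere zero, so it has a positive lower bound
  \<open>m\<close>. The arclength function then grows at least at rate \<open>m\<close>, which makes
  its inverse \<open>\<tau>\<close> strictly increasing and Lipschitz with constant
  \<open>1 / m\<close>.\<close>

lemma arclength_param_obtain:
  assumes "is_curve (a, b, f)"
  obtains L \<tau> F where "arclength_param (a, b, f) = (0, L, F)" "0 < L" "arclength (a, b, f) = L" "F \<in> extensional {0..L}"
    "\<tau> 0 = a" "\<tau> L = b" "\<And>s. s \<in> {0..L} \<Longrightarrow> \<tau> s \<in> {a..b}"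
    "\<And>x y. x \<in> {0..L} \<Longrightarrow> y \<in> {0..L} \<Longrightarrow> x < y \<Longrightarrow> \<tau> x < \<tau> y"
    "\<And>t. t \<in> {a..b} \<Longrightarrow> \<exists>s\<in>{0..L}. \<tau> s = t"
    "\<exists>C>0. \<forall>x\<in>{0..L}. \<forall>y\<in>{0..L}. \<bar>\<tau> x - \<tau> y\<bar> \<le> C * \<bar>x - y\<bar>"
    "\<And>s. s \<in> {0..L} \<Longrightarrow> F s = f (\<tau> s)"
    "\<And>s. s \<in> {0..L} \<Longrightarrow> (\<tau> has_real_derivative 1 / norm (deriv_on a b f (\<tau> s))) (at s within {0..L})"
    "\<And>s. s \<in> {0..L} \<Longrightarrow>
       (F has_vector_derivative deriv_on a b f (\<tau> s) / of_real (norm (deriv_on a b f (\<tau> s)))) (at s within {0..L})"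
proof -
  define v where "v t = norm (deriv_on a b f t)" for t
  define \<sigma> where "\<sigma> = arclength_fun (a, b, f)"
  have ab: "a < b" and ac: "absolutely_continuous_on {a..b} (deriv_on a b f)"
    and nz: "\<And>t. t \<in> {a..b} \<Longrightarrow> deriv_on a b f t \<noteq> 0" using assms by auto
  have v: "continuous_on {a..b} v"
    unfolding v_def by (intro continuous_on_norm absolutely_continuous_on_imp_continuous_on ac)
  have \<sigma>_eq: "\<sigma> t = integral {a..t} v" for t by (simp add: \<sigma>_def v_def[abs_def])
  obtain x0 where x0: "x0 \<in> {a..b}" "\<And>x. x \<in> {a..b} \<Longrightarrow> v x0 \<le> v x"
    using continuous_attains_inf[of "{a..b}" v] v ab by auto
  define m where "m = v x0"
  have m: "m > 0" "\<And>t. t \<in> {a..b} \<Longrightarrow> m \<le> v t" using nz x0 by (auto simp: m_def v_def)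
  have d\<sigma>: "(\<sigma> has_real_derivative v t) (at t within {a..b})" if "t \<in> {a..b}" for t
    using integral_has_real_derivative[OF v that] by (simp add: \<sigma>_eq[abs_def])
  have cont: "continuous_on {a..b} \<sigma>" using d\<sigma> by (rule DERIV_continuous_on)
  have grow: "m * (y - x) \<le> \<sigma> y - \<sigma> x" if "a \<le> x" "x \<le> y" "y \<le> b" for x y
  proof -
    have "\<sigma> x - m * x \<le> \<sigma> y - m * y"
    proof (rule DERIV_nonneg_imp_increasing_open[OF \<open>x \<le> y\<close>])
      fix t assume t: "x < t" "t < y"
      then have "t \<in> {a..b}" "at t within {a..b} = at t" using that by (auto intro!: at_within_interior)
      then have "((\<lambda>t. \<sigma> t - m * t) has_real_derivative v t - m * 1) (at t)"
        using d\<sigma>[of t] by (intro DERIV_diff DERIV_cmult DERIV_ident) auto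
      then show "\<exists>d. ((\<lambda>t. \<sigma> t - m * t) has_real_derivative d) (at t) \<and> 0 \<le> d"
        using m(2)[OF \<open>t \<in> {a..b}\<close>] by auto
    qed (use that in \<open>auto intro!: continuous_intros continuous_on_subset[OF cont]\<close>)
    then show ?thesis by (simp add: algebra_simps)
  qed
  have strict: "\<sigma> x < \<sigma> y" if "a \<le> x" "x < y" "y \<le> b" for x y
  proof -
    have "0 < m * (y - x)" using that m(1) by (intro mult_pos_pos) auto
    then show ?thesis using grow[of x y] that by linarith
  qed
  have inj: "inj_on \<sigma> {a..b}"
    by (rule linorder_inj_onI) (use strict in \<open>force+\<close>)
  define L where "L = \<sigma> b"
  have "\<sigma> a = 0" by (simp add: \<sigma>_eq)
  then have "0 < L" using strict[of a b] ab by (simp add: L_def)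
  have surj: "\<exists>t\<in>{a..b}. \<sigma> t = s" if "s \<in> {0..L}" for s
    using IVT'[of \<sigma> a s b] that cont ab \<open>\<sigma> a = 0\<close> by (auto simp: L_def)
  have into: "\<sigma> t \<in> {0..L}" if "t \<in> {a..b}" for t
    using strict[of a t] strict[of t b] that \<open>\<sigma> a = 0\<close> by (cases "t = a"; cases "t = b") (auto simp: L_def)
  define \<tau> where "\<tau> = inv_into {a..b} \<sigma>"
  have \<tau>: "\<tau> s \<in> {a..b}" "\<sigma> (\<tau> s) = s" if "s \<in> {0..L}" for s
  proof -
    have "s \<in> \<sigma> ` {a..b}" using surj[OF that] by auto
    then show "\<tau> s \<in> {a..b}" "\<sigma> (\<tau> s) = s"
      unfolding \<tau>_def by (auto intro: inv_into_into f_inv_into_f simp del: atLeastAtMost_iff)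
  qed
  have \<tau>\<sigma>: "\<tau> (\<sigma> t) = t" if "t \<in> {a..b}" for t
    unfolding \<tau>_def using inj that by simp
  have \<tau>_mono: "\<tau> x < \<tau> y" if "x \<in> {0..L}" "y \<in> {0..L}" "x < y" for x y
  proof (rule ccontr)
    assume "\<not> \<tau> x < \<tau> y"
    then have "\<sigma> (\<tau> y) \<le> \<sigma> (\<tau> x)"
      using strict[of "\<tau> y" "\<tau> x"] \<tau>(1)[OF that(1)] \<tau>(1)[OF that(2)] by (cases "\<tau> x = \<tau> y") auto
    then show False using \<tau>(2) that by simp
  qed
  have lip: "\<bar>\<tau> x - \<tau> y\<bar> \<le> 1 / m * \<bar>x - y\<bar>" if "x \<in> {0..L}" "y \<in> {0..L}" for x y
  proof -
    have *: "\<bar>\<tau> x - \<tau> y\<bar> \<le> 1 / m * \<bar>x - y\<bar>" if "x \<in> {0..L}" "y \<in> {0..L}" "x < y" for x y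
      using grow[of "\<tau> x" "\<tau> y"] \<tau>_mono[OF that] \<tau>[OF that(1)] \<tau>[OF that(2)] m(1) that(3)
      by (simp add: field_simps)
    show ?thesis using *[of x y] *[of y x] that by (cases x y rule: linorder_cases) (auto simp: abs_minus_commute)
  qed
  have cont\<tau>: "continuous_on {0..L} \<tau>"
    unfolding continuous_on_iff
  proof (intro ballI allI impI)
    fix x e :: real assume "x \<in> {0..L}" "0 < e"
    show "\<exists>d>0. \<forall>x'\<in>{0..L}. dist x' x < d \<longrightarrow> dist (\<tau> x') (\<tau> x) < e"
    proof (intro exI[of _ "e * m"] conjI ballI impI)
      fix y assume y: "y \<in> {0..L}" "dist y x < e * m"
      have "\<bar>\<tau> y - \<tau> x\<bar> \<le> 1 / m * \<bar>y - x\<bar>" by (rule lip) fact+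
      also have "\<dots> < e" using y(2) m(1) by (simp add: dist_real_def field_simps)
      finally show "dist (\<tau> y) (\<tau> x) < e" by (simp add: dist_real_def)
    qed (use \<open>0 < e\<close> m(1) in auto)
  qed
  \<comment> \<open>Difference quotients of \<open>\<sigma>\<close> at \<open>\<tau> s\<close> are
    inverted within the closed intervals, so the one-sided derivatives at the ends need no separate
    treatment.\<close>
  have d\<tau>: "(\<tau> has_real_derivative 1 / v (\<tau> s)) (at s within {0..L})" if s: "s \<in> {0..L}" for s
  proof -
    have "filterlim \<tau> (at (\<tau> s) within {a..b}) (at s within {0..L})"
      unfolding filterlim_at
    proof
      have ne: "\<tau> y \<noteq> \<tau> s" if "y \<in> {0..L}" "y \<noteq> s" for y
        using \<tau>(2)[OF that(1)] \<tau>(2)[OF s] that(2) by metis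
      show "\<forall>\<^sub>F x in at s within {0..L}. \<tau> x \<in> {a..b} \<and> \<tau> x \<noteq> \<tau> s"
        unfolding eventually_at_filter by (rule always_eventually) (use \<tau>(1) ne in blast)
      show "(\<tau> \<longlongrightarrow> \<tau> s) (at s within {0..L})"
        using cont\<tau> s by (simp add: continuous_on_def)
    qed
    moreover have "((\<lambda>t. (\<sigma> t - \<sigma> (\<tau> s)) / (t - \<tau> s)) \<longlongrightarrow> v (\<tau> s)) (at (\<tau> s) within {a..b})"
      using d\<sigma>[OF \<tau>(1)[OF s]] by (simp add: has_field_derivative_iff)
    ultimately have "((\<lambda>y. (\<sigma> (\<tau> y) - \<sigma> (\<tau> s)) / (\<tau> y - \<tau> s)) \<longlongrightarrow> v (\<tau> s)) (at s within {0..L})"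
      by (rule filterlim_compose[rotated])
    then have "((\<lambda>y. inverse ((\<sigma> (\<tau> y) - \<sigma> (\<tau> s)) / (\<tau> y - \<tau> s))) \<longlongrightarrow> inverse (v (\<tau> s))) (at s within {0..L})"
      using m(1) m(2)[OF \<tau>(1)[OF s]] by (intro tendsto_inverse) auto
    moreover have "\<forall>\<^sub>F y in at s within {0..L}. inverse ((\<sigma> (\<tau> y) - \<sigma> (\<tau> s)) / (\<tau> y - \<tau> s)) = (\<tau> y - \<tau> s) / (y - s)"
      unfolding eventually_at_filter
      by (rule always_eventually) (use \<tau>(2) s in \<open>auto simp del: atLeastAtMost_iff\<close>)
    ultimately show ?thesis
      unfolding has_field_derivative_iff by (auto simp: divide_inverse elim!: Lim_transform_eventually)
  qed
  define F where "F = restrict (\<lambda>s. f (\<tau> s)) {0..L}"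
  have dF: "(F has_vector_derivative deriv_on a b f (\<tau> s) / of_real (norm (deriv_on a b f (\<tau> s)))) (at s within {0..L})"
    if s: "s \<in> {0..L}" for s
  proof -
    have "\<tau> ` {0..L} \<subseteq> {a..b}" using \<tau>(1) by blast
    then have "(f has_vector_derivative deriv_on a b f (\<tau> s)) (at (\<tau> s) within \<tau> ` {0..L})"
      using has_vector_derivative_within_subset[OF is_curve_has_vector_derivative[OF assms \<tau>(1)[OF s]]] by blast
    then have "((f \<circ> \<tau>) has_vector_derivative (1 / v (\<tau> s)) *\<^sub>R deriv_on a b f (\<tau> s)) (at s within {0..L})"
      using d\<tau>[OF s] by (intro vector_diff_chain_within) (simp add: has_real_derivative_iff_has_vector_derivative)
    moreover have "(1 / v (\<tau> s)) *\<^sub>R deriv_on a b f (\<tau> s) = deriv_on a b f (\<tau> s) / of_real (norm (deriv_on a b f (\<tau> s)))"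
      by (simp add: v_def scaleR_conv_of_real)
    ultimately show ?thesis
      using has_vector_derivative_within_cong[of "{0..L}" F "f \<circ> \<tau>" s] s by (simp add: F_def)
  qed
  show thesis
  proof (rule that[of L F \<tau>])
    show "arclength_param (a, b, f) = (0, L, F)"
      by (simp add: L_def F_def \<tau>_def \<sigma>_def[symmetric] del: arclength_fun.simps)
    show "arclength (a, b, f) = L" by (simp add: L_def \<sigma>_def)
    show "\<tau> 0 = a" using \<tau>\<sigma>[of a] \<open>\<sigma> a = 0\<close> ab by simp
    show "\<tau> L = b" using \<tau>\<sigma>[of b] ab by (simp add: L_def)
    show "\<exists>s\<in>{0..L}. \<tau> s = t" if "t \<in> {a..b}" for t using \<tau>\<sigma>[OF that] into[OF that] by blast
    show "\<exists>C>0. \<forall>x\<in>{0..L}. \<forall>y\<in>{0..L}. \<bar>\<tau> x - \<tau> y\<bar> \<le> C * \<bar>x - y\<bar>"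
      using lip m(1) by (intro exI[of _ "1 / m"]) auto
  qed (use \<open>0 < L\<close> \<tau> \<tau>_mono d\<tau> dF in \<open>auto simp: F_def v_def\<close>)
qed

text \<open>Lets facts about \<open>arclength_param c\<close> be read as facts about a unit-speed
  curve \<open>c\<close> itself; in particular equivalence of such curves is equality.\<close>

lemma arclength_param_idem:
  assumes "is_curve c" "arclength_parametrized c"
  shows "arclength_param c = c"
proof -
  obtain b f where c: "c = (0, b, f)" using assms by (cases c) auto
  have b: "0 < b" "f \<in> extensional {0..b}" using assms c by auto
  have \<sigma>: "arclength_fun c t = t" if "t \<in> {0..b}" for t
  proof -
    have "arclength_fun c t = integral {0..t} (\<lambda>_. 1)"
      unfolding c arclength_fun.simps using assms(2) that by (intro integral_cong) (auto simp: c)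
    then show ?thesis using that by simp
  qed
  have inj: "inj_on (arclength_fun c) {0..b}" using \<sigma> by (auto simp: inj_on_def simp del: atLeastAtMost_iff)
  have inv: "inv_into {0..b} (arclength_fun c) s = s" if "s \<in> {0..b}" for s
    using inv_into_f_f[OF inj that] \<sigma>[OF that] by simp
  have "arclength c = b" using \<sigma>[of b] b by (simp add: c)
  then have "arclength_param c = (0, b, restrict (\<lambda>s. f (inv_into {0..b} (arclength_fun c) s)) {0..b})"
    by (simp add: c)
  also have "restrict (\<lambda>s. f (inv_into {0..b} (arclength_fun c) s)) {0..b} = restrict f {0..b}"
    using inv by (auto simp: restrict_def fun_eq_iff simp del: atLeastAtMost_iff)
  also have "restrict f {0..b} = f" using b(2) by (rule extensional_restrict)
  also note c[symmetric]
  finally show ?thesis .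
qed

lemma S_curves_angle_obtain:
  assumes S: "(a, b, f) \<in> S_curves \<alpha> \<beta>"
  obtains \<theta> c where "continuous_on {a..b} \<theta>" "\<And>t. t \<in> {a..b} \<Longrightarrow> deriv_on a b f t = of_real (norm (deriv_on a b f t)) * cis (\<theta> t)"
    "\<theta> a = \<alpha>" "cis (\<theta> b) = cis \<beta>" "c \<in> {a..b}"
    "mono_on {a..c} \<theta> \<and> antimono_on {c..b} \<theta> \<or> antimono_on {a..c} \<theta> \<and> mono_on {c..b} \<theta>"
    "\<bar>\<theta> c - \<theta> a\<bar> \<le> pi" "\<bar>\<theta> b - \<theta> c\<bar> \<le> pi"
proof -
  have curve: "is_curve (a, b, f)" and s: "is_s_curve (a, b, f)" using S by (auto simp: S_curves_def)
  have ab: "a < b" and nz: "\<And>t. t \<in> {a..b} \<Longrightarrow> deriv_on a b f t \<noteq> 0" using curve by auto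
  obtain \<theta>0 c where \<theta>0: "continuous_on {a..b} \<theta>0"
    "\<And>t. t \<in> {a..b} \<Longrightarrow> deriv_on a b f t = of_real (norm (deriv_on a b f t)) * cis (\<theta>0 t)"
    and c: "c \<in> {a..b}" "mono_on {a..c} \<theta>0 \<and> antimono_on {c..b} \<theta>0 \<or> antimono_on {a..c} \<theta>0 \<and> mono_on {c..b} \<theta>0"
      "\<bar>\<theta>0 c - \<theta>0 a\<bar> \<le> pi" "\<bar>\<theta>0 b - \<theta>0 c\<bar> \<le> pi"
    using s by auto
  have cis: "deriv_on a b f t / of_real (norm (deriv_on a b f t)) = cis (\<theta>0 t)" if "t \<in> {a..b}" for t
    using \<theta>0(2)[OF that] nz[OF that] by (metis nonzero_mult_div_cancel_left norm_eq_zero of_real_eq_0_iff)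
  have "cis (\<theta>0 a) = cis \<alpha>" "cis (\<theta>0 b) = cis \<beta>"
    using S cis[of a] cis[of b] ab by (auto simp: S_curves_def)
  from \<open>cis (\<theta>0 a) = cis \<alpha>\<close> have "sin (\<theta>0 a) = sin \<alpha> \<and> cos (\<theta>0 a) = cos \<alpha>" by (metis cis.sel)
  then obtain n :: int where n: "\<theta>0 a = \<alpha> + 2 * pi * of_int n"
    using sin_cos_eq_iff[of "\<theta>0 a" \<alpha>] by (auto simp: algebra_simps)
  \<comment> \<open>A continuous tangent angle is fixed only up to a multiple of
    \<open>2 \<pi>\<close>. The shift makes its initial value \<open>\<alpha>\<close> itself rather
    than an angle congruent to it.\<close>
  define \<theta> where "\<theta> t = \<theta>0 t - 2 * pi * of_int n" for t
  have per: "cis (\<theta> t) = cis (\<theta>0 t)" for t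
  proof -
    have "cis (\<theta> t) = cis (\<theta>0 t) / cis (2 * pi * of_int n)" unfolding \<theta>_def by (rule cis_divide[symmetric])
    also have "cis (2 * pi * of_int n) = 1" by (simp add: complex_eq_iff cos_int_2pin sin_int_2pin)
    finally show ?thesis by simp
  qed
  show thesis
  proof
    show "continuous_on {a..b} \<theta>" unfolding \<theta>_def by (intro continuous_intros \<theta>0)
    show "\<theta> a = \<alpha>" by (simp add: \<theta>_def n)
    show "cis (\<theta> b) = cis \<beta>" using \<open>cis (\<theta>0 b) = cis \<beta>\<close> per by simp
    show "mono_on {a..c} \<theta> \<and> antimono_on {c..b} \<theta> \<or> antimono_on {a..c} \<theta> \<and> mono_on {c..b} \<theta>"
      using c(2) by (auto simp: \<theta>_def monotone_on_def)
    show "c \<in> {a..b}" by fact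
    fix t assume "t \<in> {a..b}"
    then show "deriv_on a b f t = of_real (norm (deriv_on a b f t)) * cis (\<theta> t)"
      unfolding per by (rule \<theta>0(2))
  qed (use c in \<open>auto simp: \<theta>_def\<close>)
qed

text \<open>The two parts turn in opposite directions, so the total turn is at most
  \<open>\<pi>\<close>. Any other representative of \<open>\<beta>\<close> would then require a turn
  from \<open>\<pi>/2\<close> to \<open>3 \<pi>/2\<close> or from \<open>- \<pi>/2\<close> to
  \<open>- 3 \<pi>/2\<close>. Along such a turn the cosine is nonpositive, which contradicts the
  chord.\<close>

lemma end_angle_unique:
  fixes \<theta> :: "real \<Rightarrow> real"
  assumes "0 < L" and \<alpha>\<beta>: "- pi/2 \<le> \<alpha>" "\<alpha> \<le> pi/2" "- pi/2 \<le> \<beta>" "\<beta> \<le> pi/2"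
    and \<theta>: "\<theta> 0 = \<alpha>" "cis (\<theta> L) = cis \<beta>" and c: "c \<in> {0..L}"
    "mono_on {0..c} \<theta> \<and> antimono_on {c..L} \<theta> \<or> antimono_on {0..c} \<theta> \<and> mono_on {c..L} \<theta>"
    "\<bar>\<theta> c - \<theta> 0\<bar> \<le> pi" "\<bar>\<theta> L - \<theta> c\<bar> \<le> pi"
    and chord: "((\<lambda>s. cos (\<theta> s)) has_integral 1) {0..L}"
  shows "\<theta> L = \<beta>"
proof (rule ccontr)
  assume ne: "\<theta> L \<noteq> \<beta>"
  have "sin (\<theta> L) = sin \<beta> \<and> cos (\<theta> L) = cos \<beta>" using \<theta>(2) by (metis cis.sel)
  then obtain k :: int where k: "\<theta> L = \<beta> + 2 * pi * of_int k"
    using sin_cos_eq_iff[of "\<theta> L" \<beta>] by (auto simp: algebra_simps)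
  have up: "\<theta> s \<le> \<theta> c \<and> (s \<le> c \<longrightarrow> \<theta> 0 \<le> \<theta> s) \<and> (c \<le> s \<longrightarrow> \<theta> L \<le> \<theta> s)"
    if "mono_on {0..c} \<theta> \<and> antimono_on {c..L} \<theta>" "s \<in> {0..L}" for s
  proof -
    have "mono_on {0..c} \<theta>" "antimono_on {c..L} \<theta>" using that by auto
    from monotone_onD[OF this(1), of 0 s] monotone_onD[OF this(1), of s c]
      monotone_onD[OF this(2), of s L] monotone_onD[OF this(2), of c s]
    show ?thesis using that(2) c(1) by (cases "s \<le> c") auto
  qed
  have down: "\<theta> c \<le> \<theta> s \<and> (s \<le> c \<longrightarrow> \<theta> s \<le> \<theta> 0) \<and> (c \<le> s \<longrightarrow> \<theta> s \<le> \<theta> L)"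
    if "antimono_on {0..c} \<theta> \<and> mono_on {c..L} \<theta>" "s \<in> {0..L}" for s
  proof -
    have "antimono_on {0..c} \<theta>" "mono_on {c..L} \<theta>" using that by auto
    from monotone_onD[OF this(1), of 0 s] monotone_onD[OF this(1), of s c]
      monotone_onD[OF this(2), of s L] monotone_onD[OF this(2), of c s]
    show ?thesis using that(2) c(1) by (cases "s \<le> c") auto
  qed
  have 0: "0 \<in> {0..L}" and LL: "L \<in> {0..L}" using \<open>0 < L\<close> by auto
  have total: "\<bar>\<theta> L - \<theta> 0\<bar> \<le> pi"
    using c(2) up[OF _ 0] up[OF _ LL] down[OF _ 0] down[OF _ LL] c(3,4) by linarith
  have "k \<noteq> 0" using ne k by auto
  then consider "k \<ge> 1" | "k \<le> - 1" by linarith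
  then have "\<theta> 0 = - pi/2 \<and> \<theta> L = - pi/2 - pi \<or> \<theta> 0 = pi/2 \<and> \<theta> L = pi/2 + pi"
  proof cases
    case 1
    then have "2 * pi * 1 \<le> 2 * pi * of_int k" by (intro mult_left_mono) auto
    then show ?thesis using k total \<theta>(1) \<alpha>\<beta> by linarith
  next
    case 2
    then have "2 * pi * of_int k \<le> 2 * pi * of_int (- 1)" by (intro mult_left_mono) auto
    then have "2 * pi * of_int k \<le> - (2 * pi)" by simp
    then show ?thesis using k total \<theta>(1) \<alpha>\<beta> by linarith
  qed
  then have neg: "cos (\<theta> s) \<le> 0" if s: "s \<in> {0..L}" for s
  proof
    assume A: "\<theta> 0 = - pi/2 \<and> \<theta> L = - pi/2 - pi"
    have "- pi/2 - pi \<le> \<theta> s \<and> \<theta> s \<le> - pi/2"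
      using c(2) up[OF _ s] up[OF _ 0] up[OF _ LL] down[OF _ s] down[OF _ LL] down[OF _ 0] c(3,4) A pi_gt_zero by (smt (verit))
    then have "0 \<le> sin (- pi/2 - \<theta> s)" by (intro sin_ge_zero) auto
    then show ?thesis by (simp add: sin_diff)
  next
    assume A: "\<theta> 0 = pi/2 \<and> \<theta> L = pi/2 + pi"
    have "pi/2 \<le> \<theta> s \<and> \<theta> s \<le> pi/2 + pi"
      using c(2) up[OF _ s] up[OF _ 0] up[OF _ LL] down[OF _ s] down[OF _ LL] down[OF _ 0] c(3,4) A pi_gt_zero by (smt (verit))
    then have "0 \<le> sin (\<theta> s - pi/2)" by (intro sin_ge_zero) auto
    then show ?thesis by (simp add: sin_diff)
  qed
  have "0 \<le> - (1::real)"
    by (rule has_integral_nonneg[OF has_integral_neg[OF chord]]) (use neg in auto)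
  then show False by simp
qed

section \<open>Signed curvature and bending energy in terms of the tangent angle\<close>

lemma cis_has_vector_derivative:
  assumes "(\<theta> has_real_derivative y) (at x within S)"
  shows "((\<lambda>s. cis (\<theta> s)) has_vector_derivative of_real y * (\<i> * cis (\<theta> x))) (at x within S)"
  unfolding has_vector_derivative_complex_iff
  using DERIV_chain2[OF DERIV_cos assms] DERIV_chain2[OF DERIV_sin assms] by (simp add: mult.commute)

lemma norm_cis_diff_le: "norm (cis x - cis y) \<le> 2 * \<bar>x - y\<bar>"
proof -
  have s: "2 * \<bar>sin ((x - y) / 2)\<bar> \<le> \<bar>x - y\<bar>" using abs_sin_x_le_abs_x[of "(x - y) / 2"] by simp
  have "\<bar>sin x - sin y\<bar> = 2 * \<bar>sin ((x - y) / 2)\<bar> * \<bar>cos ((x + y) / 2)\<bar>"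
    by (simp add: sin_diff_sin abs_mult)
  also have "\<dots> \<le> 2 * \<bar>sin ((x - y) / 2)\<bar> * 1" by (intro mult_left_mono) auto
  finally have 1: "\<bar>sin x - sin y\<bar> \<le> \<bar>x - y\<bar>" using s by simp
  have "\<bar>cos x - cos y\<bar> = 2 * \<bar>sin ((x - y) / 2)\<bar> * \<bar>sin ((x + y) / 2)\<bar>"
    using sin_minus[of "(x - y) / 2"] by (simp add: cos_diff_cos abs_mult abs_minus_commute minus_divide_left)
  also have "\<dots> \<le> 2 * \<bar>sin ((x - y) / 2)\<bar> * 1" by (intro mult_left_mono) auto
  finally have 2: "\<bar>cos x - cos y\<bar> \<le> \<bar>x - y\<bar>" using s by simp
  show ?thesis using cmod_le[of "cis x - cis y"] 1 2 by simp
qed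

lemma deriv_on_cis:
  assumes "0 < L" "\<And>s. s \<in> {0..L} \<Longrightarrow> (F has_vector_derivative cis (\<theta> s)) (at s within {0..L})"
    and s: "s \<in> {0..L}"
  shows "deriv_on 0 L F s = cis (\<theta> s)"
    and "(\<theta> has_real_derivative y) (at s within {0..L}) \<Longrightarrow> deriv_on 0 L (deriv_on 0 L F) s = of_real y * (\<i> * cis (\<theta> s))"
proof -
  have *: "deriv_on 0 L F s = cis (\<theta> s)" if "s \<in> {0..L}" for s
    by (rule deriv_on_eqI[OF assms(1) that assms(2)[OF that]])
  then show "deriv_on 0 L F s = cis (\<theta> s)" using s by simp
  assume "(\<theta> has_real_derivative y) (at s within {0..L})"
  from cis_has_vector_derivative[OF this]
  have "deriv_on 0 L (\<lambda>s. cis (\<theta> s)) s = of_real y * (\<i> * cis (\<theta> s))"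
    by (rule deriv_on_eqI[OF assms(1) s])
  then show "deriv_on 0 L (deriv_on 0 L F) s = of_real y * (\<i> * cis (\<theta> s))"
    using deriv_on_cong[of 0 L "deriv_on 0 L F" "\<lambda>s. cis (\<theta> s)", OF * s] by simp
qed

lemma curvature_eq:
  assumes "arclength_param c = (0, L, F)" "0 < L"
    and "\<And>s. s \<in> {0..L} \<Longrightarrow> (F has_vector_derivative cis (\<theta> s)) (at s within {0..L})"
    and "s \<in> {0..L}" "(\<theta> has_real_derivative y) (at s within {0..L})"
  shows "curvature c s = y"
proof -
  have "curvature c s = Im (cnj (cis (\<theta> s)) * (of_real y * (\<i> * cis (\<theta> s))))"
    using deriv_on_cis[OF assms(2-4)] assms(5) by (simp add: curvature_def assms(1))
  also have "cnj (cis (\<theta> s)) * (of_real y * (\<i> * cis (\<theta> s))) = of_real y * \<i> * (cis (- \<theta> s) * cis (\<theta> s))"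
    by (simp add: cis_cnj)
  finally show ?thesis by (simp add: cis_mult)
qed

text \<open>Cutting at the turning point leaves monotone pieces, for which the chain rule is
  known.\<close>

lemma chain_integral_piecewise:
  fixes \<theta> :: "real \<Rightarrow> real"
  assumes ac: "absolutely_continuous_on {0..L} \<theta>" and c: "c \<in> {0..L}"
    and mono: "mono_on {0..c} \<theta> \<and> antimono_on {c..L} \<theta> \<or> antimono_on {0..c} \<theta> \<and> mono_on {c..L} \<theta>"
    and h: "\<And>x y. 0 < x \<Longrightarrow> x < L \<Longrightarrow> (\<theta> has_real_derivative y) (at x) \<Longrightarrow> h x = y"
    and P: "\<And>x. (P has_real_derivative w x) (at x)" and w: "continuous_on UNIV w" "\<And>x. 0 \<le> w x"
    and st: "0 \<le> s" "s \<le> t" "t \<le> L"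
  shows "((\<lambda>u. w (\<theta> u) * h u) has_integral P (\<theta> t) - P (\<theta> s)) {s..t}"
proof -
  have piece: "((\<lambda>u. w (\<theta> u) * h u) has_integral P (\<theta> y) - P (\<theta> x)) {x..y}"
    if xy: "0 \<le> x" "x \<le> y" "y \<le> L" and m: "mono_on {x..y} \<theta> \<or> antimono_on {x..y} \<theta>" for x y
  proof -
    have ac': "absolutely_continuous_on {x..y} \<theta>"
      using xy by (intro absolutely_continuous_on_subset[OF ac]) auto
    have h': "h u = d" if "x < u" "u < y" "(\<theta> has_real_derivative d) (at u)" for u d
      using h[of u d] that xy by auto
    from m show ?thesis
    proof
      assume "mono_on {x..y} \<theta>"
      from absolutely_continuous_mono_chain[OF xy(2) ac' this P w h'] show ?thesis .
    next
      assume "antimono_on {x..y} \<theta>"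
      from absolutely_continuous_antimono_chain[OF xy(2) ac' this P w h'] show ?thesis .
    qed
  qed
  have m1: "mono_on {x..y} \<theta> \<or> antimono_on {x..y} \<theta>" if "0 \<le> x" "y \<le> c" for x y
    using mono that monotone_on_subset[of "{0..c}" _ _ \<theta> "{x..y}"] by auto
  have m2: "mono_on {x..y} \<theta> \<or> antimono_on {x..y} \<theta>" if "c \<le> x" "y \<le> L" for x y
    using mono that monotone_on_subset[of "{c..L}" _ _ \<theta> "{x..y}"] by auto
  consider "t \<le> c" | "c \<le> s" | "s < c" "c < t" by linarith
  then show ?thesis
  proof cases
    case 1 then show ?thesis using piece m1 st by auto
  next
    case 2 then show ?thesis using piece m2 st by auto
  next
    case 3
    have "((\<lambda>u. w (\<theta> u) * h u) has_integral (P (\<theta> c) - P (\<theta> s)) + (P (\<theta> t) - P (\<theta> c))) {s..t}"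
      using 3 st c m1[of s c] m2[of c t] by (intro has_integral_combine[of s c t] piece) auto
    then show ?thesis by simp
  qed
qed

text \<open>The passage from curves to profiles: an s-curve in any parametrization is replaced by
  the tangent angle of its arclength parametrization, with \<open>curvature\<close> in the role of
  \<open>h\<close>. From here on the energy bounds apply.\<close>

theorem S_curves_profile:
  assumes S: "c \<in> S_curves \<alpha> \<beta>" and \<alpha>\<beta>: "- pi/2 \<le> \<alpha>" "\<alpha> \<le> pi/2" "- pi/2 \<le> \<beta>" "\<beta> \<le> pi/2"
  obtains L F \<theta> where "arclength_param c = (0, L, F)" "0 < L" "arclength c = L" "F \<in> extensional {0..L}" "F 0 = 0" "F L = 1"
    "\<And>s. s \<in> {0..L} \<Longrightarrow> (F has_vector_derivative cis (\<theta> s)) (at s within {0..L})"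
    "absolutely_continuous_on {0..L} \<theta>" "s_profile \<alpha> \<beta> L \<theta> (curvature c)"
proof -
  obtain a b f where c: "c = (a, b, f)" by (cases c)
  have curve: "is_curve (a, b, f)" and f: "f a = 0" "f b = 1" using S by (auto simp: S_curves_def c)
  have ab: "a < b" and ac: "absolutely_continuous_on {a..b} (deriv_on a b f)"
    and nz: "\<And>t. t \<in> {a..b} \<Longrightarrow> deriv_on a b f t \<noteq> 0" using curve by auto
  obtain \<theta>0 d where \<theta>0: "continuous_on {a..b} \<theta>0"
    "\<And>t. t \<in> {a..b} \<Longrightarrow> deriv_on a b f t = of_real (norm (deriv_on a b f t)) * cis (\<theta>0 t)"
    "\<theta>0 a = \<alpha>" "cis (\<theta>0 b) = cis \<beta>" and d: "d \<in> {a..b}"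
    "mono_on {a..d} \<theta>0 \<and> antimono_on {d..b} \<theta>0 \<or> antimono_on {a..d} \<theta>0 \<and> mono_on {d..b} \<theta>0"
    "\<bar>\<theta>0 d - \<theta>0 a\<bar> \<le> pi" "\<bar>\<theta>0 b - \<theta>0 d\<bar> \<le> pi"
    using S_curves_angle_obtain[OF S[unfolded c]] by metis
  show thesis
  proof (rule arclength_param_obtain[OF curve])
    fix L \<tau> F assume F: "arclength_param (a, b, f) = (0, L, F)" "0 < L" "arclength (a, b, f) = L" "F \<in> extensional {0..L}"
      and \<tau>: "\<tau> 0 = a" "\<tau> L = b" "\<And>s. s \<in> {0..L} \<Longrightarrow> \<tau> s \<in> {a..b}"
        "\<And>x y. x \<in> {0..L} \<Longrightarrow> y \<in> {0..L} \<Longrightarrow> x < y \<Longrightarrow> \<tau> x < \<tau> y"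
        "\<And>t. t \<in> {a..b} \<Longrightarrow> \<exists>s\<in>{0..L}. \<tau> s = t"
        "\<exists>C>0. \<forall>x\<in>{0..L}. \<forall>y\<in>{0..L}. \<bar>\<tau> x - \<tau> y\<bar> \<le> C * \<bar>x - y\<bar>"
      and F\<tau>: "\<And>s. s \<in> {0..L} \<Longrightarrow> F s = f (\<tau> s)"
      and d\<tau>: "\<And>s. s \<in> {0..L} \<Longrightarrow> (\<tau> has_real_derivative 1 / norm (deriv_on a b f (\<tau> s))) (at s within {0..L})"
      and dF: "\<And>s. s \<in> {0..L} \<Longrightarrow>
         (F has_vector_derivative deriv_on a b f (\<tau> s) / of_real (norm (deriv_on a b f (\<tau> s)))) (at s within {0..L})"
    define \<theta> where "\<theta> s = \<theta>0 (\<tau> s)" for s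
    have \<tau>_le: "\<tau> x \<le> \<tau> y" if "x \<in> {0..L}" "y \<in> {0..L}" "x \<le> y" for x y
      using \<tau>(4)[OF that(1,2)] that(3) by (cases "x = y") auto
    have dF': "(F has_vector_derivative cis (\<theta> s)) (at s within {0..L})" if "s \<in> {0..L}" for s
    proof -
      have "deriv_on a b f (\<tau> s) / of_real (norm (deriv_on a b f (\<tau> s))) = cis (\<theta> s)"
        unfolding \<theta>_def using \<theta>0(2)[OF \<tau>(3)[OF that]] nz[OF \<tau>(3)[OF that]]
        by (metis nonzero_mult_div_cancel_left norm_eq_zero of_real_eq_0_iff)
      then show ?thesis using dF[OF that] by simp
    qed
    obtain C where C: "C > 0" "\<And>x y. x \<in> {0..L} \<Longrightarrow> y \<in> {0..L} \<Longrightarrow> \<bar>\<tau> x - \<tau> y\<bar> \<le> C * \<bar>x - y\<bar>"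
      using \<tau>(6) by blast
    have "tangent_angle (a, b, f) \<theta>0" using \<theta>0(1,2) by simp
    with ac nz have "absolutely_continuous_on {a..b} \<theta>0" by (rule tangent_angle_absolutely_continuous)
    moreover have "\<tau> ` {0..L} \<subseteq> {a..b}" using \<tau>(3) by blast
    ultimately have ac\<theta>: "absolutely_continuous_on {0..L} \<theta>"
      unfolding \<theta>_def using C(1) \<tau>(4) C(2) by (intro absolutely_continuous_on_compose_mono[where C = C and \<tau> = \<tau>])
    obtain e where e: "e \<in> {0..L}" "\<tau> e = d" using \<tau>(5)[OF d(1)] by blast
    have sub: "\<tau> x \<in> {a..d} \<and> \<tau> y \<in> {a..d} \<and> \<tau> x \<le> \<tau> y" if "x \<in> {0..e}" "y \<in> {0..e}" "x \<le> y" for x y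
      using \<tau>_le[of x e] \<tau>_le[of y e] \<tau>_le[of x y] \<tau>(3)[of x] \<tau>(3)[of y] that e by auto
    have sub': "\<tau> x \<in> {d..b} \<and> \<tau> y \<in> {d..b} \<and> \<tau> x \<le> \<tau> y" if "x \<in> {e..L}" "y \<in> {e..L}" "x \<le> y" for x y
      using \<tau>_le[of e x] \<tau>_le[of e y] \<tau>_le[of x y] \<tau>(3)[of x] \<tau>(3)[of y] that e by auto
    have mono: "mono_on {0..e} \<theta> \<and> antimono_on {e..L} \<theta> \<or> antimono_on {0..e} \<theta> \<and> mono_on {e..L} \<theta>"
    proof -
      have 1: "mono_on {0..e} \<theta>" if "mono_on {a..d} \<theta>0"
        unfolding \<theta>_def by (rule monotone_onI) (use sub monotone_onD[OF that] in blast)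
      have 2: "antimono_on {0..e} \<theta>" if "antimono_on {a..d} \<theta>0"
        unfolding \<theta>_def by (rule monotone_onI) (use sub monotone_onD[OF that] in blast)
      have 3: "mono_on {e..L} \<theta>" if "mono_on {d..b} \<theta>0"
        unfolding \<theta>_def by (rule monotone_onI) (use sub' monotone_onD[OF that] in blast)
      have 4: "antimono_on {e..L} \<theta>" if "antimono_on {d..b} \<theta>0"
        unfolding \<theta>_def by (rule monotone_onI) (use sub' monotone_onD[OF that] in blast)
      show ?thesis using d(2) 1 2 3 4 by blast
    qed
    have F0L: "F 0 = 0" "F L = 1" using F\<tau>[of 0] F\<tau>[of L] \<tau>(1,2) f \<open>0 < L\<close> by auto
    have chord: "((\<lambda>s. cis (\<theta> s)) has_integral 1) {0..L}"
      using fundamental_theorem_of_calculus[of 0 L F "\<lambda>s. cis (\<theta> s)"] dF' F0L \<open>0 < L\<close> by simp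
    have "((\<lambda>s. cos (\<theta> s)) has_integral 1) {0..L}"
      using has_integral_linear[OF chord bounded_linear_Re] by (simp add: o_def)
    moreover have ends: "\<theta> 0 = \<alpha>" "cis (\<theta> L) = cis \<beta>" "\<bar>\<theta> e - \<theta> 0\<bar> \<le> pi" "\<bar>\<theta> L - \<theta> e\<bar> \<le> pi"
      using \<theta>0(3,4) d(3,4) \<tau>(1,2) e by (auto simp: \<theta>_def)
    ultimately have "\<theta> L = \<beta>"
      by (intro end_angle_unique[OF \<open>0 < L\<close> \<alpha>\<beta> _ _ e(1) mono])
    have h: "curvature c x = y" if "0 < x" "x < L" "(\<theta> has_real_derivative y) (at x)" for x y
      using that F(1) by (intro curvature_eq[OF _ \<open>0 < L\<close> dF']) (auto simp: c intro: has_field_derivative_at_within)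
    have "s_profile \<alpha> \<beta> L \<theta> (curvature c)"
      unfolding s_profile_def
    proof (intro conjI allI impI)
      show "\<exists>c\<in>{0..L}. (mono_on {0..c} \<theta> \<and> antimono_on {c..L} \<theta> \<or> antimono_on {0..c} \<theta> \<and> mono_on {c..L} \<theta>) \<and>
          \<bar>\<theta> c - \<alpha>\<bar> \<le> pi \<and> \<bar>\<beta> - \<theta> c\<bar> \<le> pi"
        using e(1) mono ends \<open>\<theta> L = \<beta>\<close> by (intro bexI[of _ e]) auto
      show "continuous_on {0..L} \<theta>" by (rule absolutely_continuous_on_imp_continuous_on[OF ac\<theta>])
      fix P w s t
      assume "\<forall>x. (P has_real_derivative w x) (at x)" "continuous_on UNIV w" "\<forall>x. 0 \<le> w x" "0 \<le> s" "s \<le> t" "t \<le> L"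
      then show "((\<lambda>u. w (\<theta> u) * curvature c u) has_integral P (\<theta> t) - P (\<theta> s)) {s..t}"
        by (intro chain_integral_piecewise[OF ac\<theta> e(1) mono h]) blast+
    qed (use \<open>0 < L\<close> ends \<open>\<theta> L = \<beta>\<close> chord in auto)
    then show thesis
      using that[of L F \<theta>] F F0L dF' ac\<theta> by (simp add: c del: arclength_param.simps arclength.simps)
  qed
qed

lemma bending_energy_eq:
  assumes "arclength c = L" "(\<lambda>u. (curvature c u)\<^sup>2) integrable_on {0..L}"
  shows "bending_energy c = ennreal (integral {0..L} (\<lambda>u. (curvature c u)\<^sup>2) / 4)"
proof -
  have "(\<integral>\<^sup>+u\<in>{0..L}. ennreal ((curvature c u)\<^sup>2) \<partial>lborel) = ennreal (integral {0..L} (\<lambda>u. (curvature c u)\<^sup>2))"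
    using assms(2) by (intro nn_integral_has_integral_lebesgue') auto
  moreover have "0 \<le> integral {0..L} (\<lambda>u. (curvature c u)\<^sup>2)"
    by (rule integral_nonneg) (use assms in auto)
  ultimately show ?thesis
    using divide_ennreal[of "integral {0..L} (\<lambda>u. (curvature c u)\<^sup>2)" 4] by (simp add: bending_energy_def assms(1))
qed

text \<open>A finite upper integral gives integrability only for measurable functions. Measurability
  of the curvature is inherited from its own integrability, its integral being the total
  turn.\<close>

lemma bending_energy_finite_imp_integrable:
  assumes L: "arclength c = L" and prof: "s_profile \<alpha> \<beta> L \<theta> (curvature c)" and fin: "bending_energy c \<noteq> top"
  shows "(\<lambda>u. (curvature c u)\<^sup>2) integrable_on {0..L}"
proof -
  let ?k = "curvature c"
  define K where "K = (\<lambda>u. (indicator {0..L} u *\<^sub>R ?k u)\<^sup>2)"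
  have "0 \<le> L" using prof by (auto simp: s_profile_def)
  then have "(\<lambda>u. indicator {0..L} u *\<^sub>R ?k u) \<in> borel_measurable lebesgue"
    using has_integral_implies_lebesgue_measurable[OF s_profile_angle_integral[OF prof, of 0 L]] by simp
  then have K: "K \<in> borel_measurable lebesgue" unfolding K_def by (rule borel_measurable_power)
  have "(\<integral>\<^sup>+u\<in>{0..L}. ennreal ((?k u)\<^sup>2) \<partial>lborel) \<noteq> top"
    using fin by (auto simp: bending_energy_def L ennreal_top_divide)
  moreover have "(\<integral>\<^sup>+u\<in>{0..L}. ennreal ((?k u)\<^sup>2) \<partial>lborel) = (\<integral>\<^sup>+u. ennreal (K u) \<partial>lebesgue)"
    unfolding nn_integral_completion by (intro nn_integral_cong) (auto simp: K_def indicator_def)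
  ultimately obtain r where "0 \<le> r" "(\<integral>\<^sup>+u. ennreal (K u) \<partial>lebesgue) = ennreal r"
    by (metis ennreal_cases)
  then have "(K has_integral r) UNIV"
    using K by (subst has_integral_iff_nn_integral_lebesgue) (auto simp: K_def)
  then have "((\<lambda>u. if u \<in> {0..L} then (?k u)\<^sup>2 else 0) has_integral r) UNIV"
    by (rule has_integral_eq[rotated]) (auto simp: K_def)
  then show ?thesis by (simp only: has_integral_restrict_UNIV) (rule has_integral_integrable)
qed

text \<open>Allows the candidate minimizer to be built in the natural parameter of the elastica and
  reparametrized afterwards.\<close>

theorem arclength_param_in_S_curves:
  assumes S: "c \<in> S_curves \<alpha> \<beta>" and \<alpha>\<beta>: "- pi/2 \<le> \<alpha>" "\<alpha> \<le> pi/2" "- pi/2 \<le> \<beta>" "\<beta> \<le> pi/2"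
  shows "arclength_param c \<in> S_curves \<alpha> \<beta>" "arclength_parametrized (arclength_param c)"
    "bending_energy (arclength_param c) = bending_energy c"
proof -
  have "arclength_param c \<in> S_curves \<alpha> \<beta> \<and> arclength_parametrized (arclength_param c) \<and>
    bending_energy (arclength_param c) = bending_energy c"
  proof (rule S_curves_profile[OF assms])
    fix L F \<theta> assume F: "arclength_param c = (0, L, F)" "0 < L" "arclength c = L" "F \<in> extensional {0..L}" "F 0 = 0" "F L = 1"
      and dF: "\<And>s. s \<in> {0..L} \<Longrightarrow> (F has_vector_derivative cis (\<theta> s)) (at s within {0..L})"
      and ac: "absolutely_continuous_on {0..L} \<theta>" and prof: "s_profile \<alpha> \<beta> L \<theta> (curvature c)"
    have d: "deriv_on 0 L F s = cis (\<theta> s)" if "s \<in> {0..L}" for s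
      by (rule deriv_on_cis(1)[OF F(2) _ that]) (rule dF)
    have curve: "is_curve (0, L, F)"
      unfolding is_curve.simps
    proof (intro conjI ballI)
      show "F differentiable_on {0..L}"
        unfolding differentiable_on_def using differentiableI_vector[OF dF] by blast
      show "absolutely_continuous_on {0..L} (deriv_on 0 L F)"
        by (rule absolutely_continuous_on_dominated[OF ac, of 1 2]) (use d norm_cis_diff_le in auto)
      show "deriv_on 0 L F t \<noteq> 0" if "t \<in> {0..L}" for t using d[OF that] by simp
    qed (use F in auto)
    have "tangent_angle (0, L, F) \<theta>"
      using absolutely_continuous_on_imp_continuous_on[OF ac] d by simp
    moreover have "\<exists>c\<in>{0..L}. (mono_on {0..c} \<theta> \<and> antimono_on {c..L} \<theta> \<or> antimono_on {0..c} \<theta> \<and> mono_on {c..L} \<theta>) \<and>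
          \<bar>\<theta> c - \<theta> 0\<bar> \<le> pi \<and> \<bar>\<theta> L - \<theta> c\<bar> \<le> pi" "\<theta> 0 = \<alpha>" "\<theta> L = \<beta>"
      using prof by (auto simp: s_profile_def)
    ultimately have 1: "arclength_param c \<in> S_curves \<alpha> \<beta>"
      using curve F d[of 0] d[of L] by (auto simp: S_curves_def simp del: is_curve.simps)
    have ap: "arclength_parametrized (arclength_param c)" using d by (simp add: F)
    have idem: "arclength_param (0, L, F) = (0, L, F)"
      using arclength_param_idem[OF curve] ap by (simp add: F(1) del: arclength_param.simps is_curve.simps)
    then have "arclength (0, L, F) = L" by simp
    moreover have "curvature (0, L, F) = curvature c"
      unfolding curvature_def[abs_def] idem F(1) ..
    ultimately have "bending_energy (arclength_param c) = bending_energy c"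
      unfolding bending_energy_def F(1) F(3) by simp
    with 1 ap show ?thesis by blast
  qed
  then show "arclength_param c \<in> S_curves \<alpha> \<beta>" "arclength_parametrized (arclength_param c)"
    "bending_energy (arclength_param c) = bending_energy c" by blast+
qed

section \<open>Elastic curves and their uniqueness\<close>

lemma C_infinity_derivation:
  assumes "a < b" "F \<in> A"
    and A: "\<And>G. G \<in> A \<Longrightarrow> \<exists>G'\<in>A. \<forall>t\<in>{a..b}. (G has_vector_derivative G' t) (at t within {a..b})"
  shows "C_infinity (a, b, F)"
proof -
  have iter: "\<exists>G\<in>A. \<forall>t\<in>{a..b}. (deriv_on a b ^^ j) F t = G t" for j
  proof (induction j)
    case 0
    then show ?case using \<open>F \<in> A\<close> by auto
  next
    case (Suc j)
    then obtain G where G: "G \<in> A" "\<And>t. t \<in> {a..b} \<Longrightarrow> (deriv_on a b ^^ j) F t = G t" by blast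
    obtain G' where G': "G' \<in> A" "\<And>t. t \<in> {a..b} \<Longrightarrow> (G has_vector_derivative G' t) (at t within {a..b})"
      using A[OF G(1)] by blast
    have "(deriv_on a b ^^ Suc j) F t = G' t" if "t \<in> {a..b}" for t
      using deriv_on_cong[of a b "(deriv_on a b ^^ j) F" G, OF G(2) that] deriv_on_eqI[OF \<open>a < b\<close> that G'(2)[OF that]] by simp
    then show ?case using G'(1) by blast
  qed
  have diff: "(deriv_on a b ^^ j) F differentiable_on {a..b}" for j
  proof -
    obtain G where G: "G \<in> A" "\<And>t. t \<in> {a..b} \<Longrightarrow> (deriv_on a b ^^ j) F t = G t" using iter by blast
    obtain G' where G': "\<And>t. t \<in> {a..b} \<Longrightarrow> (G has_vector_derivative G' t) (at t within {a..b})"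
      using A[OF G(1)] by blast
    have "((deriv_on a b ^^ j) F has_vector_derivative G' t) (at t within {a..b})" if "t \<in> {a..b}" for t
      using has_vector_derivative_within_cong[of "{a..b}" "(deriv_on a b ^^ j) F" G t, OF G(2) that] G'[OF that] by blast
    then show ?thesis unfolding differentiable_on_def using differentiableI_vector by blast
  qed
  then show ?thesis
    unfolding C_infinity_def C_k.simps by (auto intro: differentiable_imp_continuous_on)
qed

text \<open>The algebra generated by the curve, its tangent and its curvature. The elastica equation
  expresses the derivative of \<open>\<kappa>\<close> through \<open>cis \<theta>\<close> and
  \<open>cis (- \<theta>)\<close>, so the algebra is closed under differentiation and all its
  members are smooth at once.\<close>

inductive_set elastica_algebra :: "(real \<Rightarrow> complex) \<Rightarrow> (real \<Rightarrow> real) \<Rightarrow> (real \<Rightarrow> real) \<Rightarrow> (real \<Rightarrow> complex) set"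
  for F \<theta> \<kappa> where
  curve: "F \<in> elastica_algebra F \<theta> \<kappa>"
| const: "(\<lambda>s. z) \<in> elastica_algebra F \<theta> \<kappa>"
| tangent: "(\<lambda>s. cis (\<theta> s)) \<in> elastica_algebra F \<theta> \<kappa>"
| cnj_tangent: "(\<lambda>s. cis (- \<theta> s)) \<in> elastica_algebra F \<theta> \<kappa>"
| curvature: "(\<lambda>s. of_real (\<kappa> s)) \<in> elastica_algebra F \<theta> \<kappa>"
| add: "G \<in> elastica_algebra F \<theta> \<kappa> \<Longrightarrow> H \<in> elastica_algebra F \<theta> \<kappa> \<Longrightarrow> (\<lambda>s. G s + H s) \<in> elastica_algebra F \<theta> \<kappa>"
| mult: "G \<in> elastica_algebra F \<theta> \<kappa> \<Longrightarrow> H \<in> elastica_algebra F \<theta> \<kappa> \<Longrightarrow> (\<lambda>s. G s * H s) \<in> elastica_algebra F \<theta> \<kappa>"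

text \<open>An initial value problem for curve, angle and curvature. The first integral is kept as a
  separate clause because it gives the sign of \<open>sin (g - \<theta>)\<close> and the
  energy.\<close>

definition elastica_solution ::
  "real \<Rightarrow> real \<Rightarrow> real \<Rightarrow> real \<Rightarrow> real \<Rightarrow> (real \<Rightarrow> complex) \<Rightarrow> (real \<Rightarrow> real) \<Rightarrow> (real \<Rightarrow> real) \<Rightarrow> bool" where
  "elastica_solution a g m k0 L F \<theta> \<kappa> \<longleftrightarrow> 0 < L \<and> F \<in> extensional {0..L} \<and> F 0 = 0 \<and> F L = 1 \<and> \<theta> 0 = a \<and> \<kappa> 0 = k0 \<and>
     (\<forall>s\<in>{0..L}. (F has_vector_derivative cis (\<theta> s)) (at s within {0..L}) \<and>
        (\<theta> has_real_derivative \<kappa> s) (at s within {0..L}) \<and>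
        (\<kappa> has_real_derivative - (m\<^sup>2 / 2) * cos (\<theta> s - g)) (at s within {0..L}) \<and>
        (\<kappa> s)\<^sup>2 = m\<^sup>2 * sin (g - \<theta> s))"

lemma elastica_solution_C_infinity:
  assumes "elastica_solution a g m k0 L F \<theta> \<kappa>"
  shows "C_infinity (0, L, F)"
proof (rule C_infinity_derivation[of _ _ _ "elastica_algebra F \<theta> \<kappa>"])
  have dF: "(F has_vector_derivative cis (\<theta> s)) (at s within {0..L})"
    and d\<theta>: "(\<theta> has_real_derivative \<kappa> s) (at s within {0..L})"
    and d\<kappa>: "(\<kappa> has_real_derivative - (m\<^sup>2 / 2) * cos (\<theta> s - g)) (at s within {0..L})" if "s \<in> {0..L}" for s
    using assms that unfolding elastica_solution_def by blast+
  fix G assume "G \<in> elastica_algebra F \<theta> \<kappa>"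
  then show "\<exists>G'\<in>elastica_algebra F \<theta> \<kappa>. \<forall>t\<in>{0..L}. (G has_vector_derivative G' t) (at t within {0..L})"
  proof induction
    case curve
    show ?case by (rule bexI[OF _ elastica_algebra.tangent]) (use dF in blast)
  next
    case (const z)
    show ?case by (rule bexI[OF _ elastica_algebra.const[of 0]]) simp
  next
    case tangent
    show ?case
      by (rule bexI[of _ "\<lambda>s. of_real (\<kappa> s) * (\<i> * cis (\<theta> s))"])
        (use cis_has_vector_derivative[OF d\<theta>] in \<open>auto intro!: elastica_algebra.intros\<close>)
  next
    case cnj_tangent
    have "((\<lambda>s. cis (- \<theta> s)) has_vector_derivative of_real (- \<kappa> s) * (\<i> * cis (- \<theta> s))) (at s within {0..L})"
      if "s \<in> {0..L}" for s
      using cis_has_vector_derivative[of "\<lambda>s. - \<theta> s"] DERIV_minus[OF d\<theta>[OF that]] by blast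
    then show ?case
    proof (intro bexI ballI)
      show "(\<lambda>s. of_real (\<kappa> s) * (- \<i> * cis (- \<theta> s))) \<in> elastica_algebra F \<theta> \<kappa>"
        by (intro elastica_algebra.intros)
    qed auto
  next
    case curvature
    \<comment> \<open>This is \<open>- (m\<^sup>2 / 2) cos (\<theta> - g)\<close>, written in the
      generators of the algebra.\<close>
    let ?G = "\<lambda>s. of_real (- (m\<^sup>2 / 4)) * (cis g * cis (- \<theta> s) + cis (- g) * cis (\<theta> s))"
    have G: "?G s = of_real (- (m\<^sup>2 / 2) * cos (\<theta> s - g))" for s
    proof -
      have "cos (g - \<theta> s) = cos (\<theta> s - g)" "sin (g - \<theta> s) = - sin (\<theta> s - g)"
        by (metis cos_minus minus_diff_eq) (metis sin_minus minus_diff_eq)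
      then show ?thesis by (simp add: cis_mult complex_eq_iff)
    qed
    have "((\<lambda>s. of_real (\<kappa> s)) has_vector_derivative ?G s) (at s within {0..L})" if "s \<in> {0..L}" for s
      unfolding G using d\<kappa>[OF that] by (simp add: has_vector_derivative_complex_iff)
    moreover have "?G \<in> elastica_algebra F \<theta> \<kappa>" by (intro elastica_algebra.intros)
    ultimately show ?case by (intro bexI[of _ ?G] ballI)
  next
    case (add G H)
    then obtain G' H' where G': "G' \<in> elastica_algebra F \<theta> \<kappa>" "\<forall>t\<in>{0..L}. (G has_vector_derivative G' t) (at t within {0..L})"
      and H': "H' \<in> elastica_algebra F \<theta> \<kappa>" "\<forall>t\<in>{0..L}. (H has_vector_derivative H' t) (at t within {0..L})" by blast
    show ?case
    proof (intro bexI ballI)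
      show "(\<lambda>s. G' s + H' s) \<in> elastica_algebra F \<theta> \<kappa>" by (rule elastica_algebra.add[OF G'(1) H'(1)])
      show "((\<lambda>s. G s + H s) has_vector_derivative G' t + H' t) (at t within {0..L})" if "t \<in> {0..L}" for t
        using G'(2) H'(2) that by (intro has_vector_derivative_add) blast+
    qed
  next
    case (mult G H)
    then obtain G' H' where G': "G' \<in> elastica_algebra F \<theta> \<kappa>" "\<forall>t\<in>{0..L}. (G has_vector_derivative G' t) (at t within {0..L})"
      and H': "H' \<in> elastica_algebra F \<theta> \<kappa>" "\<forall>t\<in>{0..L}. (H has_vector_derivative H' t) (at t within {0..L})" by blast
    show ?case
    proof (intro bexI ballI)
      show "(\<lambda>s. G s * H' s + G' s * H s) \<in> elastica_algebra F \<theta> \<kappa>"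
        by (intro elastica_algebra.add elastica_algebra.mult mult.hyps G'(1) H'(1))
      show "((\<lambda>s. G s * H s) has_vector_derivative G t * H' t + G' t * H t) (at t within {0..L})" if "t \<in> {0..L}" for t
        using G'(2) H'(2) that by (intro has_vector_derivative_mult) blast+
    qed
  qed
qed (use assms in \<open>auto simp: elastica_solution_def intro: elastica_algebra.intros\<close>)

section \<open>Arcs of the rectangular elastica as s-curves\<close>

lemma C1_imp_absolutely_continuous_on:
  fixes f :: "real \<Rightarrow> 'a::real_normed_vector"
  assumes f: "\<And>t. t \<in> {a..b} \<Longrightarrow> (f has_vector_derivative f' t) (at t within {a..b})" and f': "continuous_on {a..b} f'"
  shows "absolutely_continuous_on {a..b} f"
proof -
  have "bounded (f' ` {a..b})" by (intro compact_imp_bounded compact_continuous_image f') auto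
  then obtain B where B: "0 < B" "\<And>t. t \<in> {a..b} \<Longrightarrow> norm (f' t) \<le> B" by (auto simp: bounded_pos)
  have "norm (f x - f y) \<le> B * norm (x - y)" if "x \<in> {a..b}" "y \<in> {a..b}" for x y
  proof (rule differentiable_bound[of "{a..b}" f "\<lambda>t h. h *\<^sub>R f' t"])
    fix t assume t: "t \<in> {a..b}"
    show "(f has_derivative (\<lambda>h. h *\<^sub>R f' t)) (at t within {a..b})"
      using f[OF t] by (simp add: has_vector_derivative_def)
    show "onorm (\<lambda>h. h *\<^sub>R f' t) \<le> B"
    proof (rule onorm_bound)
      fix h :: real
      have "\<bar>h\<bar> * norm (f' t) \<le> \<bar>h\<bar> * B" using B(2)[OF t] by (rule mult_left_mono) simp
      then show "norm (h *\<^sub>R f' t) \<le> B * norm h" by (simp add: mult.commute)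
    qed (use B in auto)
  qed (use that in auto)
  then show ?thesis
    by (intro absolutely_continuous_on_dominated[OF absolutely_continuous_on_id, of 1 B]) (use B in auto)
qed

lemma omega_monotone_on:
  shows "(\<And>t. t \<in> {x..y} \<Longrightarrow> 0 \<le> sin t) \<Longrightarrow> mono_on {x..y} omega"
    and "(\<And>t. t \<in> {x..y} \<Longrightarrow> sin t \<le> 0) \<Longrightarrow> antimono_on {x..y} omega"
proof -
  assume s: "\<And>t. t \<in> {x..y} \<Longrightarrow> 0 \<le> sin t"
  show "mono_on {x..y} omega"
  proof (rule monotone_onI)
    fix u v assume uv: "u \<in> {x..y}" "v \<in> {x..y}" "u \<le> v"
    show "omega u \<le> omega v"
    proof (rule DERIV_nonneg_imp_nondecreasing[OF uv(3)])
      fix t assume "u \<le> t" "t \<le> v"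
      then have "0 \<le> 2 * sin t / sqrt (1 + (sin t)\<^sup>2)" using s[of t] uv sqrt_1_plus_sin_pos(1)[of t] by simp
      then show "\<exists>y. (omega has_real_derivative y) (at t) \<and> 0 \<le> y" using omega_has_derivative by blast
    qed
  qed
next
  assume s: "\<And>t. t \<in> {x..y} \<Longrightarrow> sin t \<le> 0"
  show "antimono_on {x..y} omega"
  proof (rule monotone_onI)
    fix u v assume uv: "u \<in> {x..y}" "v \<in> {x..y}" "u \<le> v"
    show "omega v \<le> omega u"
    proof (rule DERIV_nonpos_imp_nonincreasing[OF uv(3)])
      fix t assume "u \<le> t" "t \<le> v"
      then have "2 * sin t / sqrt (1 + (sin t)\<^sup>2) \<le> 0" using s[of t] uv sqrt_1_plus_sin_pos(1)[of t] by (simp add: divide_le_0_iff)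
      then show "\<exists>y. (omega has_real_derivative y) (at t) \<and> y \<le> 0" using omega_has_derivative by blast
    qed
  qed
qed

text \<open>The parity of \<open>k\<close> decides which of the two half periods is the positive
  one.\<close>

lemma sin_sign_on_periods:
  fixes k :: int
  shows "(\<forall>t\<in>{of_int k * pi..(of_int k + 1) * pi}. 0 \<le> sin t) \<and> (\<forall>t\<in>{(of_int k + 1) * pi..(of_int k + 2) * pi}. sin t \<le> 0) \<or>
    (\<forall>t\<in>{of_int k * pi..(of_int k + 1) * pi}. sin t \<le> 0) \<and> (\<forall>t\<in>{(of_int k + 1) * pi..(of_int k + 2) * pi}. 0 \<le> sin t)"
proof -
  have per: "sin t = sin (t - 2 * pi * of_int j)" for t :: real and j :: int
    by (simp add: sin_diff cos_int_2pin sin_int_2pin)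
  have pos: "0 \<le> sin t" if "2 * pi * of_int j \<le> t" "t \<le> 2 * pi * of_int j + pi" for t :: real and j :: int
    unfolding per[of t j] using that by (intro sin_ge_zero) auto
  have neg: "sin t \<le> 0" if "2 * pi * of_int j + pi \<le> t" "t \<le> 2 * pi * of_int j + 2 * pi" for t :: real and j :: int
  proof -
    have "0 \<le> sin (t - 2 * pi * of_int j - pi)" using that by (intro sin_ge_zero) auto
    then show ?thesis unfolding per[of t j] by simp
  qed
  obtain j where "k = 2 * j \<or> k = 2 * j + 1" by (metis evenE oddE)
  then show ?thesis
  proof
    assume "k = 2 * j"
    then show ?thesis using pos[of j] neg[of j] by (intro disjI1) (auto simp: algebra_simps)
  next
    assume "k = 2 * j + 1"
    then show ?thesis using neg[of j] pos[of "j + 1"] by (intro disjI2) (auto simp: algebra_simps)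
  qed
qed

lemma rect_elastica_has_vector_derivative:
  "(rect_elastica has_vector_derivative cis (omega t) / of_real (sqrt (1 + (sin t)\<^sup>2))) (at t)"
proof -
  have "((\<lambda>t. Re (rect_elastica t)) has_real_derivative Re (cis (omega t) / of_real (sqrt (1 + (sin t)\<^sup>2)))) (at t)"
    using sqrt_1_plus_sin_pos(1)[of t] by (simp add: rect_elastica_def cos_omega DERIV_sin)
  moreover have "((\<lambda>t. Im (rect_elastica t)) has_real_derivative Im (cis (omega t) / of_real (sqrt (1 + (sin t)\<^sup>2)))) (at t)"
    using elastica_xi_has_derivative[of t] by (simp add: rect_elastica_def sin_omega)
  ultimately show ?thesis by (simp add: has_vector_derivative_complex_iff)
qed

text \<open>The curvature of \<open>R\<close> is \<open>2 sin t\<close>; the scale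
  \<open>2 / m\<close> turns it into \<open>m sin t\<close>. The rotation makes the chord real, and
  the translation puts the start at 0.\<close>

definition elastica_curve :: "real \<Rightarrow> real \<Rightarrow> real \<Rightarrow> real \<Rightarrow> curve" where
  "elastica_curve g m t1 t2 = affine_image (of_real (2 / m) * cis (g - pi))
     (- (of_real (2 / m) * cis (g - pi) * rect_elastica t1)) (rect_elastica_on t1 t2)"

lemma elastica_curve_in_S_curves:
  assumes arc: "elastica_arc a b g m t1 t2"
  defines "f \<equiv> snd (snd (elastica_curve g m t1 t2))"
  shows "elastica_curve g m t1 t2 = (t1, t2, f)" "is_curve (t1, t2, f)"
    "\<And>t. t \<in> {t1..t2} \<Longrightarrow> deriv_on t1 t2 f t = of_real (2 / (m * sqrt (1 + (sin t)\<^sup>2))) * cis (g - pi + omega t)"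
    "(t1, t2, f) \<in> S_curves a b"
proof -
  let ?c = "of_real (2 / m) * cis (g - pi)"
  have m: "0 < m" "t1 < t2" and ab: "a = g - pi + omega t1" "b = g - pi + omega t2"
    and chord: "sin t2 - sin t1 = - (m / 2) * cos g" "elastica_xi t2 - elastica_xi t1 = m / 2 * sin g"
    using arc by (auto simp: elastica_arc_def)
  show eq: "elastica_curve g m t1 t2 = (t1, t2, f)"
    by (simp add: f_def elastica_curve_def rect_elastica_on_def)
  have f: "f = restrict (\<lambda>t. ?c * restrict rect_elastica {t1..t2} t + - (?c * rect_elastica t1)) {t1..t2}"
    by (simp add: f_def elastica_curve_def rect_elastica_on_def)
  have f_eq: "f t = ?c * rect_elastica t - ?c * rect_elastica t1" if "t \<in> {t1..t2}" for t
    using that by (simp add: f)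
  let ?D = "\<lambda>t. of_real (2 / (m * sqrt (1 + (sin t)\<^sup>2))) * cis (g - pi + omega t)"
  have df: "(f has_vector_derivative ?D t) (at t within {t1..t2})" if t: "t \<in> {t1..t2}" for t
  proof -
    have "((\<lambda>t. ?c * rect_elastica t - ?c * rect_elastica t1) has_vector_derivative
        ?c * (cis (omega t) / of_real (sqrt (1 + (sin t)\<^sup>2))) - 0) (at t within {t1..t2})"
      by (intro has_vector_derivative_diff has_vector_derivative_mult_right has_vector_derivative_const
          has_vector_derivative_at_within[OF rect_elastica_has_vector_derivative])
    moreover have "?c * (cis (omega t) / of_real (sqrt (1 + (sin t)\<^sup>2))) - 0 = ?D t"
      unfolding cis_mult[of "g - pi" "omega t", symmetric] by (simp add: field_simps)
    ultimately have "((\<lambda>t. ?c * rect_elastica t - ?c * rect_elastica t1) has_vector_derivative ?D t) (at t within {t1..t2})"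
      by (rule has_vector_derivative_eq_rhs)
    then show ?thesis
      using has_vector_derivative_within_cong[of "{t1..t2}" f "\<lambda>t. ?c * rect_elastica t - ?c * rect_elastica t1" t "?D t"] f_eq t
      by blast
  qed
  show D: "deriv_on t1 t2 f t = ?D t" if "t \<in> {t1..t2}" for t
    by (rule deriv_on_eqI[OF m(2) that df[OF that]])
  have r: "0 < 2 / (m * sqrt (1 + (sin t)\<^sup>2))" for t using m sqrt_1_plus_sin_pos(1)[of t] by simp
  have norm: "norm (deriv_on t1 t2 f t) = 2 / (m * sqrt (1 + (sin t)\<^sup>2))" if "t \<in> {t1..t2}" for t
    unfolding D[OF that] norm_mult norm_cis norm_of_real using r[of t] by simp
  have ac: "absolutely_continuous_on {t1..t2} (deriv_on t1 t2 f)"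
  proof -
    \<comment> \<open>\<open>q\<close> is the speed of \<open>rect_elastica\<close>. It splits the
      derivative of \<open>f\<close> into continuously differentiable factors, so that this
      derivative is Lipschitz on the compact interval.\<close>
    define q where "q t = inverse (sqrt (1 + (sin t)\<^sup>2))" for t
    have dq: "(q has_real_derivative - ((q t) ^ 3 * (sin t * cos t))) (at t)" for t
    proof -
      have nz: "sqrt (1 + (sin t)\<^sup>2) \<noteq> 0" "0 < 1 + (sin t)\<^sup>2" using sqrt_1_plus_sin_pos[of t] by auto
      have d1: "((\<lambda>t. 1 + (sin t)\<^sup>2) has_real_derivative 2 * (sin t * cos t)) (at t)"
        by (auto intro!: derivative_eq_intros)
      have e: "- (inverse r / 2 * (2 * z) * inverse (r ^ Suc (Suc 0))) = - (inverse r ^ 3 * z)" for r z :: real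
        by (simp add: power3_eq_cube)
      show ?thesis
        unfolding q_def by (rule DERIV_cong[OF DERIV_inverse_fun[OF DERIV_chain2[OF DERIV_real_sqrt[OF nz(2)] d1] nz(1)] e])
    qed
    have d\<omega>: "((\<lambda>t. g - pi + omega t) has_real_derivative 2 * sin t * q t) (at t)" for t
      using DERIV_add[OF DERIV_const[of "g - pi"] omega_has_derivative[of t]] by (simp add: q_def divide_inverse)
    let ?D' = "\<lambda>t. of_real (2 / m) * (of_real (q t) * (of_real (2 * sin t * q t) * (\<i> * cis (g - pi + omega t)))
        + of_real (- ((q t) ^ 3 * (sin t * cos t))) * cis (g - pi + omega t))"
    have "((\<lambda>t. of_real (2 / m) * (of_real (q t) * cis (g - pi + omega t))) has_vector_derivative ?D' t) (at t)" for t
    proof (intro has_vector_derivative_mult_right has_vector_derivative_mult)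
      show "((\<lambda>t. complex_of_real (q t)) has_vector_derivative complex_of_real (- ((q t) ^ 3 * (sin t * cos t)))) (at t)"
        unfolding has_vector_derivative_complex_iff Re_complex_of_real Im_complex_of_real using dq[of t] by simp
      show "((\<lambda>t. cis (g - pi + omega t)) has_vector_derivative of_real (2 * sin t * q t) * (\<i> * cis (g - pi + omega t))) (at t)"
        by (rule cis_has_vector_derivative[OF d\<omega>])
    qed
    moreover have cq: "continuous_on S q" for S
      by (rule DERIV_continuous_on[OF has_field_derivative_at_within[OF dq]])
    have "continuous_on {t1..t2} ?D'"
      by (intro continuous_intros cq continuous_on_omega)
    ultimately have "absolutely_continuous_on {t1..t2} (\<lambda>t. of_real (2 / m) * (of_real (q t) * cis (g - pi + omega t)) :: complex)"
      by (intro C1_imp_absolutely_continuous_on[where f' = ?D']) (auto intro: has_vector_derivative_at_within)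
    then show ?thesis
    proof (rule absolutely_continuous_on_dominated[of _ _ 1 1])
      have "deriv_on t1 t2 f t = of_real (2 / m) * (of_real (q t) * cis (g - pi + omega t))" if "t \<in> {t1..t2}" for t
        unfolding D[OF that] q_def by (simp add: divide_inverse)
      then show "norm (deriv_on t1 t2 f x - deriv_on t1 t2 f y) \<le> 1 * norm (of_real (2 / m) * (of_real (q x) * cis (g - pi + omega x)) -
          of_real (2 / m) * (of_real (q y) * cis (g - pi + omega y)) :: complex)" if "x \<in> {t1..t2}" "y \<in> {t1..t2}" for x y
        using that by simp
    qed auto
  qed
  show curve: "is_curve (t1, t2, f)"
    unfolding is_curve.simps
  proof (intro conjI ballI)
    show "f differentiable_on {t1..t2}"
      unfolding differentiable_on_def using differentiableI_vector[OF df] by blast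
    show "f \<in> extensional {t1..t2}" by (simp add: f)
    show "deriv_on t1 t2 f t \<noteq> 0" if "t \<in> {t1..t2}" for t using norm[OF that] r[of t] by auto
  qed (use m ac in auto)
  have unit: "deriv_on t1 t2 f t / of_real (norm (deriv_on t1 t2 f t)) = cis (g - pi + omega t)" if "t \<in> {t1..t2}" for t
    unfolding norm[OF that] unfolding D[OF that]
    by (rule nonzero_mult_div_cancel_left) (metis r[of t] less_irrefl of_real_eq_0_iff)
  have angle: "tangent_angle (t1, t2, f) (\<lambda>t. g - pi + omega t)"
    unfolding tangent_angle.simps
  proof (intro conjI ballI)
    show "continuous_on {t1..t2} (\<lambda>t. g - pi + omega t)" by (intro continuous_intros continuous_on_omega)
    fix t assume t: "t \<in> {t1..t2}"
    show "deriv_on t1 t2 f t = of_real (norm (deriv_on t1 t2 f t)) * cis (g - pi + omega t)"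
      unfolding norm[OF t] unfolding D[OF t] ..
  qed
  obtain k :: int where k: "of_int k * pi \<le> t1" "t2 \<le> (of_int k + 2) * pi"
    using arc by (auto simp: elastica_arc_def)
  \<comment> \<open>On the arc the curvature \<open>m sin t\<close> can change sign only at
    \<open>(k + 1) \<pi>\<close>. If this point is outside the interval, clamping makes one of the
    two parts a single point, which is monotone in either sense.\<close>
  define d where "d = max t1 (min t2 ((of_int k + 1) * pi))"
  have d: "d \<in> {t1..t2}" using m by (auto simp: d_def)
  have sub1: "t \<in> {of_int k * pi..(of_int k + 1) * pi}" if "t \<in> {t1..d}" "d \<noteq> t1" for t
    using that k by (auto simp: d_def max_def min_def split: if_splits)
  have sub2: "t \<in> {(of_int k + 1) * pi..(of_int k + 2) * pi}" if "t \<in> {d..t2}" "d \<noteq> t2" for t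
    using that k by (auto simp: d_def max_def min_def split: if_splits)
  have up1: "mono_on {t1..d} omega" if "\<forall>t\<in>{of_int k * pi..(of_int k + 1) * pi}. 0 \<le> sin t"
  proof (cases "d = t1")
    case True
    then show ?thesis by (simp add: monotone_on_def)
  next
    case False
    show ?thesis by (rule omega_monotone_on(1)) (use that sub1[OF _ False] in blast)
  qed
  have down1: "antimono_on {t1..d} omega" if "\<forall>t\<in>{of_int k * pi..(of_int k + 1) * pi}. sin t \<le> 0"
  proof (cases "d = t1")
    case True
    then show ?thesis by (simp add: monotone_on_def)
  next
    case False
    show ?thesis by (rule omega_monotone_on(2)) (use that sub1[OF _ False] in blast)
  qed
  have up2: "mono_on {d..t2} omega" if "\<forall>t\<in>{(of_int k + 1) * pi..(of_int k + 2) * pi}. 0 \<le> sin t"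
  proof (cases "d = t2")
    case True
    then show ?thesis by (simp add: monotone_on_def)
  next
    case False
    show ?thesis by (rule omega_monotone_on(1)) (use that sub2[OF _ False] in blast)
  qed
  have down2: "antimono_on {d..t2} omega" if "\<forall>t\<in>{(of_int k + 1) * pi..(of_int k + 2) * pi}. sin t \<le> 0"
  proof (cases "d = t2")
    case True
    then show ?thesis by (simp add: monotone_on_def)
  next
    case False
    show ?thesis by (rule omega_monotone_on(2)) (use that sub2[OF _ False] in blast)
  qed
  have "mono_on {t1..d} omega \<and> antimono_on {d..t2} omega \<or> antimono_on {t1..d} omega \<and> mono_on {d..t2} omega"
    using sin_sign_on_periods[of k] up1 up2 down1 down2 by blast
  then have mono: "mono_on {t1..d} (\<lambda>t. g - pi + omega t) \<and> antimono_on {d..t2} (\<lambda>t. g - pi + omega t) \<or>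
      antimono_on {t1..d} (\<lambda>t. g - pi + omega t) \<and> mono_on {d..t2} (\<lambda>t. g - pi + omega t)"
    by (auto simp: monotone_on_def)
  have "is_s_curve (t1, t2, f)"
    unfolding is_s_curve.simps
  proof (intro conjI exI[of _ "\<lambda>t. g - pi + omega t"] bexI[OF _ d])
    show "\<bar>g - pi + omega d - (g - pi + omega t1)\<bar> \<le> pi" "\<bar>g - pi + omega t2 - (g - pi + omega d)\<bar> \<le> pi"
      using omega_bounds[of d] omega_bounds[of t1] omega_bounds[of t2] by auto
  qed (fact curve angle mono)+
  moreover have "f t1 = 0" using f_eq[of t1] m by simp
  moreover have "f t2 = 1"
  proof -
    have R: "rect_elastica t2 - rect_elastica t1 = of_real (m / 2) * - cis (- g)"
      unfolding complex_eq_iff using chord by (simp add: rect_elastica_def)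
    have "f t2 = ?c * (rect_elastica t2 - rect_elastica t1)"
      unfolding right_diff_distrib by (rule f_eq) (use m in simp)
    also have "\<dots> = - (cis (g - pi) * cis (- g))" unfolding R using m by simp
    also have "\<dots> = 1" by (simp add: cis_mult complex_eq_iff)
    finally show ?thesis .
  qed
  ultimately show "(t1, t2, f) \<in> S_curves a b"
    using unit[of t1] unit[of t2] m ab by (simp add: S_curves_def)
qed

text \<open>In arclength the parameter obeys
  \<open>\<tau>' = (m / 2) \<surd>(1 + sin\<^sup>2 \<tau>)\<close>, which cancels the denominator in
  the derivative of \<open>omega\<close> and yields the equations for \<open>\<theta>\<close> and
  \<open>\<kappa>\<close>.\<close>

theorem elastica_curve_solution:
  assumes arc: "elastica_arc a b g m t1 t2"
  shows "\<exists>L F \<theta> \<kappa>. arclength_param (elastica_curve g m t1 t2) = (0, L, F) \<and>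
    elastica_solution a g m (m * sin t1) L F \<theta> \<kappa>"
proof -
  obtain f where eq: "elastica_curve g m t1 t2 = (t1, t2, f)" and curve: "is_curve (t1, t2, f)"
    and D: "\<And>t. t \<in> {t1..t2} \<Longrightarrow> deriv_on t1 t2 f t = of_real (2 / (m * sqrt (1 + (sin t)\<^sup>2))) * cis (g - pi + omega t)"
    and S: "(t1, t2, f) \<in> S_curves a b"
    using elastica_curve_in_S_curves[OF arc] by blast
  have m: "0 < m" "t1 < t2" and ab: "a = g - pi + omega t1" using arc by (auto simp: elastica_arc_def)
  show ?thesis
  proof (rule arclength_param_obtain[OF curve])
    fix L \<tau> F assume F: "arclength_param (t1, t2, f) = (0, L, F)" "0 < L" "arclength (t1, t2, f) = L" "F \<in> extensional {0..L}"
      and \<tau>: "\<tau> 0 = t1" "\<tau> L = t2" "\<And>s. s \<in> {0..L} \<Longrightarrow> \<tau> s \<in> {t1..t2}"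
      "\<And>x y. x \<in> {0..L} \<Longrightarrow> y \<in> {0..L} \<Longrightarrow> x < y \<Longrightarrow> \<tau> x < \<tau> y"
      "\<And>t. t \<in> {t1..t2} \<Longrightarrow> \<exists>s\<in>{0..L}. \<tau> s = t"
      "\<exists>C>0. \<forall>x\<in>{0..L}. \<forall>y\<in>{0..L}. \<bar>\<tau> x - \<tau> y\<bar> \<le> C * \<bar>x - y\<bar>"
      and F\<tau>: "\<And>s. s \<in> {0..L} \<Longrightarrow> F s = f (\<tau> s)"
      and d\<tau>: "\<And>s. s \<in> {0..L} \<Longrightarrow> (\<tau> has_real_derivative 1 / norm (deriv_on t1 t2 f (\<tau> s))) (at s within {0..L})"
      and dF: "\<And>s. s \<in> {0..L} \<Longrightarrow>
       (F has_vector_derivative deriv_on t1 t2 f (\<tau> s) / of_real (norm (deriv_on t1 t2 f (\<tau> s)))) (at s within {0..L})"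
    let ?q = "\<lambda>s. sqrt (1 + (sin (\<tau> s))\<^sup>2)"
    have r: "0 < ?q s" "0 < 2 / (m * ?q s)" for s using m sqrt_1_plus_sin_pos(1)[of "\<tau> s"] by simp_all
    have norm: "norm (deriv_on t1 t2 f (\<tau> s)) = 2 / (m * ?q s)" if "s \<in> {0..L}" for s
      unfolding D[OF \<tau>(3)[OF that]] norm_mult norm_cis norm_of_real using r(2)[of s] by simp
    define \<theta> where "\<theta> s = g - pi + omega (\<tau> s)" for s
    define \<kappa> where "\<kappa> s = m * sin (\<tau> s)" for s
    have d\<tau>': "(\<tau> has_real_derivative m * ?q s / 2) (at s within {0..L})" if "s \<in> {0..L}" for s
      using d\<tau>[OF that] unfolding norm[OF that] by simp
    have "elastica_solution a g m (m * sin t1) L F \<theta> \<kappa>"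
      unfolding elastica_solution_def
    proof (intro conjI ballI)
      show "F 0 = 0" "F L = 1" using F\<tau>[of 0] F\<tau>[of L] \<tau>(1,2) F(2) S by (auto simp: S_curves_def)
      show "\<theta> 0 = a" "\<kappa> 0 = m * sin t1" by (simp_all add: \<theta>_def \<kappa>_def \<tau> ab)
      fix s assume s: "s \<in> {0..L}"
      have "deriv_on t1 t2 f (\<tau> s) / of_real (norm (deriv_on t1 t2 f (\<tau> s))) = cis (\<theta> s)"
        unfolding norm[OF s] unfolding D[OF \<tau>(3)[OF s]] \<theta>_def
        by (rule nonzero_mult_div_cancel_left) (metis r(2)[of s] less_irrefl of_real_eq_0_iff)
      then show "(F has_vector_derivative cis (\<theta> s)) (at s within {0..L})" using dF[OF s] by simp
      have "((\<lambda>s. omega (\<tau> s)) has_real_derivative 2 * sin (\<tau> s) / ?q s * (m * ?q s / 2)) (at s within {0..L})"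
        by (rule DERIV_chain2[OF omega_has_derivative d\<tau>'[OF s]])
      from DERIV_add[OF DERIV_const[of "g - pi"] this]
      show "(\<theta> has_real_derivative \<kappa> s) (at s within {0..L})"
        unfolding \<theta>_def[abs_def] \<kappa>_def using r(1)[of s] by (simp add: mult.commute)
      have "((\<lambda>s. sin (\<tau> s)) has_real_derivative cos (\<tau> s) * (m * ?q s / 2)) (at s within {0..L})"
        by (rule DERIV_chain2[OF DERIV_sin d\<tau>'[OF s]])
      from DERIV_cmult[OF this, of m]
      have "(\<kappa> has_real_derivative m * (cos (\<tau> s) * (m * ?q s / 2))) (at s within {0..L})"
        unfolding \<kappa>_def[abs_def] .
      moreover have "\<theta> s - g = omega (\<tau> s) - pi" by (simp add: \<theta>_def)
      then have "cos (\<theta> s - g) = - (cos (\<tau> s) * ?q s)" by (simp add: cos_omega)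
      then have "m * (cos (\<tau> s) * (m * ?q s / 2)) = - (m\<^sup>2 / 2) * cos (\<theta> s - g)"
        by (simp add: power2_eq_square)
      ultimately show "(\<kappa> has_real_derivative - (m\<^sup>2 / 2) * cos (\<theta> s - g)) (at s within {0..L})" by simp
      have "g - \<theta> s = pi - omega (\<tau> s)" by (simp add: \<theta>_def)
      then have "sin (g - \<theta> s) = (sin (\<tau> s))\<^sup>2" by (simp add: sin_omega)
      then show "(\<kappa> s)\<^sup>2 = m\<^sup>2 * sin (g - \<theta> s)" by (simp add: \<kappa>_def power_mult_distrib)
    qed (use F in auto)
    then show ?thesis using F(1) unfolding eq by blast
  qed
qed

section \<open>Energy and uniqueness of solutions\<close>

lemma elastica_solutionD:
  assumes "elastica_solution a g m k0 L F \<theta> \<kappa>" "s \<in> {0..L}"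
  shows "(F has_vector_derivative cis (\<theta> s)) (at s within {0..L})" "(\<theta> has_real_derivative \<kappa> s) (at s within {0..L})"
    "(\<kappa> has_real_derivative - (m\<^sup>2 / 2) * cos (\<theta> s - g)) (at s within {0..L})" "(\<kappa> s)\<^sup>2 = m\<^sup>2 * sin (g - \<theta> s)"
  using assms unfolding elastica_solution_def by blast+

text \<open>By the first integral, the squared curvature is a constant multiple of
  \<open>sin (g - \<theta>)\<close>, whose integral is fixed by the chord.\<close>

lemma elastica_solution_integral:
  assumes sol: "elastica_solution a g m k0 L F \<theta> \<kappa>"
  shows "((\<lambda>s. cis (\<theta> s)) has_integral 1) {0..L}" "((\<lambda>s. (\<kappa> s)\<^sup>2) has_integral m\<^sup>2 * sin g) {0..L}"
proof -
  have L: "0 < L" "F 0 = 0" "F L = 1" using sol by (auto simp: elastica_solution_def)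
  show *: "((\<lambda>s. cis (\<theta> s)) has_integral 1) {0..L}"
    using fundamental_theorem_of_calculus[of 0 L F "\<lambda>s. cis (\<theta> s)"] elastica_solutionD(1)[OF sol] L by simp
  have "((\<lambda>s. m\<^sup>2 * sin (g - \<theta> s)) has_integral m\<^sup>2 * sin g) {0..L}"
    by (intro has_integral_mult_right cis_integral_sin *)
  then show "((\<lambda>s. (\<kappa> s)\<^sup>2) has_integral m\<^sup>2 * sin g) {0..L}"
    by (rule has_integral_eq[rotated]) (use elastica_solutionD(4)[OF sol] in auto)
qed

lemma elastica_solution_energy:
  assumes c: "arclength_param c = (0, L, F)" "arclength c = L" and sol: "elastica_solution a g m k0 L F \<theta> \<kappa>"
  shows "bending_energy c = ennreal (m\<^sup>2 * sin g / 4)" "0 \<le> m\<^sup>2 * sin g"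
proof -
  have "0 < L" using sol by (simp add: elastica_solution_def)
  have "curvature c s = \<kappa> s" if "s \<in> {0..L}" for s
    by (rule curvature_eq[OF c(1) \<open>0 < L\<close> elastica_solutionD(1)[OF sol] that elastica_solutionD(2)[OF sol that]])
  then have *: "((\<lambda>s. (curvature c s)\<^sup>2) has_integral m\<^sup>2 * sin g) {0..L}"
    by (intro has_integral_eq[OF _ elastica_solution_integral(2)[OF sol]]) simp
  then show "bending_energy c = ennreal (m\<^sup>2 * sin g / 4)"
    using bending_energy_eq[OF c(2)] by (simp add: has_integral_integrable integral_unique)
  show "0 \<le> m\<^sup>2 * sin g" by (rule has_integral_nonneg[OF *]) simp
qed

text \<open>The system for \<open>(\<theta>, \<kappa>)\<close> is Lipschitz, in contrast to the
  first integral. A Gronwall argument shows that the squared distance of two solutions, weighted by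
  \<open>exp (- C s)\<close>, cannot grow from its initial value 0; the curves then agree by
  integration.\<close>

lemma elastica_solution_agree:
  assumes sol1: "elastica_solution a g m k0 L1 F1 \<theta>1 \<kappa>1" and sol2: "elastica_solution a g m k0 L2 F2 \<theta>2 \<kappa>2"
    and "L1 \<le> L2" "s \<in> {0..L1}"
  shows "\<theta>1 s = \<theta>2 s" "F1 s = F2 s"
proof -
  have "0 < L1" using sol1 by (simp add: elastica_solution_def)
  have sub: "{0..L1} \<subseteq> {0..L2}" using \<open>L1 \<le> L2\<close> by auto
  have init: "\<theta>1 0 = \<theta>2 0" "\<kappa>1 0 = \<kappa>2 0" "F1 0 = 0" "F2 0 = 0" using sol1 sol2 by (auto simp: elastica_solution_def)
  define x where "x u = \<theta>1 u - \<theta>2 u" for u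
  define y where "y u = \<kappa>1 u - \<kappa>2 u" for u
  \<comment> \<open>The derivative of \<open>x\<^sup>2 + y\<^sup>2\<close> is at most
    \<open>2 \<bar>x\<bar> \<bar>y\<bar> (1 + m\<^sup>2)\<close>, since
    \<open>\<bar>y'\<bar> \<le> m\<^sup>2 \<bar>x\<bar>\<close>.\<close>
  define C where "C = 1 + m\<^sup>2"
  define H where "H u = ((x u)\<^sup>2 + (y u)\<^sup>2) * exp (- C * u)" for u
  define y' where "y' u = - (m\<^sup>2 / 2) * cos (\<theta>1 u - g) - - (m\<^sup>2 / 2) * cos (\<theta>2 u - g)" for u
  have dx: "(x has_real_derivative y u) (at u within {0..L1})"
    and dy: "(y has_real_derivative y' u) (at u within {0..L1})" if u: "u \<in> {0..L1}" for u
  proof -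
    have u2: "u \<in> {0..L2}" using u sub by blast
    note d1 = elastica_solutionD[OF sol1 u] and d2 = elastica_solutionD[OF sol2 u2]
    show "(x has_real_derivative y u) (at u within {0..L1})"
      unfolding x_def y_def by (intro DERIV_diff d1(2) DERIV_subset[OF d2(2) sub])
    show "(y has_real_derivative y' u) (at u within {0..L1})"
      unfolding y_def y'_def by (intro DERIV_diff d1(3) DERIV_subset[OF d2(3) sub])
  qed
  have dH: "(H has_real_derivative (2 * x u * y u + 2 * y u * y' u - C * ((x u)\<^sup>2 + (y u)\<^sup>2)) * exp (- C * u)) (at u within {0..L1})"
    if "u \<in> {0..L1}" for u
  proof -
    have "((\<lambda>u. exp (- C * u)) has_real_derivative exp (- C * u) * - C) (at u within {0..L1})"
      by (auto intro!: derivative_eq_intros)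
    moreover have "((\<lambda>u. (x u)\<^sup>2 + (y u)\<^sup>2) has_real_derivative 2 * x u * y u + 2 * y u * y' u) (at u within {0..L1})"
      by (rule derivative_eq_intros dx[OF that] dy[OF that] refl | simp)+
    ultimately have "(H has_real_derivative (2 * x u * y u + 2 * y u * y' u) * exp (- C * u) + exp (- C * u) * - C * ((x u)\<^sup>2 + (y u)\<^sup>2)) (at u within {0..L1})"
      unfolding H_def[abs_def] by (rule DERIV_mult[rotated, of _ _ _ _ "\<lambda>u. (x u)\<^sup>2 + (y u)\<^sup>2"])
    then show ?thesis by (rule DERIV_cong) (simp add: algebra_simps)
  qed
  have growth: "2 * x u * y u + 2 * y u * y' u \<le> C * ((x u)\<^sup>2 + (y u)\<^sup>2)" for u
  proof -
    have "\<bar>cos (\<theta>1 u - g) - cos (\<theta>2 u - g)\<bar> \<le> norm (cis (\<theta>1 u - g) - cis (\<theta>2 u - g))"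
      using abs_Re_le_cmod[of "cis (\<theta>1 u - g) - cis (\<theta>2 u - g)"] by simp
    also have "\<dots> \<le> 2 * \<bar>x u\<bar>" using norm_cis_diff_le[of "\<theta>1 u - g" "\<theta>2 u - g"] by (simp add: x_def)
    finally have "m\<^sup>2 / 2 * \<bar>cos (\<theta>1 u - g) - cos (\<theta>2 u - g)\<bar> \<le> m\<^sup>2 / 2 * (2 * \<bar>x u\<bar>)"
      by (rule mult_left_mono) simp
    moreover have "\<bar>y' u\<bar> = m\<^sup>2 / 2 * \<bar>cos (\<theta>1 u - g) - cos (\<theta>2 u - g)\<bar>"
    proof -
      have "y' u = - (m\<^sup>2 / 2 * (cos (\<theta>1 u - g) - cos (\<theta>2 u - g)))" by (simp add: y'_def algebra_simps)
      then show ?thesis by (simp add: abs_mult)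
    qed
    ultimately have y': "\<bar>y' u\<bar> \<le> m\<^sup>2 * \<bar>x u\<bar>" by simp
    have "2 * x u * y u \<le> 2 * \<bar>x u\<bar> * \<bar>y u\<bar>" using abs_ge_self[of "x u * y u"] by (simp add: abs_mult)
    moreover have "2 * y u * y' u \<le> 2 * \<bar>y u\<bar> * \<bar>y' u\<bar>" using abs_ge_self[of "y u * y' u"] by (simp add: abs_mult)
    moreover have "2 * \<bar>y u\<bar> * \<bar>y' u\<bar> \<le> 2 * \<bar>y u\<bar> * (m\<^sup>2 * \<bar>x u\<bar>)" using y' by (intro mult_left_mono) auto
    ultimately have "2 * x u * y u + 2 * y u * y' u \<le> C * (2 * \<bar>x u\<bar> * \<bar>y u\<bar>)" by (simp add: C_def algebra_simps)
    also have "\<dots> \<le> C * ((x u)\<^sup>2 + (y u)\<^sup>2)"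
      using sum_squares_bound[of "\<bar>x u\<bar>" "\<bar>y u\<bar>"] by (intro mult_left_mono) (auto simp: C_def)
    finally show ?thesis .
  qed
  have zero: "x s = 0" if s: "s \<in> {0..L1}" for s
  proof -
    have "- H 0 \<le> - H s"
    proof (rule DERIV_nonneg_imp_increasing_open[where f = "\<lambda>u. - H u"])
      show "0 \<le> s" using s by simp
      fix u assume u: "0 < u" "u < s"
      then have "u \<in> {0..L1}" "at u within {0..L1} = at u" using s by (auto intro!: at_within_interior)
      then have "((\<lambda>u. - H u) has_real_derivative - ((2 * x u * y u + 2 * y u * y' u - C * ((x u)\<^sup>2 + (y u)\<^sup>2)) * exp (- C * u))) (at u)"
        using DERIV_minus[OF dH[of u]] by simp
      moreover have "0 \<le> - ((2 * x u * y u + 2 * y u * y' u - C * ((x u)\<^sup>2 + (y u)\<^sup>2)) * exp (- C * u))"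
        using growth[of u] by (simp add: mult_le_0_iff)
      ultimately show "\<exists>d. ((\<lambda>u. - H u) has_real_derivative d) (at u) \<and> 0 \<le> d" by blast
    next
      have "continuous_on {0..L1} H" using dH by (rule DERIV_continuous_on)
      then show "continuous_on {0..s} (\<lambda>u. - H u)"
        by (intro continuous_on_minus) (rule continuous_on_subset, use s in auto)
    qed
    then have "((x s)\<^sup>2 + (y s)\<^sup>2) * exp (- C * s) \<le> 0" by (simp add: H_def x_def y_def init)
    then have "(x s)\<^sup>2 + (y s)\<^sup>2 \<le> 0" by (simp add: mult_le_0_iff)
    then show ?thesis by (simp add: sum_power2_le_zero_iff)
  qed
  then show \<theta>: "\<theta>1 s = \<theta>2 s" using \<open>s \<in> {0..L1}\<close> by (simp add: x_def)
  have "((\<lambda>u. cis (\<theta>1 u)) has_integral F1 s - F1 0) {0..s}"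
  proof (rule fundamental_theorem_of_calculus)
    show "(F1 has_vector_derivative cis (\<theta>1 u)) (at u within {0..s})" if "u \<in> {0..s}" for u
      by (rule has_vector_derivative_within_subset[OF elastica_solutionD(1)[OF sol1]])
        (use that \<open>s \<in> {0..L1}\<close> in auto)
  qed (use \<open>s \<in> {0..L1}\<close> in auto)
  moreover have "((\<lambda>u. cis (\<theta>1 u)) has_integral F2 s - F2 0) {0..s}"
  proof -
    have "((\<lambda>u. cis (\<theta>2 u)) has_integral F2 s - F2 0) {0..s}"
    proof (rule fundamental_theorem_of_calculus)
      show "(F2 has_vector_derivative cis (\<theta>2 u)) (at u within {0..s})" if "u \<in> {0..s}" for u
        by (rule has_vector_derivative_within_subset[OF elastica_solutionD(1)[OF sol2]])
          (use that \<open>s \<in> {0..L1}\<close> \<open>L1 \<le> L2\<close> in auto)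
    qed (use \<open>s \<in> {0..L1}\<close> in auto)
    then show ?thesis
      by (rule has_integral_eq[rotated]) (use zero \<open>s \<in> {0..L1}\<close> in \<open>auto simp: x_def\<close>)
  qed
  ultimately have "F1 s - F1 0 = F2 s - F2 0" by (rule has_integral_unique)
  then show "F1 s = F2 s" using init by simp
qed

text \<open>Both solutions have the same chord, so the nonnegative function
  \<open>sin (g - \<theta>2)\<close> has integral 0 over an excess interval \<open>[L1, L2]\<close>
  and vanishes there. Then \<open>\<kappa>2\<close> vanishes too, and its differential equation
  forces the cosine of the same angle to be 0.\<close>

lemma elastica_solution_length_le:
  assumes sol1: "elastica_solution a g m k0 L1 F1 \<theta>1 \<kappa>1" and sol2: "elastica_solution a g m k0 L2 F2 \<theta>2 \<kappa>2"
    and "0 < m"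
  shows "L2 \<le> L1"
proof (rule ccontr)
  assume "\<not> L2 \<le> L1"
  then have "L1 < L2" by simp
  have "0 < L1" using sol1 by (simp add: elastica_solution_def)
  have "((\<lambda>u. sin (g - \<theta>1 u)) has_integral sin g) {0..L1}"
    by (rule cis_integral_sin[OF elastica_solution_integral(1)[OF sol1]])
  then have 1: "((\<lambda>u. sin (g - \<theta>2 u)) has_integral sin g) {0..L1}"
    by (rule has_integral_eq[rotated]) (use elastica_solution_agree(1)[OF sol1 sol2] \<open>L1 < L2\<close> in simp)
  have 2: "((\<lambda>u. sin (g - \<theta>2 u)) has_integral sin g) {0..L2}"
    by (rule cis_integral_sin[OF elastica_solution_integral(1)[OF sol2]])
  have cont: "continuous_on {0..L2} \<theta>2" using elastica_solutionD(2)[OF sol2] by (rule DERIV_continuous_on)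
  have cont': "continuous_on {L1..L2} (\<lambda>u. sin (g - \<theta>2 u))"
    using \<open>0 < L1\<close> by (intro continuous_intros continuous_on_subset[OF cont]) auto
  have "integral {0..L1} (\<lambda>u. sin (g - \<theta>2 u)) + integral {L1..L2} (\<lambda>u. sin (g - \<theta>2 u)) = integral {0..L2} (\<lambda>u. sin (g - \<theta>2 u))"
    using \<open>0 < L1\<close> \<open>L1 < L2\<close> 2 by (intro Henstock_Kurzweil_Integration.integral_combine) auto
  then have "integral {L1..L2} (\<lambda>u. sin (g - \<theta>2 u)) = 0" using 1 2 by (simp add: integral_unique)
  moreover have "0 \<le> sin (g - \<theta>2 u)" if "u \<in> {L1..L2}" for u
  proof -
    have "0 \<le> m\<^sup>2 * sin (g - \<theta>2 u)" using elastica_solutionD(4)[OF sol2, of u] that \<open>0 < L1\<close> by (metis atLeastAtMost_iff less_imp_le order_trans zero_le_power2)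
    then show ?thesis using \<open>0 < m\<close> by (simp add: zero_le_mult_iff)
  qed
  ultimately have sin0: "sin (g - \<theta>2 u) = 0" if "u \<in> {L1..L2}" for u
    using integral_eq_0_iff[OF cont' \<open>L1 < L2\<close>] that by blast
  then have \<kappa>0: "\<kappa>2 u = 0" if "u \<in> {L1..L2}" for u
    using elastica_solutionD(4)[OF sol2, of u] that \<open>0 < L1\<close> by auto
  define u where "u = (L1 + L2) / 2"
  have u: "u \<in> {0..L2}" "L1 < u" "u < L2" using \<open>L1 < L2\<close> \<open>0 < L1\<close> by (auto simp: u_def)
  have "at u within {0..L2} = at u" using u \<open>0 < L1\<close> by (intro at_within_interior) auto
  then have d: "(\<kappa>2 has_real_derivative - (m\<^sup>2 / 2) * cos (\<theta>2 u - g)) (at u)"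
    using elastica_solutionD(3)[OF sol2 u(1)] by simp
  have "((\<lambda>_. 0) has_real_derivative - (m\<^sup>2 / 2) * cos (\<theta>2 u - g)) (at u)"
    by (rule has_field_derivative_transform_within_open[OF d, of "{L1<..<L2}"]) (use u \<kappa>0 in auto)
  then have "- (m\<^sup>2 / 2) * cos (\<theta>2 u - g) = 0" using DERIV_unique DERIV_const by blast
  then have "cos (\<theta>2 u - g) = 0" using \<open>0 < m\<close> by simp
  moreover have "sin (\<theta>2 u - g) = 0" using sin0[of u] u by (metis atLeastAtMost_iff less_imp_le minus_diff_eq neg_equal_0_iff_equal sin_minus)
  ultimately show False using sin_cos_squared_add[of "\<theta>2 u - g"] by simp
qed

theorem elastica_solution_unique:
  assumes sol1: "elastica_solution a g m k0 L1 F1 \<theta>1 \<kappa>1" and sol2: "elastica_solution a g m k0 L2 F2 \<theta>2 \<kappa>2" and "0 < m"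
  shows "L1 = L2" "F1 = F2"
proof -
  show L: "L1 = L2"
    using elastica_solution_length_le[OF sol1 sol2 \<open>0 < m\<close>] elastica_solution_length_le[OF sol2 sol1 \<open>0 < m\<close>] by simp
  show "F1 = F2"
  proof (rule extensionalityI)
    show "F1 \<in> extensional {0..L1}" "F2 \<in> extensional {0..L1}" using sol1 sol2 L by (auto simp: elastica_solution_def)
    show "F1 s = F2 s" if "s \<in> {0..L1}" for s using elastica_solution_agree(2)[OF sol1 sol2 _ that] L by simp
  qed
qed

section \<open>Regularity of minimizers\<close>

lemma C_k_2_of_continuous_curvature:
  assumes "0 < L" and dF: "\<And>s. s \<in> {0..L} \<Longrightarrow> (F has_vector_derivative cis (\<theta> s)) (at s within {0..L})"
    and d\<theta>: "\<And>s. s \<in> {0..L} \<Longrightarrow> (\<theta> has_real_derivative \<kappa> s) (at s within {0..L})" and \<kappa>: "continuous_on {0..L} \<kappa>"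
  shows "C_k 2 (0, L, F)"
proof -
  have d1: "deriv_on 0 L F s = cis (\<theta> s)" if "s \<in> {0..L}" for s
    by (rule deriv_on_cis(1)[OF assms(1) _ that]) (rule dF)
  have d2: "deriv_on 0 L (deriv_on 0 L F) s = of_real (\<kappa> s) * (\<i> * cis (\<theta> s))" if "s \<in> {0..L}" for s
    by (rule deriv_on_cis(2)[OF assms(1) _ that d\<theta>[OF that]]) (rule dF)
  have dd: "(deriv_on 0 L F has_vector_derivative of_real (\<kappa> s) * (\<i> * cis (\<theta> s))) (at s within {0..L})" if "s \<in> {0..L}" for s
    using has_vector_derivative_within_cong[of "{0..L}" "deriv_on 0 L F" "\<lambda>s. cis (\<theta> s)" s] d1 that
      cis_has_vector_derivative[OF d\<theta>[OF that]] by blast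
  have "continuous_on {0..L} (\<lambda>s. of_real (\<kappa> s) * (\<i> * cis (\<theta> s)))"
    by (intro continuous_intros \<kappa> DERIV_continuous_on[OF d\<theta>])
  then have "continuous_on {0..L} (deriv_on 0 L (deriv_on 0 L F))"
    by (subst continuous_on_cong[OF refl d2])
  moreover have "F differentiable_on {0..L}" "deriv_on 0 L F differentiable_on {0..L}"
    unfolding differentiable_on_def using differentiableI_vector[OF dF] differentiableI_vector[OF dd] by blast+
  ultimately show ?thesis by (simp add: numeral_2_eq_2 less_Suc_eq)
qed

text \<open>A minimizer containing a straight segment has \<open>\<kappa>' = 0\<close> along it, but \<open>\<bar>\<kappa>'\<bar> = m\<^sup>2/2\<close> where an elastic
  arc touches it.\<close>

lemma C_infinity_imp_elastica_ode:
  assumes "0 < L" "0 < m" and dF: "\<And>s. s \<in> {0..L} \<Longrightarrow> (F has_vector_derivative cis (\<theta> s)) (at s within {0..L})"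
    and d\<theta>: "\<And>s. s \<in> {0..L} \<Longrightarrow> (\<theta> has_real_derivative \<kappa> s) (at s within {0..L})"
    and sq: "\<And>s. s \<in> {0..L} \<Longrightarrow> (\<kappa> s)\<^sup>2 = m\<^sup>2 * sin (g - \<theta> s)"
    and sign: "(\<forall>s\<in>{0..L}. \<kappa> s \<le> 0) \<or> (\<forall>s\<in>{0..L}. 0 \<le> \<kappa> s)" and ne: "\<theta> 0 \<noteq> \<theta> L"
    and smooth: "C_infinity (0, L, F)" and s: "s \<in> {0..L}"
  shows "(\<kappa> has_real_derivative - (m\<^sup>2 / 2) * cos (\<theta> s - g)) (at s within {0..L})"
proof -
  define W where "W = deriv_on 0 L (deriv_on 0 L F)"
  define W3 where "W3 = deriv_on 0 L W"
  have W: "W s = of_real (\<kappa> s) * (\<i> * cis (\<theta> s))" if "s \<in> {0..L}" for s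
    unfolding W_def by (rule deriv_on_cis(2)[OF assms(1) _ that d\<theta>[OF that]]) (rule dF)
  have "C_k 3 (0, L, F)" using smooth by (simp add: C_infinity_def)
  then have "\<forall>j<3. (deriv_on 0 L ^^ j) F differentiable_on {0..L}" and "continuous_on {0..L} ((deriv_on 0 L ^^ 3) F)"
    by auto
  then have "(deriv_on 0 L ^^ 2) F differentiable_on {0..L}" "continuous_on {0..L} W3"
    by (auto simp: W3_def W_def numeral_3_eq_3)
  then have W_diff: "W differentiable_on {0..L}" and W3: "continuous_on {0..L} W3"
    by (simp_all add: W_def numeral_2_eq_2)
  have dW: "(W has_vector_derivative W3 s) (at s within {0..L})" if "s \<in> {0..L}" for s
    using W_diff that vector_derivative_works[of W "at s within {0..L}"]
    by (auto simp: differentiable_on_def W3_def deriv_on_def)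
  \<comment> \<open>The curvature is the imaginary part of \<open>cis (- \<theta>)\<close> times the
    second derivative of \<open>F\<close>, so smoothness of \<open>F\<close> gives
    \<open>\<kappa>\<close> a continuous derivative \<open>q\<close>.\<close>
  define Q where "Q s = cis (- \<theta> s) * W3 s + of_real (- \<kappa> s) * (\<i> * cis (- \<theta> s)) * W s" for s
  define q where "q s = Im (Q s)" for s
  have d\<kappa>: "(\<kappa> has_real_derivative q s) (at s within {0..L})" if s: "s \<in> {0..L}" for s
  proof -
    have "((\<lambda>s. cis (- \<theta> s)) has_vector_derivative of_real (- \<kappa> s) * (\<i> * cis (- \<theta> s))) (at s within {0..L})"
      using cis_has_vector_derivative[of "\<lambda>s. - \<theta> s"] DERIV_minus[OF d\<theta>[OF s]] by blast
    then have "((\<lambda>s. cis (- \<theta> s) * W s) has_vector_derivative Q s) (at s within {0..L})"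
      unfolding Q_def by (intro has_vector_derivative_mult dW s)
    then have "((\<lambda>s. Im (cis (- \<theta> s) * W s)) has_real_derivative q s) (at s within {0..L})"
      by (simp only: has_vector_derivative_complex_iff q_def)
    moreover have "Im (cis (- \<theta> s) * W s) = \<kappa> s" if "s \<in> {0..L}" for s
    proof -
      have "cis (- \<theta> s) * W s = of_real (\<kappa> s) * \<i> * (cis (- \<theta> s) * cis (\<theta> s))" unfolding W[OF that] by (simp only: mult_ac)
      also have "cis (- \<theta> s) * cis (\<theta> s) = 1" by (simp add: cis_mult)
      finally show ?thesis by simp
    qed
    ultimately show ?thesis
      using has_field_derivative_transform_within[of "\<lambda>s. Im (cis (- \<theta> s) * W s)" "q s" s "{0..L}" 1 \<kappa>] s by simp
  qed
  have cont\<theta>: "continuous_on {0..L} \<theta>" using d\<theta> by (rule DERIV_continuous_on)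
  have cont\<kappa>: "continuous_on {0..L} \<kappa>" using d\<kappa> by (rule DERIV_continuous_on)
  have contW: "continuous_on {0..L} W" using W_diff by (rule differentiable_imp_continuous_on)
  have contq: "continuous_on {0..L} q"
    unfolding q_def Q_def by (intro continuous_intros cont\<theta> cont\<kappa> contW W3)
  have int: "u \<in> {0..L}" "at u within {0..L} = at u" if "u \<in> {0<..<L}" for u
    using that by (auto intro!: at_within_interior)
  have nz: "q u = - (m\<^sup>2 / 2) * cos (\<theta> u - g)" if u: "u \<in> {0<..<L}" "\<kappa> u \<noteq> 0" for u
  proof -
    note iu = int[OF u(1)]
    have "((\<lambda>u. (\<kappa> u)\<^sup>2 - m\<^sup>2 * sin (g - \<theta> u)) has_real_derivative
        2 * \<kappa> u * q u - m\<^sup>2 * (cos (g - \<theta> u) * (0 - \<kappa> u))) (at u)"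
      using d\<kappa>[OF iu(1)] d\<theta>[OF iu(1)] unfolding iu(2)
      by (intro DERIV_diff DERIV_cmult DERIV_chain2[OF DERIV_sin] DERIV_const) (auto intro!: derivative_eq_intros)
    then have "((\<lambda>_. 0) has_real_derivative 2 * \<kappa> u * q u - m\<^sup>2 * (cos (g - \<theta> u) * (0 - \<kappa> u))) (at u)"
      by (rule has_field_derivative_transform_within_open[of _ _ _ "{0<..<L}"]) (use u sq in auto)
    then have "2 * \<kappa> u * q u - m\<^sup>2 * (cos (g - \<theta> u) * (0 - \<kappa> u)) = 0" using DERIV_unique DERIV_const by blast
    then have "\<kappa> u * (2 * q u + m\<^sup>2 * cos (g - \<theta> u)) = 0" by (simp add: algebra_simps)
    then have "2 * q u + m\<^sup>2 * cos (g - \<theta> u) = 0" using u(2) by simp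
    moreover have "cos (g - \<theta> u) = cos (\<theta> u - g)" by (metis cos_minus minus_diff_eq)
    ultimately show ?thesis by simp
  qed
  \<comment> \<open>Since \<open>\<kappa>\<close> does not change sign, an interior zero is a local
    extremum.\<close>
  have z: "q u = 0" if u: "u \<in> {0<..<L}" "\<kappa> u = 0" for u
  proof -
    have d: "(\<kappa> has_real_derivative q u) (at u)" using d\<kappa>[OF int(1)[OF u(1)]] int(2)[OF u(1)] by simp
    have r: "0 < min u (L - u)" "\<And>v. \<bar>u - v\<bar> < min u (L - u) \<Longrightarrow> v \<in> {0..L}" using u by auto
    from sign show ?thesis
    proof
      assume "\<forall>s\<in>{0..L}. \<kappa> s \<le> 0"
      then show ?thesis using u(2) r by (intro DERIV_local_max[OF d r(1)]) auto
    next
      assume "\<forall>s\<in>{0..L}. 0 \<le> \<kappa> s"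
      then show ?thesis using u(2) r by (intro DERIV_local_min[OF d r(1)]) auto
    qed
  qed
  \<comment> \<open>By the squares of sine and cosine, \<open>\<Phi>\<close> equals
    \<open>m ^ 4 / 4\<close> where the curvature is nonzero, and it is 0 elsewhere. A continuous
    function on an interval cannot take both values and nothing in between.\<close>
  define \<Phi> where "\<Phi> u = (q u)\<^sup>2 + (\<kappa> u) ^ 4 / 4" for u
  have \<Phi>z: "\<Phi> u = 0" if "u \<in> {0<..<L}" "\<kappa> u = 0" for u using z[OF that] that by (simp add: \<Phi>_def)
  have \<Phi>nz: "\<Phi> u = m ^ 4 / 4" if "u \<in> {0<..<L}" "\<kappa> u \<noteq> 0" for u
  proof -
    have "(\<kappa> u) ^ 4 = ((\<kappa> u)\<^sup>2)\<^sup>2" by simp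
    also have "\<dots> = (m\<^sup>2 * sin (g - \<theta> u))\<^sup>2" using sq[OF int(1)[OF that(1)]] by simp
    also have "\<dots> = m ^ 4 * (sin (\<theta> u - g))\<^sup>2" using sin_minus[of "\<theta> u - g"] by (simp add: power_mult_distrib)
    finally have k4: "(\<kappa> u) ^ 4 = m ^ 4 * (sin (\<theta> u - g))\<^sup>2" .
    have e: "(- (m\<^sup>2 / 2) * cos (\<theta> u - g))\<^sup>2 = m ^ 4 / 4 * (cos (\<theta> u - g))\<^sup>2"
      by (simp add: power_mult_distrib power_divide)
    show ?thesis
      unfolding \<Phi>_def nz[OF that] k4 e by (simp add: sin_squared_eq right_diff_distrib diff_divide_distrib)
  qed
  have "\<exists>u\<in>{0<..<L}. \<kappa> u \<noteq> 0"
  proof (rule ccontr)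
    assume "\<not> (\<exists>u\<in>{0<..<L}. \<kappa> u \<noteq> 0)"
    then have "(\<theta> has_real_derivative 0) (at u)" if "0 < u" "u < L" for u
      using d\<theta>[of u] int[of u] that by auto
    then have "\<theta> L = \<theta> 0" using cont\<theta> \<open>0 < L\<close> by (intro DERIV_isconst_end) auto
    then show False using ne by simp
  qed
  then obtain u1 where u1: "u1 \<in> {0<..<L}" "\<kappa> u1 \<noteq> 0" by blast
  have all_nz: "\<kappa> u \<noteq> 0" if u: "u \<in> {0<..<L}" for u
  proof
    assume "\<kappa> u = 0"
    have "continuous_on {0<..<L} \<Phi>"
      unfolding \<Phi>_def by (intro continuous_intros continuous_on_subset[OF contq] continuous_on_subset[OF cont\<kappa>]) auto
    then have "connected (\<Phi> ` {0<..<L})" by (rule connected_continuous_image) (rule connected_Ioo)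
    moreover have "0 \<in> \<Phi> ` {0<..<L}" using \<Phi>z[OF u \<open>\<kappa> u = 0\<close>] u by (metis imageI)
    moreover have "m ^ 4 / 4 \<in> \<Phi> ` {0<..<L}" using \<Phi>nz[OF u1] u1 by (metis imageI)
    ultimately have "{0..m ^ 4 / 4} \<subseteq> \<Phi> ` {0<..<L}" by (rule connected_contains_Icc)
    then have "m ^ 4 / 8 \<in> \<Phi> ` {0<..<L}" using \<open>0 < m\<close> by auto
    then obtain v where v: "v \<in> {0<..<L}" "\<Phi> v = m ^ 4 / 8" by (metis imageE)
    then show False using \<Phi>z[OF v(1)] \<Phi>nz[OF v(1)] \<open>0 < m\<close> by (cases "\<kappa> v = 0") auto
  qed
  have "q s - - (m\<^sup>2 / 2) * cos (\<theta> s - g) = 0"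
  \<comment> \<open>The identity is known inside the interval; continuity carries it to the
    ends.\<close>
  proof (rule continuous_constant_on_closure[of "{0<..<L}" "\<lambda>s. q s - - (m\<^sup>2 / 2) * cos (\<theta> s - g)"])
    show "continuous_on (closure {0<..<L}) (\<lambda>s. q s - - (m\<^sup>2 / 2) * cos (\<theta> s - g))"
      using \<open>0 < L\<close> by (simp only: closure_greaterThanLessThan) (intro continuous_intros contq cont\<theta>)
    show "s \<in> closure {0<..<L}" using s \<open>0 < L\<close> by (simp only: closure_greaterThanLessThan)
  qed (use nz all_nz in simp)
  then have "q s = - (m\<^sup>2 / 2) * cos (\<theta> s - g)" by linarith
  with d\<kappa>[OF s] show ?thesis by (rule DERIV_cong)
qed

section \<open>Minimizers\<close>

lemma S_opt_eq:
  assumes "e \<in> S_opt \<alpha> \<beta>"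
  shows "c \<in> S_opt \<alpha> \<beta> \<longleftrightarrow> c \<in> S_curves \<alpha> \<beta> \<and> arclength_parametrized c \<and> bending_energy c = bending_energy e"
  using assms unfolding S_opt_def by (auto intro: antisym)

text \<open>The energy of one known minimizer \<open>e\<close> pins down that of every other. If the
  value is the one in the calibration bound, each minimizer becomes an equality case.\<close>

lemma S_opt_profile:
  assumes c: "c \<in> S_opt \<alpha> \<beta>" and e: "e \<in> S_opt \<alpha> \<beta>" and E: "bending_energy e = ennreal (E / 4)" "0 \<le> E"
    and \<alpha>\<beta>: "- pi/2 \<le> \<alpha>" "\<alpha> \<le> pi/2" "- pi/2 \<le> \<beta>" "\<beta> \<le> pi/2"
  shows "\<exists>L F \<theta> h. c = (0, L, F) \<and> 0 < L \<and> F \<in> extensional {0..L} \<and> F 0 = 0 \<and> F L = 1 \<and>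
    (\<forall>s\<in>{0..L}. (F has_vector_derivative cis (\<theta> s)) (at s within {0..L})) \<and> s_profile \<alpha> \<beta> L \<theta> h \<and>
    ((\<lambda>u. (h u)\<^sup>2) has_integral E) {0..L}"
proof -
  have S: "c \<in> S_curves \<alpha> \<beta>" and ap: "arclength_parametrized c" and en: "bending_energy c = ennreal (E / 4)"
    using c S_opt_eq[OF e] E by auto
  have "is_curve c" using S by (auto simp: S_curves_def simp del: is_curve.simps)
  then have idem: "arclength_param c = c" using ap by (rule arclength_param_idem)
  show ?thesis
  proof (rule S_curves_profile[OF S \<alpha>\<beta>])
    fix L F \<theta>
    assume F: "arclength_param c = (0, L, F)" "0 < L" "arclength c = L" "F \<in> extensional {0..L}" "F 0 = 0" "F L = 1"
      and dF: "\<And>s. s \<in> {0..L} \<Longrightarrow> (F has_vector_derivative cis (\<theta> s)) (at s within {0..L})"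
      and ac: "absolutely_continuous_on {0..L} \<theta>" and prof: "s_profile \<alpha> \<beta> L \<theta> (curvature c)"
    have int: "(\<lambda>u. (curvature c u)\<^sup>2) integrable_on {0..L}"
      using bending_energy_finite_imp_integrable[OF F(3) prof] en by simp
    have "0 \<le> integral {0..L} (\<lambda>u. (curvature c u)\<^sup>2)" by (rule integral_nonneg[OF int]) simp
    then have "integral {0..L} (\<lambda>u. (curvature c u)\<^sup>2) = E"
      using bending_energy_eq[OF F(3) int] en E(2) by simp
    then have "((\<lambda>u. (curvature c u)\<^sup>2) has_integral E) {0..L}" using int by (simp add: has_integral_integrable_integral)
    moreover have "c = (0, L, F)" using idem F(1) by simp
    ultimately show ?thesis using F dF prof by blast
  qed
qed

text \<open>The arc attains a bound valid for all profiles, so it is minimal. Any other minimizer is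
  an equality case with the same initial angle and initial curvature; whenever the second-order
  equation is available, it solves the same initial value problem as the arc and coincides with
  it.\<close>

theorem S_opt_elastica:
  assumes \<alpha>\<beta>: "- pi/2 \<le> \<alpha>" "\<alpha> \<le> pi/2" "- pi/2 \<le> \<beta>" "\<beta> \<le> pi/2" and opt: "optimal_arc \<alpha> \<beta> g m t1 t2"
  shows "\<exists>c\<in>S_opt \<alpha> \<beta>. C_infinity c \<and> c = arclength_param (elastica_curve g m t1 t2) \<and>
    (\<forall>d\<in>S_opt \<alpha> \<beta>. C_infinity d \<or> \<bar>\<alpha> - \<beta>\<bar> < pi \<longrightarrow> d = c) \<and>
    (\<bar>\<alpha> - \<beta>\<bar> = pi \<longrightarrow> (\<forall>d\<in>S_opt \<alpha> \<beta>. C_k 2 d))"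
proof -
  have arc: "elastica_arc \<alpha> \<beta> g m t1 t2" using opt by (simp add: optimal_arc_def)
  then have "0 < m" by (simp add: elastica_arc_def)
  define C where "C = elastica_curve g m t1 t2"
  define c where "c = arclength_param C"
  have CS: "C \<in> S_curves \<alpha> \<beta>" unfolding C_def using elastica_curve_in_S_curves(1,4)[OF arc] by metis
  obtain L F \<theta> \<kappa> where cL: "arclength_param C = (0, L, F)" and sol: "elastica_solution \<alpha> g m (m * sin t1) L F \<theta> \<kappa>"
    using elastica_curve_solution[OF arc] by (auto simp: C_def)
  have cF: "c = (0, L, F)" by (simp only: c_def cL)
  have arcC: "arclength C = L"
  proof -
    obtain x y f where "C = (x, y, f)" by (cases C)
    then show ?thesis using cL by simp
  qed
  note enC = elastica_solution_energy[OF cL arcC sol]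
  have cS: "c \<in> S_curves \<alpha> \<beta>" "arclength_parametrized c" and en: "bending_energy c = ennreal (m\<^sup>2 * sin g / 4)"
    using arclength_param_in_S_curves[OF CS \<alpha>\<beta>] enC(1) by (simp_all only: c_def)
  have "bending_energy c \<le> bending_energy d" if d: "d \<in> S_curves \<alpha> \<beta>" for d
  proof (cases "bending_energy d = top")
    case False
    show ?thesis
    proof (rule S_curves_profile[OF d \<alpha>\<beta>])
      fix L F \<theta>
      assume L: "arclength d = L" and prof: "s_profile \<alpha> \<beta> L \<theta> (curvature d)"
      have int: "(\<lambda>u. (curvature d u)\<^sup>2) integrable_on {0..L}"
        by (rule bending_energy_finite_imp_integrable[OF L prof False])
      have "m\<^sup>2 * sin g \<le> integral {0..L} (\<lambda>u. (curvature d u)\<^sup>2)" by (rule optimal_arcD(1)[OF opt prof int])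
      then show ?thesis unfolding bending_energy_eq[OF L int] en by (intro ennreal_leI) simp
    qed
  qed simp
  then have c_opt: "c \<in> S_opt \<alpha> \<beta>" using cS by (simp add: S_opt_def)
  have critical: "\<exists>L F \<theta> \<kappa>. d = (0, L, F) \<and> 0 < L \<and> F \<in> extensional {0..L} \<and> F 0 = 0 \<and> F L = 1 \<and> \<theta> 0 = \<alpha> \<and> \<theta> L = \<beta> \<and>
      (\<forall>s\<in>{0..L}. (F has_vector_derivative cis (\<theta> s)) (at s within {0..L})) \<and>
      (\<forall>s\<in>{0..L}. (\<theta> has_real_derivative \<kappa> s) (at s within {0..L})) \<and> continuous_on {0..L} \<kappa> \<and> \<kappa> 0 = m * sin t1 \<and>
      (\<forall>s\<in>{0..L}. (\<kappa> s)\<^sup>2 = m\<^sup>2 * sin (g - \<theta> s)) \<and>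
      (\<bar>\<alpha> - \<beta>\<bar> < pi \<longrightarrow> (\<forall>s\<in>{0..L}. (\<kappa> has_real_derivative - (m\<^sup>2 / 2) * cos (\<theta> s - g)) (at s within {0..L}))) \<and>
      (\<bar>\<alpha> - \<beta>\<bar> = pi \<longrightarrow> (\<forall>s\<in>{0..L}. \<kappa> s \<le> 0) \<or> (\<forall>s\<in>{0..L}. 0 \<le> \<kappa> s))"
    if d: "d \<in> S_opt \<alpha> \<beta>" for d
  proof -
    obtain L F \<theta> h where F: "d = (0, L, F)" "0 < L" "F \<in> extensional {0..L}" "F 0 = 0" "F L = 1"
      and dF: "\<forall>s\<in>{0..L}. (F has_vector_derivative cis (\<theta> s)) (at s within {0..L})" and prof: "s_profile \<alpha> \<beta> L \<theta> h"
      and E: "((\<lambda>u. (h u)\<^sup>2) has_integral m\<^sup>2 * sin g) {0..L}"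
      using S_opt_profile[OF d c_opt en enC(2) \<alpha>\<beta>] by blast
    have "critical_profile \<alpha> \<beta> g m L \<theta> h (m * sin t1) (m * sin t2)"
      by (rule optimal_arcD(2)[OF opt prof has_integral_integrable[OF E] integral_unique[OF E]])
    then obtain \<kappa> where \<kappa>: "continuous_on {0..L} \<kappa>" "negligible {s \<in> {0..L}. h s \<noteq> \<kappa> s}" "\<kappa> 0 = m * sin t1"
      "\<forall>s\<in>{0..L}. (\<kappa> s)\<^sup>2 = m\<^sup>2 * sin (g - \<theta> s)"
      "\<bar>\<alpha> - \<beta>\<bar> < pi \<longrightarrow> (\<forall>s\<in>{0..L}. (\<kappa> has_real_derivative - (m\<^sup>2 / 2) * cos (\<theta> s - g)) (at s within {0..L}))"
      "\<bar>\<alpha> - \<beta>\<bar> = pi \<longrightarrow> (\<forall>s\<in>{0..L}. \<kappa> s \<le> 0) \<or> (\<forall>s\<in>{0..L}. 0 \<le> \<kappa> s)"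
      unfolding critical_profile_def by blast
    have "\<forall>s\<in>{0..L}. (\<theta> has_real_derivative \<kappa> s) (at s within {0..L})"
      using s_profile_continuous_curvature(2)[OF prof \<kappa>(1,2)] by blast
    moreover have "\<theta> 0 = \<alpha>" "\<theta> L = \<beta>" using prof by (auto simp: s_profile_def)
    ultimately show ?thesis using F dF \<kappa> by blast
  qed
  have unique: "d = c" if d: "d \<in> S_opt \<alpha> \<beta>" and "C_infinity d \<or> \<bar>\<alpha> - \<beta>\<bar> < pi" for d
  proof -
    obtain L' F' \<theta>' \<kappa>' where F: "d = (0, L', F')" "0 < L'" "F' \<in> extensional {0..L'}" "F' 0 = 0" "F' L' = 1" "\<theta>' 0 = \<alpha>" "\<theta>' L' = \<beta>"
      and dF: "\<forall>s\<in>{0..L'}. (F' has_vector_derivative cis (\<theta>' s)) (at s within {0..L'})"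
      and d\<theta>: "\<forall>s\<in>{0..L'}. (\<theta>' has_real_derivative \<kappa>' s) (at s within {0..L'})"
      and \<kappa>: "\<kappa>' 0 = m * sin t1" "\<forall>s\<in>{0..L'}. (\<kappa>' s)\<^sup>2 = m\<^sup>2 * sin (g - \<theta>' s)"
        "\<bar>\<alpha> - \<beta>\<bar> < pi \<longrightarrow> (\<forall>s\<in>{0..L'}. (\<kappa>' has_real_derivative - (m\<^sup>2 / 2) * cos (\<theta>' s - g)) (at s within {0..L'}))"
        "\<bar>\<alpha> - \<beta>\<bar> = pi \<longrightarrow> (\<forall>s\<in>{0..L'}. \<kappa>' s \<le> 0) \<or> (\<forall>s\<in>{0..L'}. 0 \<le> \<kappa>' s)"
      using critical[OF d] by blast
    have "\<bar>\<alpha> - \<beta>\<bar> \<le> pi" using \<alpha>\<beta> by auto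
    have "(\<kappa>' has_real_derivative - (m\<^sup>2 / 2) * cos (\<theta>' s - g)) (at s within {0..L'})" if s: "s \<in> {0..L'}" for s
    proof (cases "\<bar>\<alpha> - \<beta>\<bar> < pi")
      case True
      then show ?thesis using \<kappa>(3) s by blast
    next
      case False
      then have "\<bar>\<alpha> - \<beta>\<bar> = pi" using \<open>\<bar>\<alpha> - \<beta>\<bar> \<le> pi\<close> by simp
      then have sign: "(\<forall>s\<in>{0..L'}. \<kappa>' s \<le> 0) \<or> (\<forall>s\<in>{0..L'}. 0 \<le> \<kappa>' s)" and ne: "\<theta>' 0 \<noteq> \<theta>' L'"
        using \<kappa>(4) F pi_gt_zero by auto
      have smooth: "C_infinity (0, L', F')" using \<open>C_infinity d \<or> \<bar>\<alpha> - \<beta>\<bar> < pi\<close> False F(1) by simp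
      show ?thesis
        using dF d\<theta> \<kappa>(2) by (intro C_infinity_imp_elastica_ode[OF F(2) \<open>0 < m\<close> _ _ _ sign ne smooth s]) blast+
    qed
    then have "elastica_solution \<alpha> g m (m * sin t1) L' F' \<theta>' \<kappa>'"
      unfolding elastica_solution_def using F dF d\<theta> \<kappa>(1,2) by blast
    from elastica_solution_unique[OF this sol \<open>0 < m\<close>] show ?thesis by (simp add: F(1) cF)
  qed
  have "C_k 2 d" if d: "d \<in> S_opt \<alpha> \<beta>" for d
  proof -
    obtain L' F' \<theta>' \<kappa>' where F: "d = (0, L', F')" "0 < L'"
      and dF: "\<forall>s\<in>{0..L'}. (F' has_vector_derivative cis (\<theta>' s)) (at s within {0..L'})"
      and d\<theta>: "\<forall>s\<in>{0..L'}. (\<theta>' has_real_derivative \<kappa>' s) (at s within {0..L'})" and \<kappa>: "continuous_on {0..L'} \<kappa>'"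
      using critical[OF d] by blast
    show ?thesis unfolding F(1) using dF d\<theta> by (intro C_k_2_of_continuous_curvature[OF F(2) _ _ \<kappa>]) blast+
  qed
  moreover have "C_infinity c" unfolding cF by (rule elastica_solution_C_infinity[OF sol])
  ultimately show ?thesis using c_opt unique unfolding c_def C_def by blast
qed

text \<open>Energy 0 forces the curvature to vanish almost everywhere, hence the tangent angle is 0
  and the curve is the unit segment. The segment is an elastic solution with \<open>m = 0\<close>,
  which supplies its smoothness and its energy.\<close>

lemma S_opt_straight: "\<exists>c\<in>S_opt 0 0. C_infinity c \<and> (\<forall>d\<in>S_opt 0 0. d = c)"
proof -
  define F :: "real \<Rightarrow> complex" where "F = restrict of_real {0..1}"
  define c where "c = (0 :: real, 1 :: real, F)"
  have F: "F \<in> extensional {0..1}" "F 0 = 0" "F 1 = 1" by (simp_all add: F_def)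
  have dF: "(F has_vector_derivative cis 0) (at s within {0..1})" if "s \<in> {0..1}" for s
  proof -
    have "(complex_of_real has_vector_derivative 1) (at s within {0..1})"
      by (simp add: has_vector_derivative_complex_iff)
    then show ?thesis
      using has_vector_derivative_within_cong[of "{0..1}" F complex_of_real s] that by (simp add: F_def)
  qed
  have sol: "elastica_solution 0 0 0 0 1 F (\<lambda>_. 0) (\<lambda>_. 0)"
    unfolding elastica_solution_def using F dF by simp
  have D: "deriv_on 0 1 F s = 1" if "s \<in> {0..1}" for s
    using deriv_on_eqI[of 0 1 s F "cis 0"] dF[OF that] that by simp
  have curve: "is_curve (0, 1, F)"
    unfolding is_curve.simps
  proof (intro conjI ballI)
    show "F differentiable_on {0..1}" unfolding differentiable_on_def using differentiableI_vector[OF dF] by blast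
    show "absolutely_continuous_on {0..1} (deriv_on 0 1 F)"
      by (rule absolutely_continuous_on_dominated[OF absolutely_continuous_on_id, of 1 1]) (use D in auto)
  qed (use F D in auto)
  have "is_s_curve (0, 1, F)"
    unfolding is_s_curve.simps
  proof (intro conjI exI[of _ "\<lambda>_. 0"] bexI[of _ 0])
    show "tangent_angle (0, 1, F) (\<lambda>_. 0)" using D by simp
  qed (use curve in \<open>auto simp: monotone_on_def simp del: is_curve.simps\<close>)
  then have cS: "c \<in> S_curves 0 0" using F D by (simp add: S_curves_def c_def)
  have ap: "arclength_parametrized c" using D by (simp add: c_def)
  have idem: "arclength_param c = (0, 1, F)" using arclength_param_idem[OF curve] ap by (simp only: c_def)
  then have "arclength c = 1" by (simp add: c_def)
  then have en: "bending_energy c = ennreal (0 / 4)" using elastica_solution_energy(1)[OF idem _ sol] by simp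
  then have c_opt: "c \<in> S_opt 0 0" using cS ap by (simp add: S_opt_def)
  have "d = c" if d: "d \<in> S_opt 0 0" for d
  proof -
    obtain L F' \<theta> h where F': "d = (0, L, F')" "0 < L" "F' \<in> extensional {0..L}" "F' 0 = 0" "F' L = 1"
      and dF': "\<forall>s\<in>{0..L}. (F' has_vector_derivative cis (\<theta> s)) (at s within {0..L})" and prof: "s_profile 0 0 L \<theta> h"
      and E: "((\<lambda>u. (h u)\<^sup>2) has_integral 0) {0..L}"
      using S_opt_profile[OF d c_opt en] by auto
    have neg: "negligible {u \<in> {0..L}. h u \<noteq> 0}"
      using has_integral_0_nonneg_imp_negligible[OF E] by simp
    have \<theta>0: "\<theta> s = 0" if "s \<in> {0..L}" for s
    proof -
      have "((\<lambda>_. 0) has_integral \<theta> s - \<theta> 0) {0..s}"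
        using s_profile_continuous_curvature(1)[OF prof _ neg, of 0 s] that by simp
      moreover have "\<theta> 0 = 0" using prof by (simp add: s_profile_def)
      ultimately show ?thesis by simp
    qed
    have line: "F' s = of_real s" if "s \<in> {0..L}" for s
    proof -
      have "((\<lambda>_. 1) has_integral F' s - F' 0) {0..s}"
      proof (rule fundamental_theorem_of_calculus)
        fix u assume "u \<in> {0..s}"
        then have u: "u \<in> {0..L}" using that by auto
        then have "(F' has_vector_derivative 1) (at u within {0..L})" using dF' \<theta>0[OF u] by force
        then show "(F' has_vector_derivative 1) (at u within {0..s})"
          by (rule has_vector_derivative_within_subset) (use that in auto)
      qed (use that in auto)
      moreover have "((\<lambda>_. 1 :: complex) has_integral of_real s) {0..s}"
        using has_integral_const_real[of "1 :: complex" 0 s] that by (simp add: scaleR_conv_of_real)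
      ultimately have "F' s - F' 0 = of_real s" by (rule has_integral_unique)
      then show ?thesis using F'(4) by simp
    qed
    have "complex_of_real L = of_real 1" using line[of L] F' by simp
    then have "L = 1" by (simp only: of_real_eq_iff)
    moreover have "F' = F"
    proof (rule extensionalityI)
      show "F' \<in> extensional {0..1}" "F \<in> extensional {0..1}" using F' F \<open>L = 1\<close> by simp_all
      show "F' s = F s" if "s \<in> {0..1}" for s using line[of s] that \<open>L = 1\<close> by (simp add: F_def)
    qed
    ultimately show ?thesis using F' by (simp add: c_def)
  qed
  moreover have "C_infinity c" unfolding c_def by (rule elastica_solution_C_infinity[OF sol])
  ultimately show ?thesis using c_opt by blast
qed

theorem theorem3p1:
  fixes \<alpha> \<beta> :: real
  assumes "(\<alpha>, \<beta>) \<in> {-pi/2..pi/2} \<times> {-pi/2..pi/2}"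
  shows "(\<exists>!c. c \<in> S_opt \<alpha> \<beta> \<and> C_infinity c) \<and>
    (\<bar>\<alpha> - \<beta>\<bar> < pi \<longrightarrow> S_opt \<alpha> \<beta> = {c1_curve \<alpha> \<beta>}) \<and>
    (\<bar>\<alpha> - \<beta>\<bar> = pi \<longrightarrow> (\<forall>c\<in>S_opt \<alpha> \<beta>. C_k 2 c)) \<and>
    ((\<alpha>, \<beta>) \<noteq> (0, 0) \<longrightarrow>
      (\<exists>t1 t2. t1 < t2 \<and> t2 < t1 + 2 * pi \<and>
        directly_similar (c1_curve \<alpha> \<beta>) (rect_elastica_on t1 t2)))"
proof -
  have \<alpha>\<beta>: "- pi/2 \<le> \<alpha>" "\<alpha> \<le> pi/2" "- pi/2 \<le> \<beta>" "\<beta> \<le> pi/2" using assms by auto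
  have "\<exists>c\<in>S_opt \<alpha> \<beta>. C_infinity c \<and> (\<forall>d\<in>S_opt \<alpha> \<beta>. C_infinity d \<or> \<bar>\<alpha> - \<beta>\<bar> < pi \<longrightarrow> d = c) \<and>
    (\<bar>\<alpha> - \<beta>\<bar> = pi \<longrightarrow> (\<forall>d\<in>S_opt \<alpha> \<beta>. C_k 2 d)) \<and>
    ((\<alpha>, \<beta>) \<noteq> (0, 0) \<longrightarrow> (\<exists>t1 t2. t1 < t2 \<and> t2 < t1 + 2 * pi \<and> directly_similar c (rect_elastica_on t1 t2)))"
  proof (cases "(\<alpha>, \<beta>) = (0, 0)")
    case True
    then show ?thesis using S_opt_straight pi_neq_zero by auto
  next
    case False
    obtain g m t1 t2 where opt: "optimal_arc \<alpha> \<beta> g m t1 t2"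
      using optimal_arc_exists[OF \<alpha>\<beta> False] by blast
    then have t: "t1 < t2" "t2 < t1 + 2 * pi" "0 < m" by (auto simp: optimal_arc_def elastica_arc_def)
    obtain c where c: "c \<in> S_opt \<alpha> \<beta>" "C_infinity c" "c = arclength_param (elastica_curve g m t1 t2)"
      "\<forall>d\<in>S_opt \<alpha> \<beta>. C_infinity d \<or> \<bar>\<alpha> - \<beta>\<bar> < pi \<longrightarrow> d = c"
      "\<bar>\<alpha> - \<beta>\<bar> = pi \<longrightarrow> (\<forall>d\<in>S_opt \<alpha> \<beta>. C_k 2 d)"
      using S_opt_elastica[OF \<alpha>\<beta> opt] by blast
    have "is_curve c" "arclength_parametrized c"
      using c(1) by (auto simp: S_opt_def S_curves_def simp del: is_curve.simps)
    then have "arclength_param c = c" by (rule arclength_param_idem)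
    then have "equivalent c (elastica_curve g m t1 t2)" using c(3) by (simp only: equivalent_def)
    moreover have "of_real (2 / m) * cis (g - pi) \<noteq> 0" using t by simp
    ultimately have "directly_similar c (rect_elastica_on t1 t2)"
      unfolding directly_similar_def elastica_curve_def by blast
    then show ?thesis using c t by blast
  qed
  then obtain c where c: "c \<in> S_opt \<alpha> \<beta>" "C_infinity c"
    "\<And>d. d \<in> S_opt \<alpha> \<beta> \<Longrightarrow> C_infinity d \<or> \<bar>\<alpha> - \<beta>\<bar> < pi \<Longrightarrow> d = c"
    "\<bar>\<alpha> - \<beta>\<bar> = pi \<longrightarrow> (\<forall>d\<in>S_opt \<alpha> \<beta>. C_k 2 d)"
    "(\<alpha>, \<beta>) \<noteq> (0, 0) \<longrightarrow> (\<exists>t1 t2. t1 < t2 \<and> t2 < t1 + 2 * pi \<and> directly_similar c (rect_elastica_on t1 t2))"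
    by blast
  have "c1_curve \<alpha> \<beta> = c"
    unfolding c1_curve_def using c by (intro the_equality) blast+
  then show ?thesis using c by blast
qed

end
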